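(* Let $p\in(1,+\infty)$. Then the discrete minimization problem $$\text{find } u_h\in V_h \text{ such that } J_h(u_h)=\min_{v_h\in V_h}J_h(v_h)$$ has a solution, where $J_h:V_h\to\mathbb R$ is the discrete energy functional $$J_h(v_h)=\tfrac1p\|D_{DG}(v_h;g_D)\|_{L^p(\Omega)}^p+\tfrac1p\|[\![v_h]\!]\|_{L^p(\Gamma^o,\eta h_e^{1-p})}^p+\tfrac1p\|v_h-g_D\|_{L^p(\Gamma^D,\eta h_e^{1-p})}^p-(f,v_h)_\Omega-\langle \boldsymbol g_N\cdot\boldsymbol n,v_h\rangle_{\Gamma^N}.$$
   Context: Setting. $\frac1p+\frac1{p'}=1$. $\Omega\subset\mathbb R^d$ is a polyhedral open bounded connected set with $\partial\Omega=\Gamma^D\sqcup\Gamma^N$ and $|\Gamma^D|>0$. Data: $f\in L^{p'}(\Omega)\cap W^{-1,p'}(\Omega)$, $g_D\in W^{1/p',p}(\Gamma^D)$, $\boldsymbol g_N\cdot\boldsymbol n\in L^{p'}(\Gamma^N)\cap W^{-1/p',p'}(\Gamma^N)$. $(\cdot,\cdot)_D$ and $\langle\cdot,\cdot\rangle_e$ are the integral pairings on a domain and on a $(d-1)$-dimensional set; $\|v\|_{L^p(S,w)}=(\int_S|v|^p w)^{1/p}$. $\mathbb N$ contains $0$. Mesh. $\mathcal T_h$ is a finite partition of $\Omega$ into simplices $K$; two distinct elements are disjoint or share only part of one common face; each face is interior (distinct elements on both sides) or a boundary face contained in exactly one of $\Gamma^D,\Gamma^N$. $\Gamma^o$ is the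 union of interior faces; $\boldsymbol n$ is the unit outward normal. $h_e>0$ is the shortest normal characteristic length of the face $e$ (e.g. the minimum height over $e$ of the neighboring elements). $\eta>0$ (scalar) and $\boldsymbol C_{12}\in\mathbb R^d$ are constant on each face. Spaces. For fixed $k\in\mathbb N$, $V_h=\bigoplus_{K}\mathcal P^k(K)$ and $Q_h=\Sigma_h=\bigoplus_K(\mathcal P^k(K))^d$ (piecewise polynomials of total degree at most $k$, no continuity imposed). $\nabla_h$ is the elementwise gradient. Jumps and averages. On an interior face shared by $K_1,K_2$ with outward normals $\boldsymbol n_1=-\boldsymbol n_2$: $[\![q]\!]=q_1\boldsymbol n_1+q_2\boldsymbol n_2$, $[\![\boldsymbol\varphi]\!]=\boldsymbol\varphi_1\cdot\boldsymbol n_1+\boldsymbol\varphi_2\cdot\boldsymbol n_2$, and $\{\!\{\cdot\}\!\}$ is the arithmetic mean of the two traces. On a boundary face $[\![q]\!]=q\boldsymbol n$ and $\{\!\{\boldsymbol\varphi\}\!\}=\boldsymbol\varphi$. Discrete gradient. For $v$ in the broken space $W^{1,1}(\mathcal T_h)=\{v: v|_K\in W^{1,1}(K)\ \forall K\}$ and $g\in L^1(\Gamma^D)$, $D_{DG}(v;g)\in Q_h$ is defined by: for all $\boldsymbol\zeta_h\in\Sigma_h$, $$(D_{DG}(v;g),\boldsymbol\zeta_h)_\Omega=(\nabla_hv,\boldsymbol\zeta_h)_\Omega-\langle[\![v]\!],\{\!\{\boldsymbol\zeta_h\}\!\}-\boldsymbol C_{12}[\![\boldsymbol\zeta_h]\!]\rangle_{\Gamma^o}-\langle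 v-g,\boldsymbol\zeta_h\cdot\boldsymbol n\rangle_{\Gamma^D}.$$ *)

theory Defs
  imports "HOL-Analysis.Analysis"
begin

section \<open>Surface measure on polyhedral sets\<close>

text \<open>
  For a hyperplane \<open>H\<close>, the orthogonal projection onto \<open>H\<close> pushes Lebesgue measure on the slab of
  total thickness 1 around \<open>H\<close> forward to the \<open>(d-1)\<close>-dimensional Lebesgue measure of \<open>H\<close>
  (counting measure on the point \<open>H\<close> if \<open>d = 1\<close>).
\<close>

definition hyperplane_measure :: "(real^'n) set \<Rightarrow> (real^'n) measure" where
  "hyperplane_measure H =
     distr (restrict_space lborel {y. infdist y H \<le> 1/2}) borel (closest_point H)"

definition hyperplanes :: "(real^'n) set set" where
  "hyperplanes = {H. affine H \<and> aff_dim H = int CARD('n) - 1}"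

text \<open>
  On a set contained in finitely many hyperplanes, adding up the measures of all hyperplanes gives
  the \<open>(d-1)\<close>-dimensional surface (Hausdorff) measure, because distinct hyperplanes meet in a
  null set of either.
\<close>

definition surface_measure :: "(real^'n) measure" where
  "surface_measure = completion (measure_of UNIV (sets borel)
     (\<lambda>A. \<integral>\<^sup>+ H. emeasure (hyperplane_measure H) A \<partial>count_space hyperplanes))"

lemma emeasure_surface_measure:
  fixes A :: "(real^'n) set"
  assumes A: "A \<in> sets borel"
  shows "emeasure surface_measure A =
           (\<integral>\<^sup>+ H. emeasure (hyperplane_measure H) A \<partial>count_space hyperplanes)"
proof -
  let ?f = "\<lambda>A::(real^'n) set. \<integral>\<^sup>+ H. emeasure (hyperplane_measure H) A \<partial>count_space hyperplanes"
  let ?M = "measure_of UNIV (sets borel) ?f"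
  have sets: "sets ?M = sets borel"
    using sets.sigma_sets_eq[of "borel :: (real^'n) measure"] by simp
  have "emeasure ?M A = ?f A"
  proof (rule emeasure_measure_of[OF refl])
    show "positive (sets ?M) ?f" by (simp add: positive_def)
    show "countably_additive (sets ?M) ?f"
    proof (rule countably_additiveI)
      fix B :: "nat \<Rightarrow> (real^'n) set"
      assume B: "range B \<subseteq> sets ?M" "disjoint_family B"
      have "(\<Sum>i. ?f (B i)) =
          (\<integral>\<^sup>+ H. (\<Sum>i. emeasure (hyperplane_measure H) (B i)) \<partial>count_space hyperplanes)"
        by (rule nn_integral_suminf[symmetric]) simp
      also have "\<dots> = ?f (\<Union>i. B i)"
        using B unfolding sets
        by (intro nn_integral_cong suminf_emeasure) (auto simp: hyperplane_measure_def)
      finally show "(\<Sum>i. ?f (B i)) = ?f (\<Union>i. B i)" .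
    qed
  qed (use A sets in auto)
  then show ?thesis
    unfolding surface_measure_def using A sets by simp
qed

section \<open>Function spaces for the data\<close>

definition in_Lp :: "'a measure \<Rightarrow> real \<Rightarrow> 'a set \<Rightarrow> ('a \<Rightarrow> real) \<Rightarrow> bool" where
  "in_Lp M q S g \<longleftrightarrow>
     set_borel_measurable M S g \<and> set_integrable M S (\<lambda>x. \<bar>g x\<bar> powr q)"

definition gradient :: "(real^'n \<Rightarrow> real) \<Rightarrow> real^'n \<Rightarrow> real^'n" where
  "gradient u x = (\<chi> i. frechet_derivative u (at x) (axis i 1))"

primrec C_order :: "nat \<Rightarrow> (real^'n \<Rightarrow> real) \<Rightarrow> bool" where
  "C_order 0 u \<longleftrightarrow> continuous_on UNIV u"
| "C_order (Suc m) u \<longleftrightarrow>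
     (\<forall>x. u differentiable (at x)) \<and> (\<forall>i. C_order m (\<lambda>x. gradient u x $ i))"

definition test_function :: "(real^'n) set \<Rightarrow> (real^'n \<Rightarrow> real) \<Rightarrow> bool" where
  "test_function \<Omega> \<phi> \<longleftrightarrow> (\<forall>m. C_order m \<phi>) \<and>
     compact (closure {x. \<phi> x \<noteq> 0}) \<and> closure {x. \<phi> x \<noteq> 0} \<subseteq> \<Omega>"

text \<open>
  \<open>g\<close> lies in the dual \<open>W\<^sup>-\<^sup>1\<^sup>,\<^sup>q\<^sup>'(\<Omega>)\<close> of \<open>W\<^sub>0\<^sup>1\<^sup>,\<^sup>q(\<Omega>)\<close>. Boundedness is tested on
  the dense subspace of test functions.
\<close>

definition in_dual_W1_0 :: "real \<Rightarrow> (real^'n) set \<Rightarrow> (real^'n \<Rightarrow> real) \<Rightarrow> bool" where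
  "in_dual_W1_0 q \<Omega> g \<longleftrightarrow> (\<exists>C. \<forall>\<phi>. test_function \<Omega> \<phi> \<longrightarrow>
     set_integrable lebesgue \<Omega> (\<lambda>x. g x * \<phi> x) \<and>
     \<bar>LINT x:\<Omega>|lebesgue. g x * \<phi> x\<bar> \<le>
       C * ((LINT x:\<Omega>|lebesgue. \<bar>\<phi> x\<bar> powr q) +
            (LINT x:\<Omega>|lebesgue. norm (gradient \<phi> x) powr q)) powr (1/q))"

text \<open>The Gagliardo seminorm (to the power \<open>q\<close>) on a \<open>(d-1)\<close>-dimensional set.\<close>

definition gagliardo :: "real \<Rightarrow> real \<Rightarrow> (real^'n) set \<Rightarrow> (real^'n \<Rightarrow> real) \<Rightarrow> ennreal" where
  "gagliardo s q S g =
     (\<integral>\<^sup>+ x. (\<integral>\<^sup>+ y. ennreal (\<bar>g x - g y\<bar> powr q / dist x y powr (real CARD('n) - 1 + s * q))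
        \<partial>restrict_space surface_measure S) \<partial>restrict_space surface_measure S)"

definition in_Ws :: "real \<Rightarrow> real \<Rightarrow> (real^'n) set \<Rightarrow> (real^'n \<Rightarrow> real) \<Rightarrow> bool" where
  "in_Ws s q S g \<longleftrightarrow> in_Lp surface_measure q S g \<and> gagliardo s q S g < \<infinity>"

text \<open>\<open>g\<close> lies in the dual \<open>W\<^sup>-\<^sup>s\<^sup>,\<^sup>q\<^sup>'(S)\<close> of \<open>W\<^sup>s\<^sup>,\<^sup>q(S)\<close>.\<close>

definition in_dual_Ws :: "real \<Rightarrow> real \<Rightarrow> (real^'n) set \<Rightarrow> (real^'n \<Rightarrow> real) \<Rightarrow> bool" where
  "in_dual_Ws s q S g \<longleftrightarrow> (\<exists>C. \<forall>\<phi>. in_Ws s q S \<phi> \<longrightarrow>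
     set_integrable surface_measure S (\<lambda>x. g x * \<phi> x) \<and>
     \<bar>LINT x:S|surface_measure. g x * \<phi> x\<bar> \<le>
       C * ((LINT x:S|surface_measure. \<bar>\<phi> x\<bar> powr q) + enn2real (gagliardo s q S \<phi>)) powr (1/q))"

section \<open>Domain and mesh\<close>

text \<open>
  Taking the interior of a finite union of polytopes makes \<open>\<Omega>\<close> lie on one side of its boundary
  (no slits), so that boundary traces and the unit outward normal are single-valued.
\<close>

definition polyhedral :: "(real^'n) set \<Rightarrow> bool" where
  "polyhedral \<Omega> \<longleftrightarrow> (\<exists>P. finite P \<and> (\<forall>S\<in>P. polytope S) \<and> \<Omega> = interior (\<Union>P))"

text \<open>Well defined where the boundary is locally flat, that is, at almost every boundary point.\<close>

definition domain_normal :: "(real^'n) set \<Rightarrow> real^'n \<Rightarrow> real^'n" where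
  "domain_normal \<Omega> x = (THE n. norm n = 1 \<and>
     (\<exists>r>0. \<forall>y\<in>ball x r. y \<in> \<Omega> \<longleftrightarrow> n \<bullet> (y - x) < 0))"

text \<open>The unit outward normal to the element \<open>K\<close> on a \<open>(d-1)\<close>-dimensional part \<open>e\<close> of one of
  its facets.\<close>

definition outward_normal :: "(real^'n) set \<Rightarrow> (real^'n) set \<Rightarrow> real^'n" where
  "outward_normal K e = (THE n. norm n = 1 \<and> (\<forall>x\<in>e. \<forall>y\<in>K. n \<bullet> (y - x) \<le> 0))"

text \<open>
  Elements are closed simplices. Hanging nodes are allowed: the interior faces are the
  \<open>(d-1)\<close>-dimensional intersections of two elements, possibly only a part of a facet of either.
\<close>

definition interior_faces :: "(real^'n) set set \<Rightarrow> (real^'n) set set" where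
  "interior_faces T = {K \<inter> K' | K K'. K \<in> T \<and> K' \<in> T \<and> K \<noteq> K' \<and>
     aff_dim (K \<inter> K') = int CARD('n) - 1}"

text \<open>
  Closed faces of the two boundary parts may meet, so only the relative interior of a face is
  required to lie in the boundary part \<open>\<Gamma>\<close>.
\<close>

definition boundary_faces :: "(real^'n) set set \<Rightarrow> (real^'n) set \<Rightarrow> (real^'n) set set" where
  "boundary_faces T \<Gamma> = {F. (\<exists>K\<in>T. F facet_of K) \<and> rel_interior F \<subseteq> \<Gamma>}"

definition dg_mesh ::
    "(real^'n) set \<Rightarrow> (real^'n) set \<Rightarrow> (real^'n) set \<Rightarrow> (real^'n) set set \<Rightarrow> bool" where
  "dg_mesh \<Omega> \<Gamma>D \<Gamma>N T \<longleftrightarrow>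
     finite T \<and> (\<forall>K\<in>T. int CARD('n) simplex K) \<and> \<Union>T = closure \<Omega> \<and>
     (\<forall>K\<in>T. \<forall>K'\<in>T. K \<noteq> K' \<longrightarrow> K \<inter> K' = {} \<or>
        (\<exists>F F'. F facet_of K \<and> F' facet_of K' \<and> K \<inter> K' \<subseteq> F \<inter> F')) \<and>
     (\<forall>K\<in>T. \<forall>F. F facet_of K \<longrightarrow>
        F \<subseteq> \<Union>(interior_faces T) \<or> rel_interior F \<subseteq> \<Gamma>D \<or> rel_interior F \<subseteq> \<Gamma>N)"

section \<open>Discontinuous Galerkin spaces\<close>

definition poly_space :: "nat \<Rightarrow> (real^'n \<Rightarrow> real) set" where
  "poly_space k = {P. \<exists>c. \<forall>x. P x =
     (\<Sum>\<alpha>\<in>{\<alpha>::'n \<Rightarrow> nat. (\<Sum>i\<in>UNIV. \<alpha> i) \<le> k}. c \<alpha> * (\<Prod>i\<in>UNIV. (x $ i) ^ \<alpha> i))}"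

definition vec_poly_space :: "nat \<Rightarrow> (real^'n \<Rightarrow> real^'n) set" where
  "vec_poly_space k = {P. \<forall>i. (\<lambda>x. P x $ i) \<in> poly_space k}"

text \<open>
  The direct sums over the elements are sets of families indexed by the elements. A polynomial on
  the nondegenerate simplex \<open>K\<close> is identified with its unique extension to the whole space, so the
  trace of \<open>v\<close> from \<open>K\<close> at a point \<open>x\<close> of a face is simply \<open>v K x\<close>.
\<close>

definition V_h :: "(real^'n) set set \<Rightarrow> nat \<Rightarrow> ((real^'n) set \<Rightarrow> real^'n \<Rightarrow> real) set" where
  "V_h T k = T \<rightarrow>\<^sub>E poly_space k"

definition Q_h :: "(real^'n) set set \<Rightarrow> nat \<Rightarrow> ((real^'n) set \<Rightarrow> real^'n \<Rightarrow> real^'n) set" where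
  "Q_h T k = T \<rightarrow>\<^sub>E vec_poly_space k"

definition broken_integral ::
    "(real^'n) set set \<Rightarrow> ((real^'n) set \<Rightarrow> real^'n \<Rightarrow> real) \<Rightarrow> real" where
  "broken_integral T \<phi> = (\<Sum>K\<in>T. LINT x:K|lebesgue. \<phi> K x)"

definition face_integral ::
    "(real^'n) set set \<Rightarrow> ((real^'n) set \<Rightarrow> real^'n \<Rightarrow> real) \<Rightarrow> real" where
  "face_integral E \<phi> = (\<Sum>e\<in>E. LINT x:e|surface_measure. \<phi> e x)"

text \<open>An interior face is contained in exactly two elements, a boundary face in exactly one.\<close>

definition neighbours :: "(real^'n) set set \<Rightarrow> (real^'n) set \<Rightarrow> (real^'n) set set" where
  "neighbours T e = {K \<in> T. e \<subseteq> K}"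

definition boundary_element :: "(real^'n) set set \<Rightarrow> (real^'n) set \<Rightarrow> (real^'n) set" where
  "boundary_element T e = (THE K. K \<in> T \<and> e \<subseteq> K)"

definition jump ::
    "(real^'n) set set \<Rightarrow> ((real^'n) set \<Rightarrow> real^'n \<Rightarrow> real) \<Rightarrow>
     (real^'n) set \<Rightarrow> real^'n \<Rightarrow> real^'n" where
  "jump T v e x = (\<Sum>K\<in>neighbours T e. v K x *\<^sub>R outward_normal K e)"

definition vec_jump ::
    "(real^'n) set set \<Rightarrow> ((real^'n) set \<Rightarrow> real^'n \<Rightarrow> real^'n) \<Rightarrow>
     (real^'n) set \<Rightarrow> real^'n \<Rightarrow> real" where
  "vec_jump T \<zeta> e x = (\<Sum>K\<in>neighbours T e. \<zeta> K x \<bullet> outward_normal K e)"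

definition vec_average ::
    "(real^'n) set set \<Rightarrow> ((real^'n) set \<Rightarrow> real^'n \<Rightarrow> real^'n) \<Rightarrow>
     (real^'n) set \<Rightarrow> real^'n \<Rightarrow> real^'n" where
  "vec_average T \<zeta> e x =
     (1 / real (card (neighbours T e))) *\<^sub>R (\<Sum>K\<in>neighbours T e. \<zeta> K x)"

definition D_DG ::
    "(real^'n) set set \<Rightarrow> (real^'n) set \<Rightarrow> nat \<Rightarrow> ((real^'n) set \<Rightarrow> real^'n) \<Rightarrow>
     ((real^'n) set \<Rightarrow> real^'n \<Rightarrow> real) \<Rightarrow> (real^'n \<Rightarrow> real) \<Rightarrow>
     (real^'n) set \<Rightarrow> real^'n \<Rightarrow> real^'n" where
  "D_DG T \<Gamma>D k C12 v g = (THE q. q \<in> Q_h T k \<and> (\<forall>\<zeta>\<in>Q_h T k.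
     broken_integral T (\<lambda>K x. q K x \<bullet> \<zeta> K x) =
       broken_integral T (\<lambda>K x. gradient (v K) x \<bullet> \<zeta> K x)
       - face_integral (interior_faces T)
           (\<lambda>e x. jump T v e x \<bullet> (vec_average T \<zeta> e x - vec_jump T \<zeta> e x *\<^sub>R C12 e))
       - face_integral (boundary_faces T \<Gamma>D)
           (\<lambda>e x. let K = boundary_element T e in
              (v K x - g x) * (\<zeta> K x \<bullet> outward_normal K e))))"

definition J_h ::
    "(real^'n) set \<Rightarrow> (real^'n) set \<Rightarrow> (real^'n) set \<Rightarrow> (real^'n) set set \<Rightarrow> nat \<Rightarrow> real \<Rightarrow>
     ((real^'n) set \<Rightarrow> real) \<Rightarrow> ((real^'n) set \<Rightarrow> real) \<Rightarrow> ((real^'n) set \<Rightarrow> real^'n) \<Rightarrow>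
     (real^'n \<Rightarrow> real) \<Rightarrow> (real^'n \<Rightarrow> real) \<Rightarrow> (real^'n \<Rightarrow> real^'n) \<Rightarrow>
     ((real^'n) set \<Rightarrow> real^'n \<Rightarrow> real) \<Rightarrow> real" where
  "J_h \<Omega> \<Gamma>D \<Gamma>N T k p \<eta> h C12 f gD gN v =
     1/p * (broken_integral T (\<lambda>K x. norm (D_DG T \<Gamma>D k C12 v gD K x) powr p)
              powr (1/p)) powr p
   + 1/p * (face_integral (interior_faces T)
              (\<lambda>e x. norm (jump T v e x) powr p * (\<eta> e * h e powr (1 - p)))
              powr (1/p)) powr p
   + 1/p * (face_integral (boundary_faces T \<Gamma>D)
              (\<lambda>e x. \<bar>v (boundary_element T e) x - gD x\<bar> powr p * (\<eta> e * h e powr (1 - p)))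
              powr (1/p)) powr p
   - broken_integral T (\<lambda>K x. f x * v K x)
   - face_integral (boundary_faces T \<Gamma>N)
       (\<lambda>e x. (gN x \<bullet> domain_normal \<Omega> x) * v (boundary_element T e) x)"

end

theory Submission
  imports Defs "HOL-Library.Function_Algebras"
begin

text \<open>
  In coordinates with respect to a basis of \<open>V\<^sub>h\<close>, the discrete gradient is an affine map, by Riesz
  representation in \<open>Q\<^sub>h\<close> with an orthonormal basis. So \<open>J\<^sub>h\<close> is a finite sum of terms
  \<open>\<integral> |A c + g|\<^sup>p\<close> minus a linear form. Each term is continuous and is bounded below by
  \<open>2\<^sup>-\<^sup>p \<integral> |A c|\<^sup>p - const\<close>. The sum of the \<open>p\<close>-homogeneous parts vanishes only at \<open>0\<close>:
  if the homogeneous discrete gradient, the jumps and the Dirichlet traces of \<open>v\<close> all vanish, then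
  \<open>v\<close> is piecewise constant, hence constant since \<open>\<Omega>\<close> is connected, hence zero since \<open>\<Gamma>\<^sup>D\<close> has
  positive measure. Compactness of the unit sphere turns this into coercivity.
\<close>

section \<open>Surface measure\<close>

text \<open>The homogeneous part is definite because differentiation keeps the total degree at most
  \<open>k\<close>: the broken gradient of \<open>v\<close> is itself an admissible test field. The
  mesh is fixed, so every constant may come from compactness, and no discrete Poincare inequality
  with explicit constants enters. The obstacle is geometric. Interior faces are bare intersections
  of elements, hanging nodes are allowed, and normals and boundary elements are definite
  descriptions. It has to be shown that an interior face has exactly two neighbours with opposite
  normals, that faces have finite positive surface measure, that a part \<open>\<Gamma>D\<close> of
  positive measure contains the relative interior of some mesh face, and that steps across interior
  faces alone connect all elements. The factor \<open>2 powr (-p)\<close> stems from |a|^p \<le> 2^p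
  (|a + b|^p + |b|^p), where b is the datum. Since \<open>p > 1\<close>, growth of degree
  \<open>p\<close> beats the linear load. The data are integrable against discrete functions because
  these are bounded on compact elements and faces, and |g| \<le> 1 + |g|^q.\<close>

lemma aff_dim_imp_null_set_lborel:
  fixes S :: "(real^'n) set"
  assumes "aff_dim S < int CARD('n)"
  shows "\<exists>N\<in>null_sets lborel. S \<subseteq> N"
proof -
  obtain a b where "a \<noteq> 0" and S: "S \<subseteq> {x. a \<bullet> x = b}"
    using aff_lowdim_subset_hyperplane[of S] assms by auto
  have "negligible {x. a \<bullet> x = b}"
    using \<open>a \<noteq> 0\<close> by (intro negligible_hyperplane) auto
  moreover have "{x. a \<bullet> x = b} \<in> sets borel"
    by (intro borel_closed closed_hyperplane)
  ultimately have "{x. a \<bullet> x = b} \<in> null_sets lborel"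
    by (auto simp: negligible_iff_null_sets null_sets_def)
  then show ?thesis using S by blast
qed

lemma hyperplanesE:
  fixes H :: "(real^'n) set"
  assumes "H \<in> hyperplanes"
  obtains n b where "norm n = 1" "H = {y. n \<bullet> y = b}"
proof -
  have H: "affine H" "aff_dim H = int (DIM(real^'n) - 1)"
    using assms by (simp_all add: hyperplanes_def of_nat_diff Suc_leI)
  have "\<exists>a b. a \<noteq> 0 \<and> affine hull H = {x. a \<bullet> x = b}"
    using H(2) by (rule aff_dim_eq_hyperplane[THEN iffD1])
  then obtain a b where a: "a \<noteq> 0" "H = {y. a \<bullet> y = b}"
    unfolding affine_hull_eq[THEN iffD2, OF H(1)] by blast
  have "H = {y. (a /\<^sub>R norm a) \<bullet> y = b / norm a}"
    using a by (auto simp: field_simps)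
  with a show thesis by (intro that[of "a /\<^sub>R norm a"]) auto
qed

lemma hyperplane_in_hyperplanes:
  fixes n :: "real^'n"
  assumes "n \<noteq> 0"
  shows "{y. n \<bullet> y = b} \<in> hyperplanes"
  using assms aff_dim_hyperplane[of n b] affine_hyperplane[of n b] by (simp add: hyperplanes_def)

lemma hyperplanes_convex_closed:
  assumes "H \<in> hyperplanes"
  shows "convex H" "closed H" "H \<noteq> {}"
proof -
  show "convex H" "closed H"
    using assms by (auto simp: hyperplanes_def affine_imp_convex affine_closed)
  show "H \<noteq> {}"
    using assms by (auto simp: hyperplanes_def)
qed

text \<open>The slab of thickness 1 over \<open>A\<close> has the volume of \<open>A\<close> times
  1, so questions about (d-1)-dimensional measure become questions about Lebesgue measure of the
  ambient space. Nullity, finiteness and positivity are all read off from this formula.\<close>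

lemma hyperplane_measure_slab:
  fixes H :: "(real^'n) set"
  assumes "H \<in> hyperplanes" "A \<in> sets borel"
  shows "emeasure (hyperplane_measure H) A =
      emeasure lborel {y. infdist y H \<le> 1/2 \<and> closest_point H y \<in> A}"
    and "{y. infdist y H \<le> 1/2 \<and> closest_point H y \<in> A} \<in> sets borel"
proof -
  let ?S = "{y. infdist y H \<le> 1/2}"
  have S: "?S \<in> sets lborel"
    by (auto intro!: borel_closed closed_Collect_le continuous_intros)
  have cp: "closest_point H \<in> borel_measurable borel"
    using hyperplanes_convex_closed[OF assms(1)]
    by (intro borel_measurable_continuous_onI continuous_on_closest_point)
  then have cpr: "closest_point H \<in> restrict_space lborel ?S \<rightarrow>\<^sub>M borel"
    by (simp add: measurable_restrict_space1)
  have eq: "closest_point H -` A \<inter> ?S = {y. infdist y H \<le> 1/2 \<and> closest_point H y \<in> A}" by auto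
  have "emeasure (hyperplane_measure H) A = emeasure (restrict_space lborel ?S) (closest_point H -` A \<inter> ?S)"
    unfolding hyperplane_measure_def using cpr assms(2)
    by (subst emeasure_distr) (auto simp: space_restrict_space)
  also have "\<dots> = emeasure lborel (closest_point H -` A \<inter> ?S)"
    using S by (subst emeasure_restrict_space) auto
  finally show "emeasure (hyperplane_measure H) A =
      emeasure lborel {y. infdist y H \<le> 1/2 \<and> closest_point H y \<in> A}" unfolding eq .
  have "closest_point H -` A \<inter> space borel \<in> sets borel"
    using cp assms(2) by (rule measurable_sets)
  then have "closest_point H -` A \<inter> ?S \<in> sets borel"
    using S by auto
  then show "{y. infdist y H \<le> 1/2 \<and> closest_point H y \<in> A} \<in> sets borel"
    unfolding eq .
qed

text \<open>Test the variational inequality of the projection at \<open>c + w\<close>, with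
  \<open>w\<close> the tangential part of \<open>y - c\<close>: it gives
  \<open>w \<bullet> w \<le> 0\<close>, so only a multiple of \<open>n\<close> remains.\<close>

lemma closest_point_hyperplane:
  fixes y n :: "real^'n"
  assumes n: "norm n = 1" and H: "H = {y. n \<bullet> y = b}"
  shows "\<exists>t. y = closest_point H y + t *\<^sub>R n"
proof -
  have HH: "H \<in> hyperplanes" unfolding H using n by (intro hyperplane_in_hyperplanes) auto
  note cc = hyperplanes_convex_closed[OF HH]
  define c where "c = closest_point H y"
  define w where "w = (y - c) - (n \<bullet> (y - c)) *\<^sub>R n"
  have c: "n \<bullet> c = b" using closest_point_in_set[OF cc(2,3), of y] by (auto simp: H c_def)
  have nn: "n \<bullet> n = 1" using n by (simp add: norm_eq_1)
  have nw: "n \<bullet> w = 0" by (simp add: w_def inner_diff_right nn)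
  have "c + w \<in> H" using c nw by (simp add: H inner_add_right)
  from closest_point_dot[OF cc(1,2) this, of y] have "(y - c) \<bullet> w \<le> 0"
    by (simp add: c_def)
  moreover have "(y - c) \<bullet> w = w \<bullet> w"
    using nw by (simp add: w_def inner_diff_left inner_diff_right inner_commute)
  ultimately have "w = 0" by (metis inner_eq_zero_iff inner_ge_zero order_antisym)
  then show ?thesis unfolding w_def c_def[symmetric]
    by (intro exI[of _ "n \<bullet> (y - c)"]) (simp add: algebra_simps)
qed

text \<open>The slab extends \<open>L\<close> only in the direction \<open>n\<close>, so it lies in
  the affine hull of \<open>L\<close> and the single extra point \<open>u + n\<close>. This raises
  the dimension by at most one, and the slab is null.\<close>

lemma hyperplane_measure_lowdim:
  fixes L :: "(real^'n) set"
  assumes H: "H \<in> hyperplanes" and L: "aff_dim L \<le> int CARD('n) - 2" "L \<in> sets borel"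
  shows "emeasure (hyperplane_measure H) L = 0"
proof (cases "L = {}")
  case False
  then obtain u where u: "u \<in> L" by auto
  obtain n b where n: "norm n = 1" "H = {y. n \<bullet> y = b}" using hyperplanesE[OF H] .
  let ?P = "{y. infdist y H \<le> 1/2 \<and> closest_point H y \<in> L}"
  let ?I = "insert (u + n) L"
  have "?P \<subseteq> affine hull ?I"
  proof
    fix y assume y: "y \<in> ?P"
    obtain t where t: "y = closest_point H y + t *\<^sub>R n" using closest_point_hyperplane[OF n] by blast
    have "closest_point H y \<in> affine hull ?I" "u + n \<in> affine hull ?I" "u \<in> affine hull ?I"
      using y u by (auto intro: hull_inc)
    then have "closest_point H y + t *\<^sub>R ((u + n) - u) \<in> affine hull ?I"
      by (intro mem_affine_3_minus affine_affine_hull)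
    then show "y \<in> affine hull ?I" using t by simp
  qed
  moreover have "aff_dim (affine hull ?I) < int CARD('n)"
    using L(1) aff_dim_insert[of "u + n" L] by (simp split: if_splits)
  ultimately obtain N where N: "N \<in> null_sets lborel" "?P \<subseteq> N"
    using aff_dim_imp_null_set_lborel[of "affine hull ?I"] by blast
  have "?P \<in> sets lborel" using hyperplane_measure_slab(2)[OF H L(2)] by simp
  then have "?P \<in> null_sets lborel" using N null_sets_subset by blast
  then show ?thesis using hyperplane_measure_slab(1)[OF H L(2)] by auto
qed auto

lemma sets_surface_measure: "sets borel \<subseteq> sets (surface_measure :: (real^'n) measure)"
proof -
  have "sets (borel :: (real^'n) measure) =
      sets (measure_of UNIV (sets borel)
     (\<lambda>A::(real^'n) set. \<integral>\<^sup>+ H. emeasure (hyperplane_measure H) A \<partial>count_space hyperplanes))"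
    using sets.sigma_sets_eq[of "borel :: (real^'n) measure"] by simp
  then show ?thesis unfolding surface_measure_def by auto
qed

lemma space_surface_measure [simp]: "space surface_measure = UNIV"
  by (simp add: surface_measure_def)

lemma complete_surface_measure: "complete_measure surface_measure"
  unfolding surface_measure_def by (rule completion.complete_measure_axioms)

text \<open>The affine hull is closed, hence Borel, and has the same dimension. Completeness of the
  surface measure then covers \<open>L\<close>, about whose measurability nothing is known.\<close>

lemma surface_measure_lowdim:
  fixes L :: "(real^'n) set"
  assumes "aff_dim L \<le> int CARD('n) - 2"
  shows "L \<in> null_sets surface_measure"
proof -
  have "closed (affine hull L)" by simp
  then have b: "affine hull L \<in> sets borel" by (rule borel_closed)
  have "emeasure surface_measure (affine hull L) =
      (\<integral>\<^sup>+ H. emeasure (hyperplane_measure H) (affine hull L) \<partial>count_space hyperplanes)"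
    by (rule emeasure_surface_measure[OF b])
  also have "\<dots> = (\<integral>\<^sup>+ H. 0 \<partial>count_space (hyperplanes :: (real^'n) set set))"
    using assms b by (intro nn_integral_cong hyperplane_measure_lowdim) auto
  finally have "affine hull L \<in> null_sets surface_measure"
    using b sets_surface_measure by (auto simp: null_sets_def)
  then show ?thesis
    using complete_measure.complete2[OF complete_surface_measure hull_subset] by blast
qed

text \<open>In the sum over all hyperplanes only the term of \<open>H\<close> survives: projections
  onto another \<open>H'\<close> land in \<open>H'\<close>, so the slab over \<open>e\<close> lies
  in the slab over \<open>H \<inter> H'\<close>, a set of codimension 2.\<close>

lemma emeasure_surface_measure_hyperplane:
  fixes e :: "(real^'n) set"
  assumes H: "H \<in> hyperplanes" and e: "e \<subseteq> H" "e \<in> sets borel"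
  shows "emeasure surface_measure e = emeasure (hyperplane_measure H) e"
proof -
  have z: "emeasure (hyperplane_measure H') e = 0" if H': "H' \<in> hyperplanes" "H' \<noteq> H" for H'
  proof -
    have sub: "\<not> H \<subseteq> H'"
      using H H' aff_dim_eq_full_gen[of H H'] by (auto simp: hyperplanes_def hull_same)
    have "aff_dim (H \<inter> H') < aff_dim H"
    proof (rule ccontr)
      assume "\<not> ?thesis"
      then have "aff_dim (H \<inter> H') = aff_dim H"
        using aff_dim_subset[of "H \<inter> H'" H] by auto
      then have "affine hull (H \<inter> H') = affine hull H"
        using aff_dim_eq_full_gen[of "H \<inter> H'" H] by auto
      then show False using sub H H' hull_subset[of "H \<inter> H'"]
        by (auto simp: hyperplanes_def hull_same affine_Int)
    qed
    then have *: "aff_dim (H \<inter> H') \<le> int CARD('n) - 2" using H by (auto simp: hyperplanes_def)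
    have HB: "H \<inter> H' \<in> sets borel"
      using H H' hyperplanes_convex_closed by (intro sets.Int borel_closed) auto
    have cp: "closest_point H' y \<in> H'" for y
      using hyperplanes_convex_closed[OF H'(1)] by (intro closest_point_in_set) auto
    have "emeasure (hyperplane_measure H') e \<le> emeasure (hyperplane_measure H') (H \<inter> H')"
      unfolding hyperplane_measure_slab[OF H'(1) e(2)] hyperplane_measure_slab[OF H'(1) HB]
      using e hyperplane_measure_slab(2)[OF H'(1) HB] cp by (intro emeasure_mono) auto
    also have "\<dots> = 0" by (rule hyperplane_measure_lowdim[OF H'(1) * HB])
    finally show ?thesis by simp
  qed
  have "emeasure surface_measure e =
      (\<integral>\<^sup>+ H. emeasure (hyperplane_measure H) e \<partial>count_space hyperplanes)"
    by (rule emeasure_surface_measure[OF e(2)])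
  also have "\<dots> = (\<Sum>H\<in>{H}. emeasure (hyperplane_measure H) e)"
    using H z by (intro nn_integral_count_space') auto
  finally show ?thesis by simp
qed

lemma affine_hull_in_hyperplanes:
  fixes e :: "(real^'n) set"
  assumes "aff_dim e = int CARD('n) - 1"
  shows "affine hull e \<in> hyperplanes"
  using assms by (simp add: hyperplanes_def)

text \<open>Points of the slab are within 1/2 of the bounded set \<open>e\<close>, so the slab is
  bounded.\<close>

lemma emeasure_surface_measure_finite:
  fixes e :: "(real^'n) set"
  assumes "compact e" "aff_dim e = int CARD('n) - 1"
  shows "emeasure surface_measure e < \<infinity>"
proof -
  let ?H = "affine hull e"
  note H = affine_hull_in_hyperplanes[OF assms(2)]
  note cc = hyperplanes_convex_closed[OF H]
  have e: "e \<in> sets borel" using assms(1) by (simp add: borel_closed compact_imp_closed)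
  let ?P = "{y. infdist y ?H \<le> 1/2 \<and> closest_point ?H y \<in> e}"
  obtain B where B: "\<And>x. x \<in> e \<Longrightarrow> norm x \<le> B"
    using assms(1) compact_imp_bounded bounded_iff by metis
  have "?P \<subseteq> cball 0 (B + 1)"
  proof
    fix y assume y: "y \<in> ?P"
    have "infdist y ?H = dist y (closest_point ?H y)"
      using cc setdist_closest_point[of ?H y]
      by (simp add: infdist_eq_setdist)
    then have "dist y (closest_point ?H y) \<le> 1/2" using y by auto
    moreover have "norm (closest_point ?H y) \<le> B" using y B by auto
    ultimately show "y \<in> cball 0 (B + 1)"
      using norm_triangle_ineq2[of y "closest_point ?H y"] by (auto simp: dist_norm)
  qed
  then have "emeasure lborel ?P \<le> emeasure lborel (cball (0::real^'n) (B+1))"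
    by (intro emeasure_mono) auto
  also have "\<dots> < \<infinity>" using emeasure_bounded_finite[of "cball (0::real^'n) (B+1)"] by auto
  finally show ?thesis
    using emeasure_surface_measure_hyperplane[OF H hull_subset e] hyperplane_measure_slab(1)[OF H e]
    by simp
qed

text \<open>Projection is 1-Lipschitz and fixes a relative interior point \<open>x\<close>, so the
  slab over \<open>e\<close> contains a full ball around \<open>x\<close>; capping the radius at 1/2
  keeps that ball inside the slab.\<close>

lemma emeasure_surface_measure_pos:
  fixes e :: "(real^'n) set"
  assumes "closed e" "convex e" "aff_dim e = int CARD('n) - 1"
  shows "emeasure surface_measure e > 0"
proof -
  let ?H = "affine hull e"
  note H = affine_hull_in_hyperplanes[OF assms(3)]
  note cc = hyperplanes_convex_closed[OF H]
  have e: "e \<in> sets borel" using assms(1) by (simp add: borel_closed)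
  let ?P = "{y. infdist y ?H \<le> 1/2 \<and> closest_point ?H y \<in> e}"
  have "e \<noteq> {}" using assms(3) by auto
  then obtain x where "x \<in> rel_interior e" using assms(2) rel_interior_eq_empty by blast
  then obtain r where r: "x \<in> e" "r > 0" "ball x r \<inter> ?H \<subseteq> e" by (auto simp: mem_rel_interior_ball)
  have x: "x \<in> ?H" using r by (auto intro: hull_inc)
  have "ball x (min r (1/2)) \<subseteq> ?P"
  proof
    fix y assume y: "y \<in> ball x (min r (1/2))"
    have "infdist y ?H \<le> dist y x" using x by (rule infdist_le)
    moreover have "dist (closest_point ?H y) x \<le> dist y x"
      using closest_point_lipschitz[OF cc, of y x] closest_point_self[OF x] by simp
    moreover have "closest_point ?H y \<in> ?H" using cc by (intro closest_point_in_set)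
    ultimately show "y \<in> ?P" using y r by (auto simp: dist_commute)
  qed
  then have "emeasure lborel (ball x (min r (1/2))) \<le> emeasure lborel ?P"
    using hyperplane_measure_slab(2)[OF H e] by (intro emeasure_mono) auto
  moreover have "emeasure lborel (ball x (min r (1/2))) \<noteq> 0"
    using r content_ball_pos[of "min r (1/2)" x] by (auto simp: measure_def)
  ultimately show ?thesis
    using emeasure_surface_measure_hyperplane[OF H hull_subset e] hyperplane_measure_slab(1)[OF H e]
    by (metis bot.extremum_uniqueI bot_ennreal not_gr_zero)
qed

section \<open>Mesh geometry\<close>

text \<open>Covers interior and boundary faces at once: \<open>e\<close> may be a proper part of the
  facet \<open>F\<close>, as happens at hanging nodes.\<close>

definition flat_face :: "(real^'n) set \<Rightarrow> (real^'n) set \<Rightarrow> bool" where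
  "flat_face K e \<longleftrightarrow> polytope K \<and> aff_dim K = int CARD('n) \<and> convex e \<and>
     aff_dim e = int CARD('n) - 1 \<and> (\<exists>F. F facet_of K \<and> e \<subseteq> F)"

text \<open>The condition under the definite description in \<open>outward_normal\<close>, isolated
  so that existence and uniqueness can be shown separately.\<close>

definition supports :: "(real^'n) \<Rightarrow> (real^'n) set \<Rightarrow> (real^'n) set \<Rightarrow> bool" where
  "supports n K e \<longleftrightarrow> norm n = 1 \<and> (\<forall>x\<in>e. \<forall>y\<in>K. n \<bullet> (y - x) \<le> 0)"

lemma flat_face_subset: "flat_face K e \<Longrightarrow> e \<subseteq> K"
  by (auto simp: flat_face_def dest: facet_of_imp_subset)

text \<open>Two points of \<open>e\<close> also lie in \<open>K\<close>, so the supporting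
  inequality holds for them in both orders and \<open>n\<close> is constant on \<open>e\<close>.
  Equality of dimensions makes the hull the whole hyperplane.\<close>

lemma supports_affine_hull:
  fixes e :: "(real^'n) set"
  assumes "supports n K e" "e \<subseteq> K" "aff_dim e = int CARD('n) - 1" "x \<in> e"
  shows "affine hull e = {y. n \<bullet> y = n \<bullet> x}"
proof -
  have n: "n \<noteq> 0" using assms(1) by (auto simp: supports_def)
  have "n \<bullet> y = n \<bullet> x" if "y \<in> e" for y
  proof -
    have "n \<bullet> (y - x) \<le> 0" "n \<bullet> (x - y) \<le> 0"
      using assms that by (auto simp: supports_def)
    then show ?thesis by (simp add: inner_diff_right)
  qed
  then have "e \<subseteq> {y. n \<bullet> y = n \<bullet> x}" by auto
  moreover have "aff_dim e = aff_dim {y. n \<bullet> y = n \<bullet> x}"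
    using aff_dim_hyperplane[OF n, of "n \<bullet> x"] assms(3) by simp
  ultimately have "affine hull e = affine hull {y. n \<bullet> y = n \<bullet> x}"
    using aff_dim_eq_full_gen by blast
  also have "\<dots> = {y. n \<bullet> y = n \<bullet> x}"
    by (rule affine_hull_eq[THEN iffD2, OF affine_hyperplane])
  finally show ?thesis .
qed

text \<open>The part \<open>v\<close> of \<open>n'\<close> orthogonal to \<open>n\<close> is a
  direction of the common hyperplane, hence orthogonal to \<open>n'\<close> too, and therefore
  zero.\<close>

lemma hyperplane_unit_normals:
  fixes n n' :: "real^'n"
  assumes "norm n = 1" "norm n' = 1" "{y. n \<bullet> y = n \<bullet> x} = {y. n' \<bullet> y = n' \<bullet> x}"
  shows "n' = n \<or> n' = - n"
proof -
  have nn: "n \<bullet> n = 1" "n' \<bullet> n' = 1" using assms by (simp_all add: norm_eq_1)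
  define v where "v = n' - (n \<bullet> n') *\<^sub>R n"
  have "n \<bullet> v = 0" by (simp add: v_def inner_diff_right nn)
  then have "x + v \<in> {y. n \<bullet> y = n \<bullet> x}" by (simp add: inner_add_right)
  then have n'v: "n' \<bullet> v = 0" unfolding assms(3) by (simp add: inner_add_right)
  then have "v \<bullet> v = 0" using \<open>n \<bullet> v = 0\<close> by (simp add: v_def inner_diff_left)
  then have v: "n' = (n \<bullet> n') *\<^sub>R n" by (simp add: v_def)
  then have "\<bar>n \<bullet> n'\<bar> = 1" using assms by (metis norm_scaleR mult.right_neutral)
  then show ?thesis using v by (metis abs_eq_iff' abs_1 scaleR_minus1_left scaleR_one)
qed

text \<open>Every facet of a polyhedron is exposed; the normalised normal of the exposing half-space
  supports \<open>K\<close> along \<open>F\<close>, hence along \<open>e\<close>.\<close>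

lemma supports_ex:
  assumes "flat_face K e"
  shows "\<exists>n. supports n K e"
proof -
  obtain F where F: "F facet_of K" "e \<subseteq> F" using assms by (auto simp: flat_face_def)
  have "polyhedron K" using assms by (auto simp: flat_face_def polytope_imp_polyhedron)
  then have "F exposed_face_of K"
    using F exposed_face_of_polyhedron facet_of_imp_face_of by blast
  then obtain a b where ab: "K \<subseteq> {x. a \<bullet> x \<le> b}" "F = K \<inter> {x. a \<bullet> x = b}"
    by (auto simp: exposed_face_of_def)
  \<comment> \<open>With \<open>a = 0\<close> the exposed face would be all of \<open>K\<close> or
    empty.\<close>
  have "F \<noteq> K" "F \<noteq> {}" using F by (auto simp: facet_of_def)
  then have "a \<noteq> 0" using ab by auto
  have "supports (a /\<^sub>R norm a) K e"
    unfolding supports_def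
  proof (intro conjI ballI)
    show "norm (a /\<^sub>R norm a) = 1" using \<open>a \<noteq> 0\<close> by simp
    fix x y assume xy: "x \<in> e" "y \<in> K"
    have "a \<bullet> (y - x) \<le> 0" using xy ab F by (auto simp: inner_diff_right)
    then show "(a /\<^sub>R norm a) \<bullet> (y - x) \<le> 0"
      by (simp add: divide_le_0_iff inverse_eq_divide)
  qed
  then show ?thesis by blast
qed

text \<open>A full-dimensional \<open>K\<close> cannot lie in the hyperplane of \<open>e\<close>.
  The point \<open>z\<close> tells on which side \<open>K\<close> lies: it decides the sign of the
  normal and is the apex in \<open>half_ball_subset\<close>.\<close>

lemma supports_strict:
  assumes "flat_face K e" "supports n K e"
  shows "\<exists>z\<in>K. \<forall>x\<in>e. n \<bullet> (z - x) < 0"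
proof -
  have e: "aff_dim e = int CARD('a) - 1" "e \<noteq> {}" using assms(1) by (auto simp: flat_face_def)
  then obtain x where x: "x \<in> e" by blast
  note hull = supports_affine_hull[OF assms(2) flat_face_subset[OF assms(1)] e(1)]
  have n: "n \<noteq> 0" using assms(2) by (auto simp: supports_def)
  have "\<not> K \<subseteq> {y. n \<bullet> y = n \<bullet> x}"
  proof
    assume "K \<subseteq> {y. n \<bullet> y = n \<bullet> x}"
    then have "aff_dim K \<le> aff_dim {y. n \<bullet> y = n \<bullet> x}" by (rule aff_dim_subset)
    then show False using assms(1) aff_dim_hyperplane[OF n, of "n \<bullet> x"] by (simp add: flat_face_def)
  qed
  then obtain z where z: "z \<in> K" "n \<bullet> z \<noteq> n \<bullet> x" by auto
  have "n \<bullet> (z - x') < 0" if x': "x' \<in> e" for x'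
  proof -
    have "n \<bullet> x' = n \<bullet> x" using hull[OF x] hull_inc[OF x', of affine] by auto
    moreover have "n \<bullet> (z - x) \<le> 0" using assms(2) x z by (auto simp: supports_def)
    ultimately show ?thesis using z by (simp add: inner_diff_right)
  qed
  with z show ?thesis by blast
qed

lemma supports_unique:
  assumes "flat_face K e" "supports n K e" "supports n' K e"
  shows "n' = n"
proof -
  have e: "aff_dim e = int CARD('a) - 1" "e \<noteq> {}" using assms(1) by (auto simp: flat_face_def)
  then obtain x where x: "x \<in> e" by blast
  note sub = flat_face_subset[OF assms(1)]
  have "{y. n \<bullet> y = n \<bullet> x} = {y. n' \<bullet> y = n' \<bullet> x}"
    using supports_affine_hull[OF assms(2) sub e(1) x] supports_affine_hull[OF assms(3) sub e(1) x]
    by simp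
  then have "n' = n \<or> n' = - n"
    using assms by (intro hyperplane_unit_normals) (auto simp: supports_def)
  moreover obtain z where "z \<in> K" "n \<bullet> (z - x) < 0" using supports_strict[OF assms(1,2)] x by blast
  moreover have "n' \<bullet> (z - x) \<le> 0" using assms(3) x \<open>z \<in> K\<close> by (auto simp: supports_def)
  ultimately show ?thesis by auto
qed

lemma supports_outward_normal:
  assumes "flat_face K e"
  shows "supports (outward_normal K e) K e"
proof -
  obtain n where n: "supports n K e" using supports_ex[OF assms] by blast
  have "outward_normal K e = n"
    unfolding outward_normal_def supports_def[symmetric]
    using n supports_unique[OF assms] by blast
  then show ?thesis using n by simp
qed

text \<open>Locally \<open>K\<close> fills its whole side of the face: a point \<open>y\<close> near
  \<open>x\<close> on that side lies on a segment from \<open>z\<close>, strictly inside, to a point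
  \<open>u y\<close> of the hyperplane, and \<open>u y\<close> tends to \<open>x\<close> as
  \<open>y\<close> does, so it belongs to \<open>e\<close>.\<close>

lemma half_ball_subset:
  fixes K :: "(real^'n) set"
  assumes "flat_face K e" "supports n K e" "x \<in> rel_interior e"
  shows "\<exists>r>0. \<forall>y\<in>ball x r. n \<bullet> (y - x) \<le> 0 \<longrightarrow> y \<in> K"
proof -
  have ed: "aff_dim e = int CARD('n) - 1" and cK: "convex K"
    using assms(1) by (auto simp: flat_face_def polytope_imp_convex)
  note sub = flat_face_subset[OF assms(1)]
  have x: "x \<in> e" using assms(3) rel_interior_subset by blast
  note hull = supports_affine_hull[OF assms(2) sub ed x]
  obtain r0 where r0: "r0 > 0" "ball x r0 \<inter> affine hull e \<subseteq> e"
    using assms(3) by (auto simp: mem_rel_interior_ball)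
  obtain z where z: "z \<in> K" "n \<bullet> (z - x) < 0" using supports_strict[OF assms(1,2)] x by blast
  \<comment> \<open>\<open>\<mu> y\<close> is the weight of \<open>z\<close> in
    \<open>y = (1 - \<mu> y) *\<^sub>R u y + \<mu> y *\<^sub>R z\<close>, determined by the
    requirement that \<open>u y\<close> lie in the hyperplane of \<open>e\<close>.\<close>
  define \<mu> where "\<mu> y = n \<bullet> (y - x) / (n \<bullet> (z - x))" for y
  define u where "u y = x + (1 / (1 - \<mu> y)) *\<^sub>R ((y - x) - \<mu> y *\<^sub>R (z - x))" for y
  have \<mu>: "(\<mu> \<longlongrightarrow> 0) (nhds x)"
    unfolding \<mu>_def by (rule tendsto_eq_intros filterlim_ident refl | use z in simp)+
  have "(u \<longlongrightarrow> x) (nhds x)"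
    unfolding u_def by (rule tendsto_eq_intros \<mu> filterlim_ident refl | simp)+
  then have "\<forall>\<^sub>F y in nhds x. dist (u y) x < r0" using r0 by (auto dest: tendstoD)
  moreover have "\<forall>\<^sub>F y in nhds x. \<mu> y < 1" using \<mu> by (rule order_tendstoD) simp
  ultimately have "\<forall>\<^sub>F y in nhds x. dist (u y) x < r0 \<and> \<mu> y < 1" by eventually_elim simp
  then obtain r where r: "r > 0" "\<And>y. dist y x < r \<Longrightarrow> dist (u y) x < r0 \<and> \<mu> y < 1"
    unfolding eventually_nhds_metric by blast
  have "y \<in> K" if y: "y \<in> ball x r" "n \<bullet> (y - x) \<le> 0" for y
  proof -
    have u: "dist (u y) x < r0" "\<mu> y < 1" using r(2)[of y] y by (auto simp: dist_commute)
    have "\<mu> y \<ge> 0" using y z by (auto simp: \<mu>_def divide_nonpos_neg)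
    have "n \<bullet> ((y - x) - \<mu> y *\<^sub>R (z - x)) = 0" using z by (simp add: \<mu>_def inner_diff_right)
    then have "n \<bullet> u y = n \<bullet> x" by (simp add: u_def inner_add_right)
    then have "u y \<in> e" using u r0 hull by (auto simp: dist_commute)
    then have "(1 - \<mu> y) *\<^sub>R u y + \<mu> y *\<^sub>R z \<in> K"
      using sub z cK \<open>\<mu> y \<ge> 0\<close> u by (intro convexD_alt) auto
    moreover have "(1 - \<mu> y) *\<^sub>R u y = (1 - \<mu> y) *\<^sub>R x + ((y - x) - \<mu> y *\<^sub>R (z - x))"
      using u(2) unfolding u_def by (simp only: scaleR_add_right scaleR_scaleR) simp
    then have "(1 - \<mu> y) *\<^sub>R u y + \<mu> y *\<^sub>R z = y"
      by (simp add: algebra_simps)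
    ultimately show ?thesis by simp
  qed
  with r(1) show ?thesis by blast
qed

text \<open>With equal normals both elements would contain the same half ball, so their intersection
  would be full-dimensional.\<close>

lemma outward_normal_opposite:
  fixes K K' :: "(real^'n) set"
  assumes K: "flat_face K e" and K': "flat_face K' e" and dim: "aff_dim (K \<inter> K') < int CARD('n)"
  shows "outward_normal K' e = - outward_normal K e"
proof -
  let ?n = "outward_normal K e" and ?n' = "outward_normal K' e"
  note n = supports_outward_normal[OF K] and n' = supports_outward_normal[OF K']
  have e: "aff_dim e = int CARD('n) - 1" "e \<noteq> {}" "convex e" using K by (auto simp: flat_face_def)
  then obtain x where x: "x \<in> rel_interior e" using rel_interior_eq_empty by blast
  then have xe: "x \<in> e" using rel_interior_subset by blast
  have "{y. ?n \<bullet> y = ?n \<bullet> x} = {y. ?n' \<bullet> y = ?n' \<bullet> x}"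
    using supports_affine_hull[OF n flat_face_subset[OF K] e(1) xe]
      supports_affine_hull[OF n' flat_face_subset[OF K'] e(1) xe] by simp
  then have *: "?n' = ?n \<or> ?n' = - ?n"
    using n n' by (intro hyperplane_unit_normals) (auto simp: supports_def)
  have "?n' \<noteq> ?n"
  proof
    assume eq: "?n' = ?n"
    obtain r where r: "r > 0" "\<forall>y\<in>ball x r. ?n \<bullet> (y - x) \<le> 0 \<longrightarrow> y \<in> K"
      using half_ball_subset[OF K n x] by blast
    obtain r' where r': "r' > 0" "\<forall>y\<in>ball x r'. ?n \<bullet> (y - x) \<le> 0 \<longrightarrow> y \<in> K'"
      using half_ball_subset[OF K' n' x] eq by auto
    define U where "U = ball x (min r r') \<inter> {y. ?n \<bullet> y < ?n \<bullet> x}"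
    have "open U" unfolding U_def by (intro open_Int open_ball open_halfspace_lt)
    moreover have "norm ?n = 1" "?n \<bullet> ?n = 1" using n by (auto simp: supports_def norm_eq_1)
    then have "x - (min r r' / 2) *\<^sub>R ?n \<in> U"
      using r(1) r'(1) by (auto simp: U_def dist_norm inner_diff_right)
    ultimately have "aff_dim U = int CARD('n)" by (subst aff_dim_open) auto
    moreover have "U \<subseteq> K \<inter> K'" using r r' by (auto simp: U_def inner_diff_right)
    ultimately show False using dim aff_dim_subset[of U "K \<inter> K'"] by simp
  qed
  with * show ?thesis by simp
qed

text \<open>The half balls filled by the two elements lie on opposite sides and together form a
  ball.\<close>

lemma rel_interior_shared_face:
  fixes K K' :: "(real^'n) set"
  assumes K: "flat_face K e" and K': "flat_face K' e" and dim: "aff_dim (K \<inter> K') < int CARD('n)"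
  shows "rel_interior e \<subseteq> interior (K \<union> K')"
proof
  fix x assume x: "x \<in> rel_interior e"
  let ?n = "outward_normal K e" and ?n' = "outward_normal K' e"
  note n = supports_outward_normal[OF K] and n' = supports_outward_normal[OF K']
  obtain r where r: "r > 0" "\<forall>y\<in>ball x r. ?n \<bullet> (y - x) \<le> 0 \<longrightarrow> y \<in> K"
    using half_ball_subset[OF K n x] by blast
  obtain r' where r': "r' > 0" "\<forall>y\<in>ball x r'. ?n' \<bullet> (y - x) \<le> 0 \<longrightarrow> y \<in> K'"
    using half_ball_subset[OF K' n' x] by blast
  have "y \<in> K \<union> K'" if "y \<in> ball x (min r r')" for y
    using r(2) r'(2) outward_normal_opposite[OF assms] that linear[of "?n \<bullet> (y - x)" 0] by auto
  then have "ball x (min r r') \<subseteq> K \<union> K'" by blast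
  then show "x \<in> interior (K \<union> K')"
    using r(1) r'(1) by (auto simp: mem_interior intro!: exI[of _ "min r r'"])
qed

text \<open>The relative frontier is a finite union of facets of \<open>e\<close>, each of
  codimension 2 in the whole space.\<close>

lemma surface_measure_rel_frontier:
  fixes e :: "(real^'n) set"
  assumes "polytope e" "aff_dim e = int CARD('n) - 1"
  shows "rel_frontier e \<in> null_sets surface_measure"
proof -
  have p: "polyhedron e" using assms by (simp add: polytope_imp_polyhedron)
  have "F \<in> null_sets surface_measure" if "F facet_of e" for F
    using that assms by (intro surface_measure_lowdim) (auto simp: facet_of_def)
  then have "\<Union>{F. F facet_of e} \<in> null_sets surface_measure"
    using finite_polyhedron_facets[OF p]
    by (intro null_sets.finite_Union) auto
  then show ?thesis using rel_frontier_of_polyhedron[OF p] by simp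
qed

section \<open>Elements, interior faces and boundary faces of the mesh\<close>

locale dg_domain =
  fixes \<Omega> \<Gamma>D \<Gamma>N :: "(real^'n) set" and T :: "(real^'n) set set"
  assumes polyhedral: "polyhedral \<Omega>" and open_\<Omega>: "open \<Omega>" and connected_\<Omega>: "connected \<Omega>"
    and frontier_\<Omega>: "\<Gamma>D \<union> \<Gamma>N = frontier \<Omega>" and disjoint_\<Gamma>: "\<Gamma>D \<inter> \<Gamma>N = {}"
    and pos_\<Gamma>D: "emeasure surface_measure \<Gamma>D > 0"
    and mesh: "dg_mesh \<Omega> \<Gamma>D \<Gamma>N T"
begin

lemma finite_T: "finite T" and Union_T: "\<Union>T = closure \<Omega>"
  using mesh by (auto simp: dg_mesh_def)

lemma element:
  assumes "K \<in> T"
  shows "polytope K" "aff_dim K = int CARD('n)" "convex K" "compact K" "closed K" "interior K \<noteq> {}"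
proof -
  have s: "int CARD('n) simplex K" using assms mesh by (auto simp: dg_mesh_def)
  show p: "polytope K" using s by (rule simplex_imp_polytope)
  show d: "aff_dim K = int CARD('n)" using s by (rule aff_dim_simplex)
  show c: "convex K" using p by (rule polytope_imp_convex)
  show "compact K" using p by (rule polytope_imp_compact)
  then show "closed K" by (rule compact_imp_closed)
  show "interior K \<noteq> {}"
    using d c interior_rel_interior_gen[of K] rel_interior_eq_empty[of K] by auto
qed

text \<open>\<open>\<Omega>\<close> is the interior of a closed set, hence regular open. This is
  where slits are excluded: a ball filled by two elements lies in the closure and therefore in
  \<open>\<Omega>\<close>.\<close>

lemma interior_closure_\<Omega>: "interior (closure \<Omega>) = \<Omega>"
proof
  obtain P where P: "finite P" "\<forall>S\<in>P. polytope S" "\<Omega> = interior (\<Union>P)"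
    using polyhedral by (auto simp: polyhedral_def)
  have "closed (\<Union>P)" using P by (intro closed_Union) (auto simp: polytope_imp_closed)
  then have "closure \<Omega> \<subseteq> \<Union>P" using P(3) by (simp add: closure_minimal interior_subset)
  then show "interior (closure \<Omega>) \<subseteq> \<Omega>" using interior_mono P(3) by blast
  show "\<Omega> \<subseteq> interior (closure \<Omega>)" using open_\<Omega> by (simp add: closure_subset interior_maximal)
qed

lemma interior_element: "K \<in> T \<Longrightarrow> interior K \<subseteq> \<Omega>"
  using interior_mono[of K "closure \<Omega>"] Union_T interior_closure_\<Omega> by auto

lemma frontier_eq: "frontier \<Omega> = closure \<Omega> - \<Omega>"
  using open_\<Omega> by (simp add: frontier_def interior_open)

lemma aff_dim_Int:
  assumes "K \<in> T" "K' \<in> T" "K \<noteq> K'"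
  shows "aff_dim (K \<inter> K') \<le> int CARD('n) - 1"
    and "\<And>e. e \<subseteq> K \<inter> K' \<Longrightarrow> e \<noteq> {} \<Longrightarrow> (\<exists>F. F facet_of K \<and> e \<subseteq> F) \<and> (\<exists>F. F facet_of K' \<and> e \<subseteq> F)"
proof -
  have *: "K \<inter> K' = {} \<or> (\<exists>F F'. F facet_of K \<and> F' facet_of K' \<and> K \<inter> K' \<subseteq> F \<inter> F')"
    using mesh assms by (auto simp: dg_mesh_def)
  then show "\<And>e. e \<subseteq> K \<inter> K' \<Longrightarrow> e \<noteq> {} \<Longrightarrow>
      (\<exists>F. F facet_of K \<and> e \<subseteq> F) \<and> (\<exists>F. F facet_of K' \<and> e \<subseteq> F)"
    by blast
  show "aff_dim (K \<inter> K') \<le> int CARD('n) - 1"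
  proof (cases "K \<inter> K' = {}")
    case False
    then obtain F where "F facet_of K" "K \<inter> K' \<subseteq> F" using * by blast
    then show ?thesis using aff_dim_subset[of "K \<inter> K'" F] element(2)[OF assms(1)]
      by (auto simp: facet_of_def)
  qed simp
qed

lemma shared_flat_face:
  assumes "K \<in> T" "K' \<in> T" "K \<noteq> K'" "e \<subseteq> K" "e \<subseteq> K'" "convex e" "aff_dim e = int CARD('n) - 1"
  shows "flat_face K e" "flat_face K' e" "outward_normal K' e = - outward_normal K e"
    "rel_interior e \<subseteq> \<Omega>"
proof -
  have "e \<noteq> {}" using assms by auto
  then show f: "flat_face K e" "flat_face K' e"
    using aff_dim_Int(2)[OF assms(1-3), of e] element assms by (auto simp: flat_face_def)
  have d: "aff_dim (K \<inter> K') < int CARD('n)" using aff_dim_Int(1)[OF assms(1-3)] by simp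
  show "outward_normal K' e = - outward_normal K e"
    by (rule outward_normal_opposite[OF f d])
  have "interior (K \<union> K') \<subseteq> interior (closure \<Omega>)"
    using Union_T assms by (intro interior_mono) auto
  then show "rel_interior e \<subseteq> \<Omega>"
    using rel_interior_shared_face[OF f d] interior_closure_\<Omega> by blast
qed

text \<open>A third element containing \<open>e\<close> would have a normal opposite to both of two
  mutually opposite unit normals, which would then have to vanish.\<close>

lemma interior_faceE:
  assumes "e \<in> interior_faces T"
  obtains K K' where "K \<in> T" "K' \<in> T" "K \<noteq> K'" "e = K \<inter> K'" "neighbours T e = {K, K'}"
    "outward_normal K' e = - outward_normal K e" "norm (outward_normal K e) = 1"
proof -
  obtain K K' where K: "K \<in> T" "K' \<in> T" "K \<noteq> K'" "e = K \<inter> K'" "aff_dim e = int CARD('n) - 1"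
    using assms by (auto simp: interior_faces_def)
  have c: "convex e" using K element by (auto intro: convex_Int)
  have n: "norm (outward_normal K e) = 1" "outward_normal K' e = - outward_normal K e"
    using supports_outward_normal[OF shared_flat_face(1)[OF K(1-3) _ _ c K(5)]]
      shared_flat_face(3)[OF K(1-3) _ _ c K(5)] K by (auto simp: supports_def)
  have "K'' = K \<or> K'' = K'" if "K'' \<in> T" "e \<subseteq> K''" for K''
  proof (rule ccontr)
    assume "\<not> ?thesis"
    then have "outward_normal K'' e = - outward_normal K e" "outward_normal K'' e = - outward_normal K' e"
      using shared_flat_face(3)[OF K(1) that(1) _ _ that(2) c K(5)]
        shared_flat_face(3)[OF K(2) that(1) _ _ that(2) c K(5)] K(4) by auto
    then have "outward_normal K e = - outward_normal K e" using n by simp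
    then have "outward_normal K e = 0" by (simp add: eq_neg_iff_add_eq_0 flip: scaleR_2)
    then show False using n by simp
  qed
  then have "neighbours T e = {K, K'}" using K by (auto simp: neighbours_def)
  with K n that show thesis by blast
qed

lemma interior_face:
  assumes "e \<in> interior_faces T"
  shows "polytope e" "convex e" "compact e" "aff_dim e = int CARD('n) - 1" "rel_interior e \<subseteq> \<Omega>"
proof -
  obtain K K' where K: "K \<in> T" "K' \<in> T" "K \<noteq> K'" "e = K \<inter> K'" "aff_dim e = int CARD('n) - 1"
    using assms by (auto simp: interior_faces_def)
  show p: "polytope e" using K element by (auto intro: polytope_Int)
  show c: "convex e" using p by (rule polytope_imp_convex)
  show "compact e" using p by (rule polytope_imp_compact)
  show "aff_dim e = int CARD('n) - 1" by fact
  show "rel_interior e \<subseteq> \<Omega>" using shared_flat_face(4)[OF K(1-3) _ _ c K(5)] K by auto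
qed

text \<open>If two elements contained \<open>e\<close>, its relative interior would lie in
  \<open>\<Omega>\<close>, whereas it lies in the frontier; so \<open>boundary_element\<close> is
  well defined. The last claim lets data given on \<open>\<Gamma>\<close> be integrated over the
  closed face.\<close>

lemma boundary_face:
  assumes "e \<in> boundary_faces T \<Gamma>" "\<Gamma> \<subseteq> frontier \<Omega>"
  shows "polytope e" "convex e" "compact e" "aff_dim e = int CARD('n) - 1"
    "boundary_element T e \<in> T" "e \<subseteq> boundary_element T e"
    "e - \<Gamma> \<in> null_sets surface_measure"
proof -
  obtain K where K: "K \<in> T" "e facet_of K" "rel_interior e \<subseteq> \<Gamma>"
    using assms by (auto simp: boundary_faces_def)
  show p: "polytope e"
    using K element facet_of_imp_face_of face_of_polytope_polytope by blast
  show c: "convex e" using p by (rule polytope_imp_convex)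
  show "compact e" using p by (rule polytope_imp_compact)
  show d: "aff_dim e = int CARD('n) - 1" using K element by (auto simp: facet_of_def)
  have eK: "e \<subseteq> K" using K by (simp add: facet_of_imp_subset)
  have "rel_interior e \<noteq> {}" using d c rel_interior_eq_empty[of e] by auto
  then have n\<Omega>: "\<not> rel_interior e \<subseteq> \<Omega>" using K assms(2) frontier_eq by auto
  have uniq: "K' = K" if "K' \<in> T" "e \<subseteq> K'" for K'
    using shared_flat_face(4)[OF K(1) that(1) _ eK that(2) c d] n\<Omega> by metis
  have "boundary_element T e = K"
    unfolding boundary_element_def
  proof (rule the_equality)
    show "K \<in> T \<and> e \<subseteq> K" using K(1) eK by blast
    show "K' = K" if "K' \<in> T \<and> e \<subseteq> K'" for K' using uniq that by blast
  qed
  then show "boundary_element T e \<in> T" "e \<subseteq> boundary_element T e" using K eK by auto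
  have "e \<subseteq> closure e" by (rule closure_subset)
  then have "e - \<Gamma> \<subseteq> rel_frontier e" using K by (auto simp: rel_frontier_def)
  then show "e - \<Gamma> \<in> null_sets surface_measure"
    using surface_measure_rel_frontier[OF p d]
      complete_measure.complete2[OF complete_surface_measure] by blast
qed

lemma finite_interior_faces: "finite (interior_faces T)"
proof -
  have "interior_faces T \<subseteq> (\<lambda>(K, K'). K \<inter> K') ` (T \<times> T)"
    by (auto simp: interior_faces_def)
  then show ?thesis using finite_T finite_subset by blast
qed

lemma finite_facets: "finite {F. \<exists>K\<in>T. F facet_of K}"
proof -
  have "{F. \<exists>K\<in>T. F facet_of K} = (\<Union>K\<in>T. {F. F facet_of K})" by auto
  moreover have "finite {F. F facet_of K}" if "K \<in> T" for K
    using element(1)[OF that] by (intro finite_polyhedron_facets polytope_imp_polyhedron)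
  ultimately show ?thesis using finite_T by simp
qed

lemma finite_boundary_faces: "finite (boundary_faces T \<Gamma>)"
  by (rule finite_subset[OF _ finite_facets]) (auto simp: boundary_faces_def)

text \<open>Otherwise each point of \<open>\<Gamma>D\<close> lies on an interior face or on a face
  of \<open>\<Gamma>N\<close>. It cannot be a relative interior point there, as these belong to
  \<open>\<Omega>\<close> or \<open>\<Gamma>N\<close>; so \<open>\<Gamma>D\<close> would be covered
  by finitely many null relative frontiers.\<close>

lemma ex_boundary_face_\<Gamma>D: "boundary_faces T \<Gamma>D \<noteq> {}"
proof
  assume none: "boundary_faces T \<Gamma>D = {}"
  let ?N = "(\<Union>e\<in>interior_faces T. rel_frontier e) \<union> (\<Union>e\<in>boundary_faces T \<Gamma>N. rel_frontier e)"
  have N\<Gamma>: "\<Gamma>N \<subseteq> frontier \<Omega>" using frontier_\<Omega> by auto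
  have rf: "e - rel_interior e \<subseteq> rel_frontier e" for e :: "(real^'n) set"
    using closure_subset by (auto simp: rel_frontier_def)
  have "\<Gamma>D \<subseteq> ?N"
  proof
    fix x assume x: "x \<in> \<Gamma>D"
    then have xf: "x \<in> closure \<Omega>" "x \<notin> \<Omega>" "x \<notin> \<Gamma>N" using frontier_\<Omega> frontier_eq disjoint_\<Gamma> by auto
    then obtain K where K: "K \<in> T" "x \<in> K" using Union_T by blast
    then have "x \<in> rel_frontier K"
      using xf interior_element[OF K(1)] element[OF K(1)] interior_rel_interior_gen[of K]
      by (auto simp: rel_frontier_def)
    then obtain F where F: "F facet_of K" "x \<in> F"
      using rel_frontier_of_polyhedron[of K] element(1)[OF K(1)] polytope_imp_polyhedron by blast
    have "F \<subseteq> \<Union>(interior_faces T) \<or> rel_interior F \<subseteq> \<Gamma>D \<or> rel_interior F \<subseteq> \<Gamma>N"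
      using mesh K F by (auto simp: dg_mesh_def)
    moreover have "\<not> rel_interior F \<subseteq> \<Gamma>D" using none F K by (auto simp: boundary_faces_def)
    ultimately consider "F \<subseteq> \<Union>(interior_faces T)" | "rel_interior F \<subseteq> \<Gamma>N" by blast
    then show "x \<in> ?N"
    proof cases
      case 1
      then obtain e where "e \<in> interior_faces T" "x \<in> e" using F by blast
      then show ?thesis using interior_face(5) xf rf by blast
    next
      case 2
      then have "F \<in> boundary_faces T \<Gamma>N" using K F by (auto simp: boundary_faces_def)
      moreover have "x \<in> rel_frontier F" using 2 xf F rf by blast
      ultimately show ?thesis by blast
    qed
  qed
  moreover have "?N \<in> null_sets surface_measure"
    using interior_face boundary_face[OF _ N\<Gamma>] finite_interior_faces finite_boundary_faces
    by (intro null_sets.Un null_sets.finite_UN surface_measure_rel_frontier) auto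
  ultimately have "\<Gamma>D \<in> null_sets surface_measure"
    using complete_measure.complete2[OF complete_surface_measure] by blast
  then show False using pos_\<Gamma>D by auto
qed

text \<open>If the elements split into two classes \<open>A\<close>, \<open>B\<close> without a common interior face, then they
  meet only in sets of codimension 2. The segments from an interior point \<open>a\<close> of \<open>A\<close> near such a set
  to an open subset of \<open>B\<close> all cross these sets, so they lie in a null cone with apex \<open>a\<close>.\<close>

lemma constant_on_mesh:
  fixes c :: "(real^'n) set \<Rightarrow> 'b"
  assumes c: "\<And>K K'. K \<in> T \<Longrightarrow> K' \<in> T \<Longrightarrow> K \<inter> K' \<in> interior_faces T \<Longrightarrow> c K = c K'"
    and K0: "K0 \<in> T" and K1: "K1 \<in> T"
  shows "c K0 = c K1"
proof (rule ccontr)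
  assume neq: "c K0 \<noteq> c K1"
  define TA where "TA = {K\<in>T. c K = c K0}"
  define TB where "TB = {K\<in>T. c K \<noteq> c K0}"
  have fin: "finite TA" "finite TB" using finite_T by (auto simp: TA_def TB_def)
  have dim: "aff_dim (K \<inter> K') \<le> int CARD('n) - 2" if "K \<in> TA" "K' \<in> TB" for K K'
  proof -
    have K: "K \<in> T" "K' \<in> T" "K \<noteq> K'" "c K \<noteq> c K'" using that by (auto simp: TA_def TB_def)
    then have "K \<inter> K' \<notin> interior_faces T" using c by blast
    then have "aff_dim (K \<inter> K') \<noteq> int CARD('n) - 1" using K by (auto simp: interior_faces_def)
    then show ?thesis using aff_dim_Int(1)[OF K(1-3)] by linarith
  qed
  have cl: "closed (\<Union>TA)" "closed (\<Union>TB)"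
    using fin element(5) by (auto simp: TA_def TB_def intro!: closed_Union)
  have un: "\<Union>TA \<union> \<Union>TB = closure \<Omega>" unfolding Union_T[symmetric] TA_def TB_def by auto
  have "K0 \<in> TA" "K1 \<in> TB" using K0 K1 neq by (auto simp: TA_def TB_def)
  then have "interior K0 \<subseteq> \<Union>TA \<inter> \<Omega>" "interior K1 \<subseteq> \<Union>TB \<inter> \<Omega>"
    using interior_element[OF K0] interior_element[OF K1] interior_subset[of K0] interior_subset[of K1]
    by blast+
  then have "\<Union>TA \<inter> \<Omega> \<noteq> {}" "\<Union>TB \<inter> \<Omega> \<noteq> {}"
    using element(6)[OF K0] element(6)[OF K1] by blast+
  then have "\<Union>TA \<inter> \<Union>TB \<inter> \<Omega> \<noteq> {}"
    using connected_closedD[OF connected_\<Omega> _ _ cl] un closure_subset[of \<Omega>] by blast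
  \<comment> \<open>Connectedness yields an interface point inside \<open>\<Omega>\<close>. A ball
    around it within \<open>\<Omega>\<close> is convex, so segments between its points are covered
    by the two classes.\<close>
  then obtain x KA KB where x: "x \<in> \<Omega>" and KA: "KA \<in> TA" "x \<in> KA" and KB: "KB \<in> TB" "x \<in> KB" by blast
  obtain r where r: "r > 0" "ball x r \<subseteq> \<Omega>" using open_\<Omega> x open_contains_ball by blast
  have near: "\<exists>y. y \<in> interior K \<inter> ball x r" if "K \<in> T" "x \<in> K" for K
  proof -
    have "x \<in> closure (interior K)"
      using that element[OF that(1)] convex_closure_interior[of K] by auto
    then show ?thesis using r(1) closure_approachable[of x "interior K"] by (auto simp: dist_commute)
  qed
  obtain a where a: "a \<in> interior KA" "a \<in> ball x r" using near[of KA] KA by (auto simp: TA_def)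
  define U where "U = interior KB \<inter> ball x r"
  have U: "open U" "U \<noteq> {}" using near[of KB] KB by (auto simp: U_def TB_def)
  \<comment> \<open>The apex must avoid class B: the crossing point \<open>y\<close> on a segment
    then differs from \<open>a\<close>, and \<open>b\<close> is recovered as a point of the line
    through \<open>a\<close> and \<open>y\<close>.\<close>
  have aB: "a \<notin> K'" if K': "K' \<in> TB" for K'
  proof
    assume "a \<in> K'"
    have K: "KA \<in> T" "K' \<in> T" "KA \<noteq> K'" using K' KA by (auto simp: TA_def TB_def)
    have "{a} \<subseteq> KA \<inter> K'" using a(1) interior_subset[of KA] \<open>a \<in> K'\<close> by auto
    then obtain F where F: "F facet_of KA" "a \<in> F" using aff_dim_Int(2)[OF K, of "{a}"] by auto
    have "F \<subseteq> rel_frontier KA"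
      using F(1) rel_frontier_of_polyhedron[of KA] element(1)[OF K(1)] polytope_imp_polyhedron by blast
    then show False using F(2) a(1) interior_rel_interior_gen[of KA] element(2)[OF K(1)]
      by (auto simp: rel_frontier_def)
  qed
  have "U \<subseteq> (\<Union>(K, K')\<in>TA \<times> TB. affine hull (insert a (K \<inter> K')))"
  proof
    fix b assume b: "b \<in> U"
    let ?s = "closed_segment a b"
    have "?s \<subseteq> ball x r" using a b by (intro closed_segment_subset) (auto simp: U_def)
    then have s: "?s \<subseteq> \<Union>TA \<union> \<Union>TB" using r un closure_subset[of \<Omega>] by blast
    have "a \<in> \<Union>TA" "b \<in> \<Union>TB"
      using a(1) b KA KB interior_subset by (auto simp: U_def)
    then have "\<Union>TA \<inter> ?s \<noteq> {}" "\<Union>TB \<inter> ?s \<noteq> {}" by auto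
    then have "\<Union>TA \<inter> \<Union>TB \<inter> ?s \<noteq> {}"
      using connected_closedD[OF connected_segment(1)[of a b] _ _ cl] s by blast
    then obtain y K K' where y: "y \<in> ?s" "K \<in> TA" "K' \<in> TB" "y \<in> K" "y \<in> K'" by blast
    then have "y \<noteq> a" using aB by auto
    obtain t where t: "y = (1 - t) *\<^sub>R a + t *\<^sub>R b" using y(1) by (auto simp: in_segment)
    have "t \<noteq> 0" using t \<open>y \<noteq> a\<close> by auto
    have "y - a = t *\<^sub>R (b - a)" using t by (simp add: algebra_simps)
    then have "b = a + (1/t) *\<^sub>R (y - a)" using \<open>t \<noteq> 0\<close> by simp
    also have "\<dots> \<in> affine hull (insert a (K \<inter> K'))"
      using y by (intro mem_affine_3_minus affine_affine_hull) (auto intro: hull_inc)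
    finally show "b \<in> (\<Union>(K, K')\<in>TA \<times> TB. affine hull (insert a (K \<inter> K')))" using y by auto
  qed
  moreover have "\<exists>N\<in>null_sets lborel. affine hull (insert a (K \<inter> K')) \<subseteq> N"
    if "K \<in> TA" "K' \<in> TB" for K K'
    using dim[OF that] aff_dim_insert[of a "K \<inter> K'"]
    by (intro aff_dim_imp_null_set_lborel) (simp split: if_splits)
  then have "\<forall>q\<in>TA \<times> TB. \<exists>N. N \<in> null_sets lborel \<and> affine hull (insert a (fst q \<inter> snd q)) \<subseteq> N"
    by (auto simp: Bex_def)
  then obtain N where N: "\<And>q. q \<in> TA \<times> TB \<Longrightarrow> N q \<in> null_sets lborel \<and>
      affine hull (insert a (fst q \<inter> snd q)) \<subseteq> N q"
    by metis
  ultimately have "U \<subseteq> (\<Union>q\<in>TA \<times> TB. N q)" by fastforce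
  moreover have "(\<Union>q\<in>TA \<times> TB. N q) \<in> null_sets lborel"
    using fin N by (intro null_sets.finite_UN) auto
  ultimately have "negligible U"
    using U(1) by (meson negligible_iff_null_sets negligible_subset null_sets_completionI)
  then show False using U open_not_negligible by blast
qed

end

section \<open>Finite-dimensional spaces of functions\<close>

text \<open>Used twice in succession: a member of a broken space is a function of the element whose
  values are functions of the point. With this, \<open>span\<close> and \<open>subspace\<close>
  apply to both.\<close>

instantiation "fun" :: (type, real_vector) real_vector
begin

definition scaleR_fun :: "real \<Rightarrow> ('a \<Rightarrow> 'b) \<Rightarrow> 'a \<Rightarrow> 'b" where
  "scaleR_fun r f = (\<lambda>x. r *\<^sub>R f x)"

instance
  by standard (auto simp: scaleR_fun_def plus_fun_def algebra_simps)

end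

lemma scaleR_fun_apply [simp]: "(r *\<^sub>R f) x = r *\<^sub>R f x"
  by (simp add: scaleR_fun_def)

lemma sum_fun_apply: "(\<Sum>i\<in>I. f i) x = (\<Sum>i\<in>I. f i x)"
  by (induction I rule: infinite_finite_induct) auto

text \<open>Restricted to \<open>V\<close> because integrals are additive only where the integrands
  are integrable.\<close>

definition linear_functional_on :: "'a::real_vector set \<Rightarrow> ('a \<Rightarrow> real) \<Rightarrow> bool" where
  "linear_functional_on V F \<longleftrightarrow> (\<forall>u\<in>V. \<forall>v\<in>V. F (u + v) = F u + F v) \<and> (\<forall>r. \<forall>u\<in>V. F (r *\<^sub>R u) = r * F u)"

lemma linear_functional_on_sum:
  assumes "linear_functional_on V F" "subspace V" "\<And>i. i \<in> I \<Longrightarrow> b i \<in> V"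
  shows "F (\<Sum>i\<in>I. c i *\<^sub>R b i) = (\<Sum>i\<in>I. c i * F (b i))"
  using assms(3)
proof (induction I rule: infinite_finite_induct)
  case (insert x I)
  have "(\<Sum>i\<in>I. c i *\<^sub>R b i) \<in> V" "c x *\<^sub>R b x \<in> V"
    using assms(2) insert by (auto intro: subspace_sum subspace_scale)
  then show ?case using insert assms(1) by (simp add: linear_functional_on_def)
next
  case empty
  have "F (0 *\<^sub>R 0) = 0 * F 0"
    using assms(1) subspace_0[OF assms(2)] by (simp only: linear_functional_on_def)
  then show ?case by simp
next
  case (infinite I)
  have "F (0 *\<^sub>R 0) = 0 * F 0"
    using assms(1) subspace_0[OF assms(2)] by (simp only: linear_functional_on_def)
  then show ?case using infinite by simp
qed

text \<open>A form on a subspace instead of a type class: the integral pairing meant here is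
  definite on piecewise polynomials but not on arbitrary families of functions.\<close>

locale inner_product_on =
  fixes V :: "'a::real_vector set" and ip :: "'a \<Rightarrow> 'a \<Rightarrow> real"
  assumes subspace: "subspace V"
    and linear: "\<And>w. w \<in> V \<Longrightarrow> linear_functional_on V (\<lambda>u. ip u w)"
    and commute: "\<And>u w. ip u w = ip w u"
    and nonneg: "\<And>u. u \<in> V \<Longrightarrow> ip u u \<ge> 0"
    and definite: "\<And>u. u \<in> V \<Longrightarrow> ip u u = 0 \<Longrightarrow> u = 0"
begin

definition orthonormal :: "'a set \<Rightarrow> bool" where
  "orthonormal E \<longleftrightarrow> finite E \<and> E \<subseteq> V \<and> (\<forall>e\<in>E. \<forall>e'\<in>E. ip e e' = (if e = e' then 1 else 0))"

lemma ip_sum: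
  assumes "E \<subseteq> V" "w \<in> V"
  shows "ip (\<Sum>e\<in>E. c e *\<^sub>R e) w = (\<Sum>e\<in>E. c e * ip e w)"
  using linear_functional_on_sum[OF linear[OF assms(2)] subspace, of E "\<lambda>e. e"] assms(1) by auto

lemma ip_orthonormal:
  assumes "orthonormal E" "e \<in> E"
  shows "ip (\<Sum>e\<in>E. c e *\<^sub>R e) e = c e"
proof -
  have "ip (\<Sum>e\<in>E. c e *\<^sub>R e) e = (\<Sum>e'\<in>E. c e' * ip e' e)"
    using assms by (intro ip_sum) (auto simp: orthonormal_def)
  also have "\<dots> = (\<Sum>e'\<in>E. if e' = e then c e' else 0)"
    using assms by (intro sum.cong) (auto simp: orthonormal_def)
  finally have "ip (\<Sum>e\<in>E. c e *\<^sub>R e) e = (\<Sum>e'\<in>E. if e' = e then c e' else 0)" .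
  then show ?thesis using assms by (simp add: orthonormal_def)
qed

text \<open>Gram-Schmidt by induction on a generating set that may be dependent; a vector whose
  residual \<open>b'\<close> vanishes is skipped.\<close>

lemma orthonormal_basis_exists:
  assumes "finite B" "B \<subseteq> V"
  shows "\<exists>E. orthonormal E \<and> span E = span B"
  using assms
proof (induction B rule: finite_induct)
  case empty
  show ?case by (intro exI[of _ "{}"]) (auto simp: orthonormal_def)
next
  case (insert b B)
  then obtain E where E: "orthonormal E" "span E = span B" by auto
  then have EV: "E \<subseteq> V" "finite E" by (auto simp: orthonormal_def)
  define s where "s = (\<Sum>e\<in>E. ip b e *\<^sub>R e)"
  define b' where "b' = b - s"
  have sE: "s \<in> span E" unfolding s_def by (intro span_sum span_scale span_base)
  have sV: "s \<in> V" using sE EV subspace span_minimal by blast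
  have bV: "b \<in> V" using insert by auto
  have b'V: "b' \<in> V" using bV sV subspace by (auto simp: b'_def subspace_diff)
  show ?case
  proof (cases "b' = 0")
    case True
    then have "b \<in> span B" using sE E by (simp add: b'_def)
    then have "span (insert b B) = span B" by (rule span_redundant)
    then show ?thesis using E by auto
  next
    case False
    define r where "r = sqrt (ip b' b')"
    have r: "r > 0" "r * r = ip b' b'"
      using nonneg[OF b'V] definite[OF b'V] False by (auto simp: r_def less_le)
    define e0 where "e0 = (1/r) *\<^sub>R b'"
    have e0V: "e0 \<in> V" using b'V subspace by (simp add: e0_def subspace_scale)
    have lin: "ip (x *\<^sub>R u) w = x * ip u w" if "u \<in> V" "w \<in> V" for x u w
      using linear[OF that(2)] that(1) by (simp add: linear_functional_on_def)
    have orth: "ip e0 e = 0" if "e \<in> E" for e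
    proof -
      have eV: "e \<in> V" using that EV by auto
      have "ip (b' + s) e = ip b' e + ip s e"
        using linear[OF eV] b'V sV by (simp add: linear_functional_on_def)
      moreover have "ip s e = ip b e" unfolding s_def by (rule ip_orthonormal[OF E(1) that])
      ultimately have "ip b' e = 0" by (simp add: b'_def)
      then show ?thesis using lin[OF b'V eV] by (simp add: e0_def)
    qed
    have "ip e0 e0 = (1/r) * ((1/r) * ip b' b')"
      using lin[OF b'V e0V] lin[OF b'V b'V] unfolding e0_def
      by (simp only: commute[of b' "(1/r) *\<^sub>R b'"])
    then have one: "ip e0 e0 = 1" using r(1) unfolding r(2)[symmetric] by simp
    have "orthonormal (insert e0 E)"
      using E(1) e0V one orth orth[unfolded commute[of e0]] by (auto simp: orthonormal_def)
    moreover have "span (insert e0 E) = span (insert b B)"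
    proof
      have "e0 = (1/r) *\<^sub>R (b - s)" by (simp add: e0_def b'_def)
      moreover have "s \<in> span (insert b B)" "b \<in> span (insert b B)"
        using sE E(2) span_mono[of B "insert b B"] by (auto intro: span_base)
      ultimately have "e0 \<in> span (insert b B)" by (simp add: span_scale span_diff)
      moreover have "E \<subseteq> span (insert b B)"
        using span_superset[of E] E(2) span_mono[of B "insert b B"] by auto
      ultimately show "span (insert e0 E) \<subseteq> span (insert b B)" by (intro span_minimal) auto
      have "b = r *\<^sub>R e0 + s" using r by (simp add: e0_def b'_def)
      moreover have "s \<in> span (insert e0 E)" "e0 \<in> span (insert e0 E)"
        using sE span_mono[of E "insert e0 E"] by (auto intro: span_base)
      ultimately have "b \<in> span (insert e0 E)" by (simp add: span_scale span_add)
      moreover have "B \<subseteq> span (insert e0 E)"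
        using span_superset[of B] E(2) span_mono[of E "insert e0 E"] by auto
      ultimately show "span (insert b B) \<subseteq> span (insert e0 E)" by (intro span_minimal) auto
    qed
    ultimately show ?thesis by blast
  qed
qed

lemma orthonormal_expansion:
  assumes E: "orthonormal E" and v: "v \<in> span E"
  shows "v = (\<Sum>e\<in>E. ip v e *\<^sub>R e)"
proof -
  obtain c where c: "v = (\<Sum>e\<in>E. c e *\<^sub>R e)"
    using v E span_finite[of E] by (auto simp: orthonormal_def)
  have "ip v e = c e" if "e \<in> E" for e using ip_orthonormal[OF E that] c by simp
  then show ?thesis using c by simp
qed

text \<open>The representer is given by an explicit formula linear in \<open>L\<close>; this is what
  later exhibits the discrete gradient as affine in the coordinates.\<close>

lemma riesz_orthonormal:
  assumes E: "orthonormal E" "span E = V" and L: "linear_functional_on V L" and w: "w \<in> V"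
  shows "ip (\<Sum>e\<in>E. L e *\<^sub>R e) w = L w"
proof -
  have EV: "E \<subseteq> V" using E by (auto simp: orthonormal_def)
  have "ip (\<Sum>e\<in>E. L e *\<^sub>R e) w = (\<Sum>e\<in>E. L e * ip e w)" by (rule ip_sum[OF EV w])
  also have "\<dots> = (\<Sum>e\<in>E. ip w e * L e)" by (simp add: mult.commute commute)
  also have "\<dots> = L (\<Sum>e\<in>E. ip w e *\<^sub>R e)"
    using EV by (intro linear_functional_on_sum[OF L subspace, symmetric]) auto
  also have "\<dots> = L w" using orthonormal_expansion[OF E(1)] w E(2) by simp
  finally show ?thesis .
qed

lemma ip_unique:
  assumes "q \<in> V" "q' \<in> V" "\<And>w. w \<in> V \<Longrightarrow> ip q w = ip q' w"
  shows "q = q'"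
proof -
  have d: "q - q' \<in> V" using assms subspace by (simp add: subspace_diff)
  have "ip ((q - q') + q') (q - q') = ip (q - q') (q - q') + ip q' (q - q')"
    using linear[OF d] d assms(2) unfolding linear_functional_on_def by blast
  then have "ip (q - q') (q - q') = 0" using assms(3)[OF d] by simp
  then show ?thesis using definite[OF d] by simp
qed

end

definition finite_dimensional :: "'a::real_vector set \<Rightarrow> bool" where
  "finite_dimensional V \<longleftrightarrow> (\<exists>B. finite B \<and> V = span B)"

lemma finite_dimensional_linear_image:
  assumes "linear f" "finite_dimensional V"
  shows "finite_dimensional (f ` V)"
  using assms linear_span_image unfolding finite_dimensional_def by (metis finite_imageI)

text \<open>Serves two decompositions: families of functions split by element, and vector fields
  split by component.\<close>

lemma finite_dimensional_sums:
  assumes fin: "finite I" and V: "\<And>i. i \<in> I \<Longrightarrow> finite_dimensional (V i)"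
    and sub: "\<And>i. i \<in> I \<Longrightarrow> V i \<subseteq> W" and W: "subspace W"
    and sum: "\<And>w. w \<in> W \<Longrightarrow> \<exists>u. w = (\<Sum>i\<in>I. u i) \<and> (\<forall>i\<in>I. u i \<in> V i)"
  shows "finite_dimensional W"
proof -
  obtain B where B: "\<And>i. i \<in> I \<Longrightarrow> finite (B i) \<and> V i = span (B i)"
    using V unfolding finite_dimensional_def by metis
  have "W = span (\<Union>i\<in>I. B i)"
  proof
    show "W \<subseteq> span (\<Union>i\<in>I. B i)"
    proof
      fix w assume "w \<in> W"
      then obtain u where u: "w = (\<Sum>i\<in>I. u i)" "\<forall>i\<in>I. u i \<in> V i" using sum by blast
      have "u i \<in> span (\<Union>i\<in>I. B i)" if "i \<in> I" for i
        using u(2) B that span_mono[of "B i" "\<Union>i\<in>I. B i"] by blast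
      then show "w \<in> span (\<Union>i\<in>I. B i)" unfolding u(1) by (rule span_sum)
    qed
    have "B i \<subseteq> W" if "i \<in> I" for i using sub[OF that] B[OF that] span_superset by blast
    then show "span (\<Union>i\<in>I. B i) \<subseteq> W" using W by (intro span_minimal) auto
  qed
  then show ?thesis unfolding finite_dimensional_def using fin B by blast
qed

text \<open>Families vanish outside \<open>T\<close>, whereas \<open>V_h\<close> and
  \<open>Q_h\<close> are extensional with value \<open>undefined\<close> there; zero makes the set a
  subspace.\<close>

definition broken :: "'i set \<Rightarrow> 'a::real_vector set \<Rightarrow> ('i \<Rightarrow> 'a) set" where
  "broken T P = {v. (\<forall>K\<in>T. v K \<in> P) \<and> (\<forall>K. K \<notin> T \<longrightarrow> v K = 0)}"

lemma subspace_broken: "subspace P \<Longrightarrow> subspace (broken T P)"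
  by (auto simp: broken_def subspace_def)

lemma finite_dimensional_broken:
  assumes "finite T" "subspace P" "finite_dimensional P"
  shows "finite_dimensional (broken T P)"
proof -
  define \<iota> where "\<iota> K u = (\<lambda>K'. if K' = K then u else (0::'b))" for K :: 'a and u
  have lin: "linear (\<iota> K)" for K by (intro linearI) (auto simp: \<iota>_def)
  show ?thesis
  proof (rule finite_dimensional_sums[of T "\<lambda>K. \<iota> K ` P"])
    show "finite_dimensional (\<iota> K ` P)" for K
      by (rule finite_dimensional_linear_image[OF lin assms(3)])
    show "\<iota> K ` P \<subseteq> broken T P" if "K \<in> T" for K
      using that subspace_0[OF assms(2)] by (auto simp: broken_def \<iota>_def)
    show "\<exists>u. w = (\<Sum>K\<in>T. u K) \<and> (\<forall>K\<in>T. u K \<in> \<iota> K ` P)" if w: "w \<in> broken T P" for w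
    proof (intro exI[of _ "\<lambda>K. \<iota> K (w K)"] conjI ballI)
      show "w = (\<Sum>K\<in>T. \<iota> K (w K))"
      proof
        fix K'
        show "w K' = (\<Sum>K\<in>T. \<iota> K (w K)) K'"
          using w assms(1) by (auto simp: sum_fun_apply \<iota>_def broken_def)
      qed
      show "\<iota> K (w K) \<in> \<iota> K ` P" if "K \<in> T" for K using w that by (auto simp: broken_def)
    qed
  qed (use assms subspace_broken in auto)
qed

lemma finite_dimensional_basis:
  assumes "finite_dimensional V"
  obtains N :: nat and b where "\<forall>i<N. b i \<in> V"
    "\<forall>v\<in>V. \<exists>c. v = (\<Sum>i<N. c i *\<^sub>R b i)"
    "\<forall>c. (\<Sum>i<N. c i *\<^sub>R b i) = 0 \<longrightarrow> (\<forall>i<N. c i = 0)"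
proof -
  obtain B0 where B0: "finite B0" "V = span B0" using assms by (auto simp: finite_dimensional_def)
  obtain B where B: "B \<subseteq> B0" "independent B" "B0 \<subseteq> span B"
    using maximal_independent_subset[of B0] by blast
  have fin: "finite B" using B(1) B0(1) finite_subset by blast
  have V: "V = span B" using B B0 by (metis span_minimal span_mono subset_antisym subspace_span)
  obtain b where b: "bij_betw b {..<card B} B"
    using ex_bij_betw_nat_finite[OF fin] by (auto simp: atLeast0LessThan)
  have reidx: "(\<Sum>i<card B. c i *\<^sub>R b i) = (\<Sum>x\<in>B. c (inv_into {..<card B} b x) *\<^sub>R x)" for c :: "nat \<Rightarrow> real"
  proof -
    have "(\<Sum>i<card B. c i *\<^sub>R b i) = (\<Sum>x\<in>B. c (inv_into {..<card B} b x) *\<^sub>R b (inv_into {..<card B} b x))"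
      by (rule sum.reindex_bij_betw[OF bij_betw_inv_into[OF b], symmetric])
    also have "\<dots> = (\<Sum>x\<in>B. c (inv_into {..<card B} b x) *\<^sub>R x)"
      using b by (intro sum.cong) (auto simp: bij_betw_def f_inv_into_f)
    finally show ?thesis .
  qed
  show thesis
  proof (rule that[of "card B" b]; intro allI ballI impI)
    show "b i \<in> V" if "i < card B" for i
      using b that V by (auto simp: bij_betw_def intro!: span_base)
    show "\<exists>c. v = (\<Sum>i<card B. c i *\<^sub>R b i)" if v: "v \<in> V" for v
    proof -
      obtain u where "v = (\<Sum>x\<in>B. u x *\<^sub>R x)" using v V fin span_finite[OF fin] by auto
      also have "\<dots> = (\<Sum>i<card B. u (b i) *\<^sub>R b i)"
        by (rule sum.reindex_bij_betw[OF b, symmetric])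
      finally show ?thesis by (intro exI[of _ "\<lambda>i. u (b i)"])
    qed
    show "c i = 0" if z: "(\<Sum>i<card B. c i *\<^sub>R b i) = 0" and i: "i < card B" for c i
    proof -
      have "(\<Sum>x\<in>B. c (inv_into {..<card B} b x) *\<^sub>R x) = 0" using z reidx by simp
      moreover have "b i \<in> B" using b i by (auto simp: bij_betw_def)
      ultimately have "c (inv_into {..<card B} b (b i)) = 0"
        using B(2) fin by (auto simp: dependent_finite)
      then show ?thesis using b i by (auto simp: bij_betw_def)
    qed
  qed
qed

section \<open>Polynomials\<close>

definition multi_indices :: "nat \<Rightarrow> ('n::finite \<Rightarrow> nat) set" where
  "multi_indices k = {\<alpha>. (\<Sum>i\<in>UNIV. \<alpha> i) \<le> k}"

definition monomial :: "('n::finite \<Rightarrow> nat) \<Rightarrow> real^'n \<Rightarrow> real" where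
  "monomial \<alpha> x = (\<Prod>i\<in>UNIV. (x $ i) ^ \<alpha> i)"

lemma finite_multi_indices: "finite (multi_indices k)"
proof (rule finite_subset)
  show "multi_indices k \<subseteq> {\<alpha>::'a \<Rightarrow> nat. \<forall>i. \<alpha> i \<in> {..k}}"
  proof (clarsimp simp: multi_indices_def)
    fix \<alpha> :: "'a \<Rightarrow> nat" and i assume "(\<Sum>i\<in>UNIV. \<alpha> i) \<le> k"
    then show "\<alpha> i \<le> k" using member_le_sum[of i UNIV \<alpha>] by auto
  qed
  have "finite (PiE (UNIV :: 'a set) (\<lambda>_. {..k}))" by (intro finite_PiE) auto
  then show "finite {\<alpha>::'a \<Rightarrow> nat. \<forall>i. \<alpha> i \<in> {..k}}"
    by (rule rev_finite_subset) (auto simp: PiE_def)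
qed

lemma poly_space_eq_span:
  "(poly_space k :: (real^'a \<Rightarrow> real) set) = span (monomial ` multi_indices k)"
proof
  show "(poly_space k :: (real^'a \<Rightarrow> real) set) \<subseteq> span (monomial ` multi_indices k)"
  proof
    fix P :: "real^'a \<Rightarrow> real" assume "P \<in> poly_space k"
    then obtain c where c: "\<forall>x. P x = (\<Sum>\<alpha>\<in>multi_indices k. c \<alpha> * monomial \<alpha> x)"
      by (auto simp: poly_space_def multi_indices_def monomial_def)
    then have "P = (\<Sum>\<alpha>\<in>multi_indices k. c \<alpha> *\<^sub>R monomial \<alpha>)"
      by (auto simp: sum_fun_apply)
    also have "\<dots> \<in> span (monomial ` multi_indices k)"
      by (intro span_sum span_scale span_base) auto
    finally show "P \<in> span (monomial ` multi_indices k)" .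
  qed
  have sub: "subspace (poly_space k :: (real^'a \<Rightarrow> real) set)"
    unfolding subspace_def
  proof (intro conjI ballI allI)
    show "(0 :: real^'a \<Rightarrow> real) \<in> poly_space k"
      by (auto simp: poly_space_def intro!: exI[of _ "\<lambda>_. 0"])
    fix P Q :: "real^'a \<Rightarrow> real" and r :: real
    assume P: "P \<in> poly_space k"
    then obtain c where c: "\<forall>x. P x = (\<Sum>\<alpha>\<in>multi_indices k. c \<alpha> * monomial \<alpha> x)"
      by (auto simp: poly_space_def multi_indices_def monomial_def)
    show "r *\<^sub>R P \<in> poly_space k"
      unfolding poly_space_def multi_indices_def[symmetric] monomial_def[symmetric]
      using c by (auto intro!: exI[of _ "\<lambda>\<alpha>. r * c \<alpha>"] simp: sum_distrib_left mult.assoc)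
    assume "Q \<in> poly_space k"
    then obtain d where d: "\<forall>x. Q x = (\<Sum>\<alpha>\<in>multi_indices k. d \<alpha> * monomial \<alpha> x)"
      by (auto simp: poly_space_def multi_indices_def monomial_def)
    show "P + Q \<in> poly_space k"
      unfolding poly_space_def multi_indices_def[symmetric] monomial_def[symmetric]
      using c d by (auto intro!: exI[of _ "\<lambda>\<alpha>. c \<alpha> + d \<alpha>"] simp: sum.distrib algebra_simps)
  qed
  show "span (monomial ` multi_indices k) \<subseteq> (poly_space k :: (real^'a \<Rightarrow> real) set)"
  proof (rule span_minimal[OF _ sub], clarify)
    fix \<alpha> :: "'a \<Rightarrow> nat" assume "\<alpha> \<in> multi_indices k"
    then have "monomial \<alpha> x = (\<Sum>\<beta>\<in>multi_indices k. (if \<beta> = \<alpha> then 1 else 0) * monomial \<beta> x)" for x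
      using finite_multi_indices[of k, where 'a='a]
      by (simp add: if_distrib[of "\<lambda>t. t * _"] cong: if_cong)
    then show "monomial \<alpha> \<in> poly_space k"
      unfolding poly_space_def multi_indices_def[symmetric] monomial_def[symmetric]
      by (intro CollectI exI[of _ "\<lambda>\<beta>. if \<beta> = \<alpha> then 1 else 0"]) blast
  qed
qed

lemma subspace_poly_space: "subspace (poly_space k)"
  unfolding poly_space_eq_span by (rule subspace_span)

lemma finite_dimensional_poly_space: "finite_dimensional (poly_space k)"
  unfolding finite_dimensional_def poly_space_eq_span using finite_multi_indices by blast

lemma subspace_vec_poly_space: "subspace (vec_poly_space k :: (real^'n \<Rightarrow> real^'n) set)"
proof -
  have eq: "(\<lambda>x. (P + Q) x $ i) = (\<lambda>x. P x $ i) + (\<lambda>x. Q x $ i)"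
    "(\<lambda>x. (r *\<^sub>R P) x $ i) = r *\<^sub>R (\<lambda>x. P x $ i)" "(\<lambda>x. 0 x $ i) = 0"
    for P Q :: "real^'n \<Rightarrow> real^'n" and r i by auto
  show ?thesis
    unfolding subspace_def vec_poly_space_def mem_Collect_eq eq
    using subspace_poly_space[of k] by (auto simp: subspace_def)
qed

lemma finite_dimensional_vec_poly_space:
  "finite_dimensional (vec_poly_space k :: (real^'n \<Rightarrow> real^'n) set)"
proof -
  define \<iota> where "\<iota> i p = (\<lambda>x. p x *\<^sub>R (axis i 1 :: real^'n))" for i :: 'n and p :: "real^'n \<Rightarrow> real"
  have lin: "linear (\<iota> i)" for i by (intro linearI) (auto simp: \<iota>_def algebra_simps)
  show ?thesis
  proof (rule finite_dimensional_sums[of UNIV "\<lambda>i. \<iota> i ` poly_space k"])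
    show "finite_dimensional (\<iota> i ` poly_space k)" for i
      by (rule finite_dimensional_linear_image[OF lin finite_dimensional_poly_space])
    show "\<iota> i ` poly_space k \<subseteq> vec_poly_space k" for i
    proof (clarsimp simp: vec_poly_space_def \<iota>_def)
      fix p :: "real^'n \<Rightarrow> real" and j assume p: "p \<in> poly_space k"
      have "(\<lambda>x. p x * axis i 1 $ j) = (if i = j then p else 0)" by (auto simp: axis_def)
      then show "(\<lambda>x. p x * axis i 1 $ j) \<in> poly_space k"
        using p subspace_0[OF subspace_poly_space[where 'a='n]] by simp
    qed
    show "\<exists>u. w = (\<Sum>i\<in>UNIV. u i) \<and> (\<forall>i\<in>UNIV. u i \<in> \<iota> i ` poly_space k)"
      if w: "w \<in> vec_poly_space k" for w
    proof (intro exI[of _ "\<lambda>i. \<iota> i (\<lambda>x. w x $ i)"] conjI ballI)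
      show "w = (\<Sum>i\<in>UNIV. \<iota> i (\<lambda>x. w x $ i))"
        by (auto simp: sum_fun_apply \<iota>_def vec_eq_iff axis_def if_distrib cong: if_cong)
      show "\<iota> i (\<lambda>x. w x $ i) \<in> \<iota> i ` poly_space k" for i
        using w by (auto simp: vec_poly_space_def)
    qed
  qed (use subspace_vec_poly_space in auto)
qed

lemma real_polynomial_function_monomial: "real_polynomial_function (monomial \<alpha>)"
  unfolding monomial_def[abs_def]
  by (intro real_polynomial_function_prod real_polynomial_function_power
      real_polynomial_function.intros(1) bounded_linear_vec_nth) auto

lemma real_polynomial_function_poly_space:
  assumes "P \<in> poly_space k"
  shows "real_polynomial_function P"
proof -
  obtain c where c: "\<forall>x. P x = (\<Sum>\<alpha>\<in>multi_indices k. c \<alpha> * monomial \<alpha> x)"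
    using assms by (auto simp: poly_space_def multi_indices_def monomial_def)
  then have P: "P = (\<lambda>x. \<Sum>\<alpha>\<in>multi_indices k. c \<alpha> * monomial \<alpha> x)" by auto
  show ?thesis unfolding P
    by (intro real_polynomial_function_sum finite_multi_indices real_polynomial_function.intros(4)
        real_polynomial_function.intros(2) real_polynomial_function_monomial)
qed

lemma continuous_on_poly_space: "P \<in> poly_space k \<Longrightarrow> continuous_on S P"
  using differentiable_on_real_polynomial_function[OF real_polynomial_function_poly_space]
  by (blast intro: differentiable_imp_continuous_on)

lemma continuous_on_vec_poly_space:
  assumes "P \<in> vec_poly_space k" shows "continuous_on S P"
proof -
  have "continuous_on S (\<lambda>x. \<chi> i. P x $ i)"
    using assms by (intro continuous_on_vec_lambda continuous_on_poly_space[of _ k]) (auto simp: vec_poly_space_def)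
  then show ?thesis by simp
qed

text \<open>On the line from \<open>x0\<close> through \<open>y\<close> the polynomial minus
  \<open>c\<close> has one real variable and vanishes for all small positive parameters, hence
  identically; the parameter 1 gives \<open>y\<close>.\<close>

lemma real_polynomial_function_constant_on_open:
  fixes P :: "'a::euclidean_space \<Rightarrow> real"
  assumes P: "real_polynomial_function P" and U: "open U" "U \<noteq> {}" "\<And>x. x \<in> U \<Longrightarrow> P x = c"
  shows "P y = c"
proof -
  obtain x0 where x0: "x0 \<in> U" using U by blast
  obtain r where r: "r > 0" "ball x0 r \<subseteq> U" using x0 U(1) open_contains_ball by blast
  define g where "g t = x0 + t *\<^sub>R (y - x0)" for t :: real
  have g: "polynomial_function g"
    unfolding g_def by (intro polynomial_function_add polynomial_function_mult
        polynomial_function_const polynomial_function_id[unfolded id_def])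
  have "real_polynomial_function ((\<lambda>x. P x - c) \<circ> g)"
    by (intro real_polynomial_function_compose g real_polynomial_function_diff P real_polynomial_function.intros(2))
  then obtain a n where a: "((\<lambda>x. P x - c) \<circ> g) = (\<lambda>t. \<Sum>i\<le>n. a i * t ^ i)"
    unfolding real_polynomial_function_iff_sum by blast
  \<comment> \<open>Small enough for \<open>g t\<close> to stay in the ball around
    \<open>x0\<close>; the summand 1 keeps the denominator positive when
    \<open>y = x0\<close>.\<close>
  define \<delta> where "\<delta> = r / (norm (y - x0) + 1)"
  have \<delta>: "\<delta> > 0" unfolding \<delta>_def using r by (intro divide_pos_pos) (auto intro: add_nonneg_pos)
  have "{0<..<\<delta>} \<subseteq> {t. (\<Sum>i\<le>n. a i * t ^ i) = 0}"
  proof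
    fix t assume "t \<in> {0<..<\<delta>}"
    then have t: "0 < t" "t < \<delta>" by auto
    have "norm (t *\<^sub>R (y - x0)) = t * norm (y - x0)" using t by simp
    also have "\<dots> \<le> t * (norm (y - x0) + 1)" using t by (intro mult_left_mono) auto
    also have "\<dots> < \<delta> * (norm (y - x0) + 1)"
      using t by (intro mult_strict_right_mono) (auto intro: add_nonneg_pos)
    also have "\<dots> = r" by (simp add: \<delta>_def add_nonneg_eq_0_iff)
    finally have "g t \<in> U" using r by (auto simp: g_def dist_norm)
    then show "t \<in> {t. (\<Sum>i\<le>n. a i * t ^ i) = 0}" using U(3) fun_cong[OF a, of t] by simp
  qed
  then have "infinite {t. (\<Sum>i\<le>n. a i * t ^ i) = 0}"
    using infinite_Ioo[OF \<delta>] finite_subset by blast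
  then have "\<forall>i\<le>n. a i = 0" using polyfun_finite_roots[of a n] by blast
  then have "((\<lambda>x. P x - c) \<circ> g) 1 = 0" unfolding a by simp
  then show ?thesis by (simp add: g_def)
qed

section \<open>Gradients of polynomials\<close>

lemma monomial_has_derivative:
  "(monomial \<alpha> has_derivative
     (\<lambda>v. \<Sum>i\<in>UNIV. (of_nat (\<alpha> i) * v $ i * (x $ i) ^ (\<alpha> i - 1)) * (\<Prod>j\<in>UNIV - {i}. (x $ j) ^ \<alpha> j))) (at x)"
  unfolding monomial_def[abs_def]
  by (intro has_derivative_prod has_derivative_power bounded_linear.has_derivative[OF bounded_linear_vec_nth] has_derivative_ident)

text \<open>Truncated subtraction is harmless: if \<open>\<alpha> i = 0\<close>, the factor
  \<open>of_nat (\<alpha> i)\<close> vanishes.\<close>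

lemma gradient_monomial:
  "gradient (monomial \<alpha>) x $ i = of_nat (\<alpha> i) * monomial (\<alpha>(i := \<alpha> i - 1)) x"
proof -
  have "gradient (monomial \<alpha>) x $ i =
      (\<Sum>j\<in>UNIV. (of_nat (\<alpha> j) * axis i 1 $ j * (x $ j) ^ (\<alpha> j - 1)) * (\<Prod>l\<in>UNIV - {j}. (x $ l) ^ \<alpha> l))"
    unfolding gradient_def frechet_derivative_at[OF monomial_has_derivative, symmetric] by simp
  also have "\<dots> = (\<Sum>j\<in>UNIV. if j = i then
      of_nat (\<alpha> i) * ((x $ i) ^ (\<alpha> i - 1) * (\<Prod>l\<in>UNIV - {i}. (x $ l) ^ \<alpha> l)) else 0)"
    by (intro sum.cong) (auto simp: axis_def)
  also have "\<dots> = of_nat (\<alpha> i) * ((x $ i) ^ (\<alpha> i - 1) * (\<Prod>l\<in>UNIV - {i}. (x $ l) ^ \<alpha> l))"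
    by simp
  also have "(x $ i) ^ (\<alpha> i - 1) * (\<Prod>l\<in>UNIV - {i}. (x $ l) ^ \<alpha> l) = monomial (\<alpha>(i := \<alpha> i - 1)) x"
    unfolding monomial_def by (subst (2) prod.remove[of _ i]) (auto intro!: prod.cong)
  finally show ?thesis .
qed

lemma poly_space_differentiable:
  assumes "P \<in> poly_space k" shows "P differentiable (at x)"
  using differentiable_at_real_polynomial_function[OF real_polynomial_function_poly_space[OF assms]]
  by simp

lemma gradient_add:
  assumes "u differentiable (at x)" "v differentiable (at x)"
  shows "gradient (u + v) x = gradient u x + gradient v x"
proof -
  have "((\<lambda>x. u x + v x) has_derivative
      (\<lambda>h. frechet_derivative u (at x) h + frechet_derivative v (at x) h)) (at x)"
    using assms by (intro has_derivative_add) (simp_all flip: frechet_derivative_works)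
  then have "frechet_derivative (u + v) (at x) =
      (\<lambda>h. frechet_derivative u (at x) h + frechet_derivative v (at x) h)"
    by (simp add: plus_fun_def frechet_derivative_at[symmetric])
  then show ?thesis by (simp add: gradient_def vec_eq_iff)
qed

lemma gradient_scaleR:
  assumes "u differentiable (at x)"
  shows "gradient (r *\<^sub>R u) x = r *\<^sub>R gradient u x"
proof -
  have "((\<lambda>x. r *\<^sub>R u x) has_derivative (\<lambda>h. r *\<^sub>R frechet_derivative u (at x) h)) (at x)"
    using assms by (intro has_derivative_scaleR_right) (simp_all flip: frechet_derivative_works)
  then have "frechet_derivative (r *\<^sub>R u) (at x) = (\<lambda>h. r *\<^sub>R frechet_derivative u (at x) h)"
    by (simp add: scaleR_fun_def frechet_derivative_at[symmetric])
  then show ?thesis by (simp add: gradient_def vec_eq_iff)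
qed

lemma gradient_zero: "gradient 0 x = 0"
  using gradient_scaleR[of 0 x 0] by (simp add: zero_fun_def)

text \<open>Scalar and vector spaces share the degree \<open>k\<close>, so the broken gradient of a
  discrete function may be inserted as test field in the definition of the discrete
  gradient.\<close>

lemma gradient_poly_space:
  assumes "P \<in> poly_space k"
  shows "gradient P \<in> vec_poly_space k"
proof -
  have "P \<in> span (monomial ` multi_indices k)" using assms poly_space_eq_span by blast
  then have "P \<in> poly_space k \<and> gradient P \<in> vec_poly_space k"
  proof (induction rule: span_induct_alt)
    case base
    have "gradient 0 = 0" by (auto simp: gradient_zero)
    then show ?case using subspace_0[OF subspace_poly_space] subspace_0[OF subspace_vec_poly_space] by metis
  next
    case (step r m P)
    then obtain \<alpha> where \<alpha>: "m = monomial \<alpha>" "\<alpha> \<in> multi_indices k" by blast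
    have m: "m \<in> poly_space k" unfolding poly_space_eq_span using \<alpha> by (auto intro: span_base)
    have "(\<lambda>x. gradient m x $ i) \<in> poly_space k" for i
    proof -
      have "(\<Sum>j\<in>UNIV. (\<alpha>(i := \<alpha> i - 1)) j) \<le> (\<Sum>j\<in>UNIV. \<alpha> j)" by (intro sum_mono) auto
      then have "\<alpha>(i := \<alpha> i - 1) \<in> multi_indices k"
        using \<alpha>(2) by (simp add: multi_indices_def)
      then have "monomial (\<alpha>(i := \<alpha> i - 1)) \<in> poly_space k"
        unfolding poly_space_eq_span by (auto intro: span_base)
      then have "of_nat (\<alpha> i) *\<^sub>R monomial (\<alpha>(i := \<alpha> i - 1)) \<in> poly_space k"
        by (rule subspace_scale[OF subspace_poly_space])
      moreover have "(\<lambda>x. gradient m x $ i) = of_nat (\<alpha> i) *\<^sub>R monomial (\<alpha>(i := \<alpha> i - 1))"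
        by (auto simp: \<alpha>(1) gradient_monomial)
      ultimately show ?thesis by simp
    qed
    then have gm: "gradient m \<in> vec_poly_space k" by (auto simp: vec_poly_space_def)
    have rm: "r *\<^sub>R m \<in> poly_space k" using m by (rule subspace_scale[OF subspace_poly_space])
    have "gradient (r *\<^sub>R m + P) = r *\<^sub>R gradient m + gradient P"
      using m rm step by (auto simp: gradient_add gradient_scaleR poly_space_differentiable)
    then show ?case
      using gm rm step subspace_poly_space subspace_vec_poly_space
      by (metis subspace_add subspace_scale)
  qed
  then show ?thesis by blast
qed

lemma gradient_zero_constant:
  fixes P :: "real^'n \<Rightarrow> real"
  assumes P: "P \<in> poly_space k" and U: "convex U" "open U" "U \<noteq> {}" "\<And>x. x \<in> U \<Longrightarrow> gradient P x = 0"
  shows "\<exists>c. \<forall>x. P x = c"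
proof -
  have "(P has_derivative (\<lambda>h. 0)) (at x within U)" if x: "x \<in> U" for x
  proof -
    let ?D = "frechet_derivative P (at x)"
    have D: "(P has_derivative ?D) (at x)"
      using poly_space_differentiable[OF P] frechet_derivative_works by blast
    have lin: "linear ?D" using D has_derivative_linear by blast
    have "?D (axis i 1) = 0" for i using U(4)[OF x] by (simp add: gradient_def vec_eq_iff)
    then have "?D b = 0" if "b \<in> Basis" for b :: "real^'n" using that by (auto simp: Basis_vec_def)
    then have "?D h = 0" for h using linear_eq_stdbasis[OF lin linear_zero] by metis
    then have "?D = (\<lambda>h. 0)" by auto
    then show ?thesis using D has_derivative_at_withinI by metis
  qed
  then obtain c where "\<And>x. x \<in> U \<Longrightarrow> P x = c"
    using has_derivative_zero_constant[OF U(1), of P] by blast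
  then show ?thesis
    using real_polynomial_function_constant_on_open[OF real_polynomial_function_poly_space[OF P] U(2,3)]
    by blast
qed

section \<open>Coercive minimisation in coordinates\<close>

text \<open>The dimension depends on mesh and degree, so coordinate vectors are sequences of which
  only the first \<open>N\<close> entries count. Convergence of these entries alone has to suffice,
  which also forces the value to ignore the others.\<close>

definition coord_continuous :: "nat \<Rightarrow> ((nat \<Rightarrow> real) \<Rightarrow> real) \<Rightarrow> bool" where
  "coord_continuous N G \<longleftrightarrow>
     (\<forall>X c. (\<forall>i<N. (\<lambda>n. X n i) \<longlonglongrightarrow> c i) \<longrightarrow> (\<lambda>n. G (X n)) \<longlonglongrightarrow> G c)"

lemma coord_continuousD:
  "coord_continuous N G \<Longrightarrow> (\<And>i. i < N \<Longrightarrow> (\<lambda>n. X n i) \<longlonglongrightarrow> c i) \<Longrightarrow> (\<lambda>n. G (X n)) \<longlonglongrightarrow> G c"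
  unfolding coord_continuous_def by blast

lemma coord_continuousI:
  "(\<And>X c. (\<And>i. i < N \<Longrightarrow> (\<lambda>n. X n i) \<longlonglongrightarrow> c i) \<Longrightarrow> (\<lambda>n. G (X n)) \<longlonglongrightarrow> G c) \<Longrightarrow> coord_continuous N G"
  unfolding coord_continuous_def by blast

text \<open>The constant sequence \<open>c\<close> converges to \<open>c'\<close> in the first
  \<open>N\<close> coordinates.\<close>

lemma coord_continuous_cong:
  assumes "coord_continuous N G" "\<And>i. i < N \<Longrightarrow> c i = c' i"
  shows "G c = G c'"
proof -
  have "(\<lambda>_::nat. c i) \<longlonglongrightarrow> c' i" if "i < N" for i
    unfolding assms(2)[OF that] by (rule tendsto_const)
  then have "(\<lambda>_::nat. G c) \<longlonglongrightarrow> G c'"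
    by (rule coord_continuousD[OF assms(1), of "\<lambda>_. c" c'])
  then show ?thesis by (simp add: LIMSEQ_const_iff)
qed

lemma coord_continuous_add:
  "coord_continuous N F \<Longrightarrow> coord_continuous N G \<Longrightarrow> coord_continuous N (\<lambda>c. F c + G c)"
  by (rule coord_continuousI, rule tendsto_add) (auto intro: coord_continuousD)

lemma coord_continuous_diff:
  "coord_continuous N F \<Longrightarrow> coord_continuous N G \<Longrightarrow> coord_continuous N (\<lambda>c. F c - G c)"
  by (rule coord_continuousI, rule tendsto_diff) (auto intro: coord_continuousD)

lemma coord_continuous_mult_left:
  "coord_continuous N G \<Longrightarrow> coord_continuous N (\<lambda>c. a * G c)"
  by (rule coord_continuousI, rule tendsto_mult_left) (auto intro: coord_continuousD)

lemma coord_continuous_linear: "coord_continuous N (\<lambda>c. \<Sum>i<N. c i * l i)"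
  unfolding coord_continuous_def by (auto intro!: tendsto_sum tendsto_mult_right)

lemma coord_continuous_l1: "coord_continuous N (\<lambda>c. \<Sum>i<N. \<bar>c i\<bar>)"
  unfolding coord_continuous_def by (auto intro!: tendsto_sum tendsto_rabs)

lemma coord_continuous_imp_continuous_on:
  assumes "coord_continuous N G"
  shows "continuous_on S G"
  unfolding continuous_on_sequentially comp_def
proof (intro allI ballI impI)
  fix X and c :: "nat \<Rightarrow> real"
  assume X: "(\<forall>n. X n \<in> S) \<and> X \<longlonglongrightarrow> c"
  have "(\<lambda>n. X n i) \<longlonglongrightarrow> c i" for i
    by (rule continuous_on_tendsto_compose[OF continuous_on_product_coordinates]) (use X in auto)
  then show "(\<lambda>n. G (X n)) \<longlonglongrightarrow> G c" by (intro coord_continuousD[OF assms])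
qed

text \<open>Tychonoff's theorem, with all coordinates from \<open>N\<close> on pinned to 0.\<close>

lemma compact_coordinate_box:
  "compact {c::nat \<Rightarrow> real. (\<forall>i<N. \<bar>c i\<bar> \<le> R) \<and> (\<forall>i\<ge>N. c i = 0)}"
proof -
  define I :: "nat \<Rightarrow> real set" where "I i = (if i < N then {-R..R} else {0})" for i
  have "compactin (product_topology (\<lambda>_. euclidean) UNIV) (PiE UNIV I)"
    unfolding compactin_PiE by (auto simp: I_def)
  then have "compact (PiE UNIV I)"
    by (simp add: euclidean_product_topology)
  also have "PiE UNIV I = {c. (\<forall>i<N. \<bar>c i\<bar> \<le> R) \<and> (\<forall>i\<ge>N. c i = 0)}"
  proof -
    have "c i \<in> I i \<longleftrightarrow> (i < N \<longrightarrow> \<bar>c i\<bar> \<le> R) \<and> (i \<ge> N \<longrightarrow> c i = 0)" for c :: "nat \<Rightarrow> real" and i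
      unfolding I_def by (cases "i < N") auto
    then show ?thesis unfolding PiE_UNIV_domain Pi_def by auto
  qed
  finally show ?thesis .
qed

text \<open>\<open>B\<close> is chosen so that \<open>R powr (p - 1) \<ge> B\<close> gives
  \<open>\<delta> * R powr p \<ge> (A + \<bar>K\<bar>) * R\<close>; then \<open>R \<ge> 1\<close>
  bounds \<open>K\<close> by \<open>\<bar>K\<bar> * R\<close>. The exponent \<open>p - 1\<close> has
  to be positive for such \<open>R\<close> to exist.\<close>

lemma powr_coercive:
  fixes p \<delta> A K :: real
  assumes "1 < p" "0 < \<delta>" "0 \<le> A"
  shows "\<exists>R0>0. \<forall>R\<ge>R0. K \<le> \<delta> * R powr p - A * R"
proof -
  define B where "B = (A + \<bar>K\<bar>) / \<delta>"
  have B: "B \<ge> 0" "\<delta> * B = A + \<bar>K\<bar>" using assms by (auto simp: B_def)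
  define R0 where "R0 = max 1 (B powr (1 / (p - 1)))"
  have "K \<le> \<delta> * R powr p - A * R" if R: "R \<ge> R0" for R
  proof -
    have R1: "R \<ge> 1" "R \<ge> B powr (1 / (p - 1))" using R by (auto simp: R0_def)
    have "(B powr (1 / (p - 1))) powr (p - 1) \<le> R powr (p - 1)"
      using R1 assms by (intro powr_mono2) auto
    then have "B \<le> R powr (p - 1)" using B assms by (auto simp: powr_powr)
    then have "\<delta> * B * R \<le> \<delta> * R powr (p - 1) * R" using assms R1 by (intro mult_right_mono mult_left_mono) auto
    also have "\<dots> = \<delta> * R powr p" using R1 by (simp add: powr_diff)
    finally have "(A + \<bar>K\<bar>) * R \<le> \<delta> * R powr p" unfolding B(2) .
    moreover have "\<bar>K\<bar> * 1 \<le> \<bar>K\<bar> * R" using R1 by (intro mult_left_mono) auto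
    ultimately show ?thesis by (simp add: algebra_simps)
  qed
  moreover have "R0 > 0" by (simp add: R0_def)
  ultimately show ?thesis by blast
qed

text \<open>On the l1 unit sphere \<open>G0\<close> has a positive lower bound
  \<open>\<delta>\<close>, and scaling of degree \<open>p\<close> gives
  \<open>G0 c \<ge> \<delta> * n c powr p\<close>. The linear term is at most
  \<open>A * n c\<close>, so for large \<open>n c\<close> no value falls below the one at 0, and a
  minimum over a compact box is global.\<close>

lemma coercive_attains_min:
  fixes G G0 :: "(nat \<Rightarrow> real) \<Rightarrow> real"
  assumes p: "1 < p" and a: "0 < a"
    and G: "coord_continuous N G" and G0: "coord_continuous N G0"
    and hom: "\<And>t c. 0 \<le> t \<Longrightarrow> G0 (\<lambda>i. t * c i) = t powr p * G0 c"
    and nonneg: "\<And>c. 0 \<le> G0 c"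
    and definite: "\<And>c i. G0 c = 0 \<Longrightarrow> i < N \<Longrightarrow> c i = 0"
    and lower: "\<And>c. a * G0 c - C \<le> G c"
  shows "\<exists>c. \<forall>c'. G c - (\<Sum>i<N. c i * l i) \<le> G c' - (\<Sum>i<N. c' i * l i)"
proof -
  define F where "F c = G c - (\<Sum>i<N. c i * l i)" for c
  define n where "n c = (\<Sum>i<N. \<bar>c i\<bar>)" for c :: "nat \<Rightarrow> real"
  \<comment> \<open>Invisible to coordinate-continuous functions, but it moves a vector into the
    compact box.\<close>
  define cut where "cut c = (\<lambda>i. if i < N then c i else 0)" for c :: "nat \<Rightarrow> real"
  define Box where "Box R = {c::nat \<Rightarrow> real. (\<forall>i<N. \<bar>c i\<bar> \<le> R) \<and> (\<forall>i\<ge>N. c i = 0)}" for R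
  have Fc: "coord_continuous N F" unfolding F_def[abs_def]
    by (intro coord_continuous_diff G coord_continuous_linear)
  have nc: "coord_continuous N n" unfolding n_def[abs_def] by (rule coord_continuous_l1)
  have cut: "H (cut c) = H c" if "coord_continuous N H" for H c
    by (rule coord_continuous_cong[OF that]) (simp add: cut_def)
  have le_n: "\<bar>c i\<bar> \<le> n c" if "i < N" for c i
    using that member_le_sum[of i "{..<N}" "\<lambda>i. \<bar>c i\<bar>"] by (auto simp: n_def)
  have cutBox: "cut c \<in> Box R" if "n c \<le> R" for c R
    using le_n[of _ c] that by (force simp: Box_def cut_def)
  have compact_Box: "compact (Box R)" for R unfolding Box_def by (rule compact_coordinate_box)
  define S where "S = Box 1 \<inter> n -` {1}"
  have "closed (n -` {1})"
    using coord_continuous_imp_continuous_on[OF nc] by (intro closed_vimage) auto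
  then have compact_S: "compact S" unfolding S_def using compact_Box by (rule compact_Int_closed[rotated])
  obtain \<delta> where \<delta>: "\<delta> > 0" "\<And>c. c \<in> S \<Longrightarrow> \<delta> \<le> G0 c"
  \<comment> \<open>The sphere is empty when \<open>N = 0\<close>; any positive
    \<open>\<delta>\<close> then works.\<close>
  proof (cases "S = {}")
    case True then show thesis using that[of 1] by auto
  next
    case False
    obtain s where s: "s \<in> S" "\<And>c. c \<in> S \<Longrightarrow> G0 s \<le> G0 c"
      using continuous_attains_inf[OF compact_S False coord_continuous_imp_continuous_on[OF G0]] by blast
    have "G0 s \<noteq> 0"
    proof
      assume "G0 s = 0"
      then have "n s = 0" using definite[of s] by (simp add: n_def)
      then show False using s by (simp add: S_def)
    qed
    then show thesis using that[of "G0 s"] s nonneg[of s] by (auto simp: less_le)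
  qed
  have G0_ge: "\<delta> * n c powr p \<le> G0 c" for c
  proof (cases "n c = 0")
    case True then show ?thesis using nonneg by simp
  next
    case False
    have "n c \<ge> 0" unfolding n_def by (intro sum_nonneg) auto
    then have pos: "n c > 0" using False by simp
    define d where "d = cut (\<lambda>i. c i / n c)"
    have "n d = (\<Sum>i<N. \<bar>c i\<bar> / n c)"
      unfolding d_def cut[OF nc] using pos by (simp add: n_def)
    also have "\<dots> = 1" using pos by (simp add: n_def flip: sum_divide_distrib)
    finally have nd: "n d = 1" .
    then have "n (\<lambda>i. c i / n c) = 1" unfolding d_def cut[OF nc] .
    then have "d \<in> S" using nd cutBox[of "\<lambda>i. c i / n c" 1] by (simp add: S_def d_def)
    then have "\<delta> \<le> G0 d" by (rule \<delta>)
    also have "G0 d = G0 (\<lambda>i. c i / n c)" unfolding d_def by (rule cut[OF G0])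
    finally have "n c powr p * \<delta> \<le> n c powr p * G0 (\<lambda>i. c i / n c)" by (intro mult_left_mono) auto
    also have "\<dots> = G0 (\<lambda>i. n c * (c i / n c))" using pos by (simp only: hom[OF less_imp_le])
    also have "\<dots> = G0 c" using pos by simp
    finally show ?thesis by (simp add: mult.commute)
  qed
  define A where "A = (\<Sum>i<N. \<bar>l i\<bar>)"
  have A: "A \<ge> 0" unfolding A_def by (intro sum_nonneg) auto
  have lin: "(\<Sum>i<N. c i * l i) \<le> A * n c" for c
  proof -
    have "(\<Sum>i<N. c i * l i) \<le> (\<Sum>i<N. n c * \<bar>l i\<bar>)"
    proof (rule sum_mono)
      fix i assume "i \<in> {..<N}"
      then have "\<bar>c i\<bar> * \<bar>l i\<bar> \<le> n c * \<bar>l i\<bar>" using le_n by (intro mult_right_mono) auto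
      then show "c i * l i \<le> n c * \<bar>l i\<bar>" by (metis abs_le_D1 abs_mult)
    qed
    then show ?thesis by (simp add: A_def sum_distrib_left mult.commute)
  qed
  obtain R0 where R0: "R0 > 0" "\<And>R. R \<ge> R0 \<Longrightarrow> F (\<lambda>_. 0) + C \<le> (a * \<delta>) * R powr p - A * R"
    using powr_coercive[OF p mult_pos_pos[OF a \<delta>(1)] A] by blast
  have zero: "(\<lambda>_. 0) \<in> Box R0" using R0 by (auto simp: Box_def)
  obtain u where u: "u \<in> Box R0" "\<And>c. c \<in> Box R0 \<Longrightarrow> F u \<le> F c"
    using continuous_attains_inf[OF compact_Box[of R0] _ coord_continuous_imp_continuous_on[OF Fc]] zero
    by blast
  have "F u \<le> F c" for c
  proof (cases "n c \<le> R0")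
    case True
    then show ?thesis using u(2)[OF cutBox] cut[OF Fc] by metis
  next
    case False
    have "a * (\<delta> * n c powr p) \<le> a * G0 c" using G0_ge a by (intro mult_left_mono) auto
    then have "(a * \<delta>) * n c powr p - A * n c - C \<le> F c"
      using lower[of c] lin[of c] by (simp add: F_def mult.assoc)
    then have "F (\<lambda>_. 0) \<le> F c" using R0(2)[of "n c"] False by auto
    then show ?thesis using u(2)[OF zero] by linarith
  qed
  then show ?thesis unfolding F_def by blast
qed

section \<open>Powers of affine combinations\<close>

lemma set_integrable_const:
  fixes C :: "'b::{banach, second_countable_topology}"
  assumes "S \<in> sets M" "emeasure M S < \<infinity>"
  shows "set_integrable M S (\<lambda>_. C)"
  using assms unfolding set_integrable_def by auto

text \<open>Each summand is at most the maximum, which yields the constant \<open>2 powr p\<close>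
  and, after inversion, the factor \<open>2 powr (-p)\<close> of the coercivity bound.\<close>

lemma powr_add_le:
  fixes x y p :: real
  assumes "0 \<le> x" "0 \<le> y" "0 \<le> p"
  shows "(x + y) powr p \<le> 2 powr p * (x powr p + y powr p)"
proof -
  have "(x + y) powr p \<le> (2 * max x y) powr p" using assms by (intro powr_mono2) auto
  also have "\<dots> = 2 powr p * (max x y) powr p" using assms by (intro powr_mult)
  also have "\<dots> \<le> 2 powr p * (x powr p + y powr p)"
    by (intro mult_left_mono) (auto simp: max_def)
  finally show ?thesis .
qed

lemma set_borel_measurable_norm_powr:
  fixes u :: "'x \<Rightarrow> 'b::euclidean_space"
  assumes "set_borel_measurable M S u"
  shows "set_borel_measurable M S (\<lambda>x. norm (u x) powr p)"
proof -
  \<comment> \<open>The indicator passes through norm and power because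
    \<open>0 powr p = 0\<close>.\<close>
  have eq: "(\<lambda>x. indicator S x *\<^sub>R (norm (u x) powr p)) = (\<lambda>x. norm (indicator S x *\<^sub>R u x) powr p)"
    by (auto simp: indicator_def)
  show ?thesis using assms unfolding set_borel_measurable_def eq by measurable
qed

text \<open>A common frame for three integrals: discrete gradients on an element with shift
  \<open>R K\<close>, jumps on an interior face with shift 0, traces on a Dirichlet face with shift
  \<open>- gD\<close>. The basis functions are bounded, while the shift only has an integrable
  \<open>p\<close>-th power.\<close>

locale affine_energy =
  fixes M :: "'x measure" and S :: "'x set" and N :: nat and p :: real
    and \<phi> :: "nat \<Rightarrow> 'x \<Rightarrow> 'b::euclidean_space" and g :: "'x \<Rightarrow> 'b"
  assumes p: "1 < p" and S: "S \<in> sets M" "emeasure M S < \<infinity>"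
    and \<phi>: "\<And>i. i < N \<Longrightarrow> set_borel_measurable M S (\<phi> i)"
    and bounded: "\<And>i. i < N \<Longrightarrow> \<exists>B. \<forall>x\<in>S. norm (\<phi> i x) \<le> B"
    and g: "set_borel_measurable M S g" and g_integrable: "set_integrable M S (\<lambda>x. norm (g x) powr p)"
begin

definition energy :: "(nat \<Rightarrow> real) \<Rightarrow> real" where
  "energy c = (LINT x:S|M. norm ((\<Sum>i<N. c i *\<^sub>R \<phi> i x) + g x) powr p)"

definition energy0 :: "(nat \<Rightarrow> real) \<Rightarrow> real" where
  "energy0 c = (LINT x:S|M. norm (\<Sum>i<N. c i *\<^sub>R \<phi> i x) powr p)"

lemma measurable_combination: "set_borel_measurable M S (\<lambda>x. (\<Sum>i<N. c i *\<^sub>R \<phi> i x) + g x)"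
proof -
  have "(\<lambda>x. \<Sum>i<N. c i *\<^sub>R (indicator S x *\<^sub>R \<phi> i x)) \<in> borel_measurable M"
    using \<phi> unfolding set_borel_measurable_def
    by (intro borel_measurable_sum borel_measurable_scaleR[OF borel_measurable_const]) auto
  moreover have "(\<lambda>x. indicator S x *\<^sub>R ((\<Sum>i<N. c i *\<^sub>R \<phi> i x) + g x)) =
      (\<lambda>x. (\<Sum>i<N. c i *\<^sub>R (indicator S x *\<^sub>R \<phi> i x)) + indicator S x *\<^sub>R g x)"
    by (auto simp: scaleR_sum_right scaleR_add_right mult.commute)
  ultimately show ?thesis using g unfolding set_borel_measurable_def by simp
qed

lemma uniform_bound: "\<exists>B\<ge>0. \<forall>c. \<forall>x\<in>S. norm (\<Sum>i<N. c i *\<^sub>R \<phi> i x) \<le> B * (\<Sum>i<N. \<bar>c i\<bar>)"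
proof -
  obtain b where b: "\<And>i x. i < N \<Longrightarrow> x \<in> S \<Longrightarrow> norm (\<phi> i x) \<le> b i" using bounded by metis
  define B where "B = (\<Sum>i<N. \<bar>b i\<bar>)"
  have "norm (\<Sum>i<N. c i *\<^sub>R \<phi> i x) \<le> B * (\<Sum>i<N. \<bar>c i\<bar>)" if x: "x \<in> S" for c x
  proof -
    have "norm (\<Sum>i<N. c i *\<^sub>R \<phi> i x) \<le> (\<Sum>i<N. \<bar>c i\<bar> * B)"
    proof (rule sum_norm_le)
      fix i assume i: "i \<in> {..<N}"
      have "norm (\<phi> i x) \<le> b i" using b x i by auto
      also have "b i \<le> B" using i member_le_sum[of i "{..<N}" "\<lambda>i. \<bar>b i\<bar>"] by (auto simp: B_def)
      finally show "norm (c i *\<^sub>R \<phi> i x) \<le> \<bar>c i\<bar> * B" by (simp add: mult_left_mono)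
    qed
    also have "\<dots> = B * (\<Sum>i<N. \<bar>c i\<bar>)" by (simp only: sum_distrib_left mult.commute)
    finally show ?thesis .
  qed
  moreover have "B \<ge> 0" unfolding B_def by (intro sum_nonneg) auto
  ultimately show ?thesis by blast
qed

lemma pointwise_bound:
  assumes "norm u \<le> R"
  shows "norm (u + v) powr p \<le> 2 powr p * (R powr p + norm v powr p)"
proof -
  have "norm (u + v) powr p \<le> (R + norm v) powr p"
    using assms p norm_triangle_ineq[of u v] by (intro powr_mono2) auto
  also have "\<dots> \<le> 2 powr p * (R powr p + norm v powr p)"
    using p order_trans[OF norm_ge_zero assms] by (intro powr_add_le) auto
  finally show ?thesis .
qed

lemma integrable_dominating: "set_integrable M S (\<lambda>x. 2 powr p * (R powr p + norm (g x) powr p))"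
  by (intro set_integrable_mult_right set_integral_add g_integrable set_integrable_const S)

lemma integrable_energy: "set_integrable M S (\<lambda>x. norm ((\<Sum>i<N. c i *\<^sub>R \<phi> i x) + g x) powr p)"
proof -
  obtain B where B: "\<And>x. x \<in> S \<Longrightarrow> norm (\<Sum>i<N. c i *\<^sub>R \<phi> i x) \<le> B * (\<Sum>i<N. \<bar>c i\<bar>)"
    using uniform_bound by blast
  show ?thesis
    using pointwise_bound[OF B]
    by (intro set_integrable_bound[OF integrable_dominating[of "B * (\<Sum>i<N. \<bar>c i\<bar>)"]]
        set_borel_measurable_norm_powr measurable_combination) (auto intro!: AE_I2 intro: order_trans)
qed

text \<open>Dominated convergence: convergent coefficients are bounded, so all combinations are
  bounded on \<open>S\<close> by the constant \<open>B * K\<close> and one integrable majorant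
  serves every \<open>n\<close>.\<close>

lemma coord_continuous_energy: "coord_continuous N energy"
  unfolding coord_continuous_def
proof (intro allI impI)
  fix X :: "nat \<Rightarrow> nat \<Rightarrow> real" and c assume X: "\<forall>i<N. (\<lambda>n. X n i) \<longlonglongrightarrow> c i"
  obtain B where B: "B \<ge> 0" "\<And>c x. x \<in> S \<Longrightarrow> norm (\<Sum>i<N. c i *\<^sub>R \<phi> i x) \<le> B * (\<Sum>i<N. \<bar>c i\<bar>)"
    using uniform_bound by blast
  have "(\<lambda>n. \<Sum>i<N. \<bar>X n i\<bar>) \<longlonglongrightarrow> (\<Sum>i<N. \<bar>c i\<bar>)"
    using X by (intro tendsto_sum tendsto_rabs) auto
  then have "Bseq (\<lambda>n. \<Sum>i<N. \<bar>X n i\<bar>)" using convergent_imp_Bseq convergentI by blast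
  then obtain K where "\<And>n. norm (\<Sum>i<N. \<bar>X n i\<bar>) \<le> K" by (elim BseqE) blast
  then have K: "(\<Sum>i<N. \<bar>X n i\<bar>) \<le> K" for n by (metis norm_ge_zero real_norm_def abs_le_D1)
  have bd: "norm (\<Sum>i<N. X n i *\<^sub>R \<phi> i x) \<le> B * K" if "x \<in> S" for n x
    using B(2)[OF that, of "X n"] mult_left_mono[OF K B(1), of n] by linarith
  let ?f = "\<lambda>c x. indicator S x *\<^sub>R (norm ((\<Sum>i<N. c i *\<^sub>R \<phi> i x) + g x) powr p)"
  show "(\<lambda>n. energy (X n)) \<longlonglongrightarrow> energy c"
    unfolding energy_def set_lebesgue_integral_def
  proof (rule integral_dominated_convergence)
    show "?f c \<in> borel_measurable M" "?f (X n) \<in> borel_measurable M" for n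
      using integrable_energy unfolding set_integrable_def by auto
    show "integrable M (\<lambda>x. indicator S x *\<^sub>R (2 powr p * ((B * K) powr p + norm (g x) powr p)))"
      using integrable_dominating unfolding set_integrable_def .
    have "(\<lambda>n. norm ((\<Sum>i<N. X n i *\<^sub>R \<phi> i x) + g x) powr p)
        \<longlonglongrightarrow> norm ((\<Sum>i<N. c i *\<^sub>R \<phi> i x) + g x) powr p" for x
      using X p by (intro tendsto_powr2 tendsto_intros) auto
    then show "AE x in M. (\<lambda>n. ?f (X n) x) \<longlonglongrightarrow> ?f c x" by (intro AE_I2 tendsto_scaleR tendsto_const)
    show "AE x in M. norm (?f (X n) x) \<le> indicator S x *\<^sub>R (2 powr p * ((B * K) powr p + norm (g x) powr p))" for n
      using pointwise_bound[OF bd] by (auto intro!: AE_I2 simp: indicator_def)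
  qed
qed

text \<open>The homogeneous energy is the instance with zero shift and inherits continuity and
  integrability from it.\<close>

lemma affine_energy0: "affine_energy M S N p \<phi> (\<lambda>_. 0)"
  using p S \<phi> bounded by unfold_locales (auto simp: set_borel_measurable_def set_integrable_def)

lemma energy0_eq: "affine_energy.energy M S N p \<phi> (\<lambda>_. 0) = energy0"
  by (simp add: affine_energy.energy_def[OF affine_energy0] energy0_def fun_eq_iff)

lemma coord_continuous_energy0: "coord_continuous N energy0"
  using affine_energy.coord_continuous_energy[OF affine_energy0] by (simp add: energy0_eq)

lemma integrable_energy0: "set_integrable M S (\<lambda>x. norm (\<Sum>i<N. c i *\<^sub>R \<phi> i x) powr p)"
  using affine_energy.integrable_energy[OF affine_energy0] by simp

lemma energy_nonneg: "0 \<le> energy c" "0 \<le> energy0 c"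
  unfolding energy_def energy0_def set_lebesgue_integral_def by (auto intro!: integral_nonneg_AE)

lemma energy0_homogeneous:
  assumes "0 \<le> t"
  shows "energy0 (\<lambda>i. t * c i) = t powr p * energy0 c"
proof -
  have "norm (\<Sum>i<N. (t * c i) *\<^sub>R \<phi> i x) powr p = t powr p * norm (\<Sum>i<N. c i *\<^sub>R \<phi> i x) powr p" for x
  proof -
    have "(\<Sum>i<N. (t * c i) *\<^sub>R \<phi> i x) = t *\<^sub>R (\<Sum>i<N. c i *\<^sub>R \<phi> i x)"
      by (simp add: scaleR_sum_right)
    then show ?thesis using assms by (simp add: powr_mult)
  qed
  then show ?thesis by (simp add: energy0_def)
qed

text \<open>Write the linear part as the affine combination plus \<open>- g\<close>, apply the
  pointwise bound and integrate.\<close>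

lemma energy_lower: "2 powr (-p) * energy0 c - (LINT x:S|M. norm (g x) powr p) \<le> energy c"
proof -
  have "energy0 c \<le> (LINT x:S|M. 2 powr p * (norm ((\<Sum>i<N. c i *\<^sub>R \<phi> i x) + g x) powr p + norm (g x) powr p))"
    unfolding energy0_def
  proof (rule set_integral_mono)
    show "set_integrable M S (\<lambda>x. norm (\<Sum>i<N. c i *\<^sub>R \<phi> i x) powr p)" by (rule integrable_energy0)
    show "set_integrable M S (\<lambda>x. 2 powr p * (norm ((\<Sum>i<N. c i *\<^sub>R \<phi> i x) + g x) powr p + norm (g x) powr p))"
      by (intro set_integrable_mult_right set_integral_add integrable_energy g_integrable)
    show "norm (\<Sum>i<N. c i *\<^sub>R \<phi> i x) powr p
        \<le> 2 powr p * (norm ((\<Sum>i<N. c i *\<^sub>R \<phi> i x) + g x) powr p + norm (g x) powr p)" for x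
      using pointwise_bound[OF order_refl, of "(\<Sum>i<N. c i *\<^sub>R \<phi> i x) + g x" "- g x"] by simp
  qed
  also have "\<dots> = 2 powr p * (energy c + (LINT x:S|M. norm (g x) powr p))"
    by (simp add: energy_def integrable_energy g_integrable)
  finally have "2 powr (-p) * energy0 c \<le> 2 powr (-p) * (2 powr p * (energy c + (LINT x:S|M. norm (g x) powr p)))"
    by (intro mult_left_mono) auto
  also have "\<dots> = energy c + (LINT x:S|M. norm (g x) powr p)"
    by (simp add: mult.assoc[symmetric] powr_add[symmetric])
  finally show ?thesis by simp
qed

lemma energy0_zero_AE:
  assumes "energy0 c = 0"
  shows "AE x in M. x \<in> S \<longrightarrow> (\<Sum>i<N. c i *\<^sub>R \<phi> i x) = 0"
proof -
  have "AE x in M. indicator S x *\<^sub>R (norm (\<Sum>i<N. c i *\<^sub>R \<phi> i x) powr p) = 0"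
    using assms integrable_energy0[of c] unfolding energy0_def set_lebesgue_integral_def set_integrable_def
    by (subst (asm) integral_nonneg_eq_0_iff_AE) auto
  then show ?thesis by eventually_elim (auto simp: indicator_def split: if_splits)
qed

end

text \<open>All terms share the factor \<open>2 powr (-p)\<close>, so that under sums and
  nonnegative weights only the additive constants change.\<close>

definition coercive_term :: "real \<Rightarrow> nat \<Rightarrow> ((nat \<Rightarrow> real) \<Rightarrow> real) \<Rightarrow> ((nat \<Rightarrow> real) \<Rightarrow> real) \<Rightarrow> bool" where
  "coercive_term p N G G0 \<longleftrightarrow> coord_continuous N G \<and> coord_continuous N G0 \<and>
     (\<forall>t\<ge>0. \<forall>c. G0 (\<lambda>i. t * c i) = t powr p * G0 c) \<and> (\<forall>c. 0 \<le> G0 c) \<and>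
     (\<exists>C. \<forall>c. 2 powr (-p) * G0 c - C \<le> G c)"

lemma coercive_term_attains_min:
  assumes "1 < p" "coercive_term p N G G0" "\<And>c i. G0 c = 0 \<Longrightarrow> i < N \<Longrightarrow> c i = 0"
  shows "\<exists>c. \<forall>c'. G c - (\<Sum>i<N. c i * l i) \<le> G c' - (\<Sum>i<N. c' i * l i)"
proof -
  obtain C where C: "\<And>c. 2 powr (-p) * G0 c - C \<le> G c"
    using assms(2) by (auto simp: coercive_term_def)
  show ?thesis
    by (rule coercive_attains_min[of p "2 powr (-p)" N G G0 C])
      (use assms C in \<open>auto simp: coercive_term_def\<close>)
qed

lemma coercive_term_mult:
  assumes "coercive_term p N G G0" "0 \<le> w"
  shows "coercive_term p N (\<lambda>c. w * G c) (\<lambda>c. w * G0 c)"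
proof -
  obtain C where C: "\<And>c. 2 powr (-p) * G0 c - C \<le> G c"
    using assms(1) by (auto simp: coercive_term_def)
  have "2 powr (-p) * (w * G0 c) - w * C \<le> w * G c" for c
    using mult_left_mono[OF C assms(2), of c] by (simp add: algebra_simps)
  then have "\<exists>C. \<forall>c. 2 powr (-p) * (w * G0 c) - C \<le> w * G c" by blast
  then show ?thesis
    using assms by (auto simp: coercive_term_def intro!: coord_continuous_mult_left)
qed

lemma coercive_term_add:
  assumes "coercive_term p N F F0" "coercive_term p N G G0"
  shows "coercive_term p N (\<lambda>c. F c + G c) (\<lambda>c. F0 c + G0 c)"
proof -
  obtain C D where "\<And>c. 2 powr (-p) * F0 c - C \<le> F c" "\<And>c. 2 powr (-p) * G0 c - D \<le> G c"
    using assms by (auto simp: coercive_term_def)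
  then have "2 powr (-p) * (F0 c + G0 c) - (C + D) \<le> F c + G c" for c
    using add_mono by (fastforce simp: algebra_simps)
  then have "\<exists>C. \<forall>c. 2 powr (-p) * (F0 c + G0 c) - C \<le> F c + G c" by blast
  then show ?thesis
    using assms by (auto simp: coercive_term_def distrib_left intro!: coord_continuous_add)
qed

lemma coercive_term_zero: "coercive_term p N (\<lambda>_. 0) (\<lambda>_. 0)"
  by (auto simp: coercive_term_def coord_continuous_def intro!: exI[of _ 0])

lemma coercive_term_sum:
  assumes "finite I" "\<And>j. j \<in> I \<Longrightarrow> coercive_term p N (G j) (G0 j)"
  shows "coercive_term p N (\<lambda>c. \<Sum>j\<in>I. G j c) (\<lambda>c. \<Sum>j\<in>I. G0 j c)"
  using assms by (induction I rule: finite_induct) (auto intro: coercive_term_zero coercive_term_add)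

lemma (in affine_energy) coercive_term_energy: "coercive_term p N energy energy0"
  unfolding coercive_term_def
  using coord_continuous_energy coord_continuous_energy0 energy0_homogeneous energy_nonneg(2) energy_lower
  by blast

section \<open>Integration over elements and faces\<close>

text \<open>Completeness enters on \<open>N\<close>: the preimage under \<open>g\<close> meets
  \<open>N\<close> in an arbitrary subset, which is still measurable.\<close>

lemma (in complete_measure) borel_measurable_null_modification:
  assumes f: "f \<in> borel_measurable M" and N: "N \<in> null_sets M" and eq: "\<And>x. x \<notin> N \<Longrightarrow> f x = g x"
  shows "g \<in> borel_measurable M"
proof (rule measurableI)
  fix A :: "'b set" assume A: "A \<in> sets borel"
  have "g -` A \<inter> space M = (f -` A \<inter> space M - N) \<union> (g -` A \<inter> N)"
    using eq sets.sets_into_space[OF null_setsD2[OF N]] by auto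
  moreover have "f -` A \<inter> space M \<in> sets M" using f A by (rule measurable_sets)
  moreover have "g -` A \<inter> N \<in> sets M"
    using complete2[OF _ N, of "g -` A \<inter> N"] by auto
  ultimately show "g -` A \<inter> space M \<in> sets M" using N by (auto intro: sets.Diff)
qed auto

text \<open>Treats Lebesgue measure on an element and surface measure on a face alike: in both cases
  a complete measure on a compact set of finite measure.\<close>

locale trace_measure = complete_measure M for M :: "(real^'n) measure" +
  fixes S :: "(real^'n) set"
  assumes sets_borel: "sets borel \<subseteq> sets M" and space_UNIV: "space M = UNIV"
    and compact: "compact S" and emeasure_finite: "emeasure M S < \<infinity>"
begin

lemma S_sets: "S \<in> sets M"
  using compact sets_borel compact_imp_closed borel_closed by blast

lemma measurable_continuous:
  fixes \<phi> :: "real^'n \<Rightarrow> 'b::euclidean_space"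
  assumes "continuous_on UNIV \<phi>"
  shows "set_borel_measurable M S \<phi>"
proof -
  have "\<phi> \<in> borel_measurable M"
    using borel_measurable_continuous_onI[OF assms] sets_borel space_UNIV
    by (intro borel_measurable_subalgebra[of borel M]) auto
  then show ?thesis using S_sets unfolding set_borel_measurable_def by simp
qed

lemma bounded_continuous:
  assumes "continuous_on UNIV \<phi>"
  shows "\<exists>B. \<forall>x\<in>S. norm (\<phi> x) \<le> B"
proof -
  have "compact (\<phi> ` S)"
    using assms compact by (intro compact_continuous_image) (auto intro: continuous_on_subset)
  then show ?thesis using compact_imp_bounded by (fastforce simp: bounded_iff)
qed

lemma integrable_continuous:
  fixes \<phi> :: "real^'n \<Rightarrow> 'b::euclidean_space"
  assumes "continuous_on UNIV \<phi>"
  shows "set_integrable M S \<phi>"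
proof -
  obtain B where B: "\<And>x. x \<in> S \<Longrightarrow> norm (\<phi> x) \<le> B" using bounded_continuous[OF assms] by blast
  show ?thesis
    by (rule set_integrable_bound[OF set_integrable_const[OF S_sets emeasure_finite, of B]
        measurable_continuous[OF assms]]) (use B in \<open>fastforce intro!: AE_I2\<close>)
qed

text \<open>Data live on \<open>\<Omega>\<close> or a boundary part, integrals run over closed
  elements or faces. Multiplying by both indicators changes the integrand only on the null set
  \<open>S - S'\<close>.\<close>

lemma in_Lp_trace:
  assumes Lp: "in_Lp M q S' g" and null: "S - S' \<in> null_sets M"
  shows "set_borel_measurable M S g" "set_integrable M S (\<lambda>x. \<bar>g x\<bar> powr q)"
proof -
  have mod: "(\<lambda>x. indicator S x *\<^sub>R u x) \<in> borel_measurable M"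
    if u: "set_borel_measurable M S' u" for u :: "real^'n \<Rightarrow> real"
  proof (rule borel_measurable_null_modification[OF _ null])
    show "(\<lambda>x. indicator S x *\<^sub>R (indicator S' x *\<^sub>R u x)) \<in> borel_measurable M"
      using u S_sets unfolding set_borel_measurable_def by simp
    show "indicator S x *\<^sub>R (indicator S' x *\<^sub>R u x) = indicator S x *\<^sub>R u x" if "x \<notin> S - S'" for x
      using that by (auto simp: indicator_def)
  qed
  have g: "set_borel_measurable M S' g" and gi: "set_integrable M S' (\<lambda>x. \<bar>g x\<bar> powr q)"
    using Lp by (auto simp: in_Lp_def)
  show "set_borel_measurable M S g" using mod[OF g] by (simp add: set_borel_measurable_def)
  have m: "set_borel_measurable M S' (\<lambda>x. \<bar>g x\<bar> powr q)"
    using gi by (auto simp: set_integrable_def set_borel_measurable_def)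
  have "integrable M (\<lambda>x. indicator S x *\<^sub>R (indicator S' x *\<^sub>R (\<bar>g x\<bar> powr q)))"
    using gi unfolding set_integrable_def by (rule integrable_mult_indicator[OF S_sets])
  moreover have "AE x in M. indicator S x *\<^sub>R (indicator S' x *\<^sub>R (\<bar>g x\<bar> powr q)) = indicator S x *\<^sub>R (\<bar>g x\<bar> powr q)"
    using AE_not_in[OF null] by eventually_elim (auto simp: indicator_def)
  ultimately have "integrable M (\<lambda>x. indicator S x *\<^sub>R (\<bar>g x\<bar> powr q))"
    using integrable_cong_AE_imp mod[OF m] by blast
  then show "set_integrable M S (\<lambda>x. \<bar>g x\<bar> powr q)" unfolding set_integrable_def .
qed

text \<open>On a set of finite measure
  \<open>\<bar>g x\<bar> \<le> 1 + \<bar>g x\<bar> powr q\<close> is integrable, and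
  \<open>\<phi>\<close> is bounded on the compact set.\<close>

lemma integrable_Lp_mult_continuous:
  fixes \<phi> g :: "real^'n \<Rightarrow> real"
  assumes q: "1 \<le> q" and g: "set_borel_measurable M S g" "set_integrable M S (\<lambda>x. \<bar>g x\<bar> powr q)"
    and \<phi>: "continuous_on UNIV \<phi>"
  shows "set_integrable M S (\<lambda>x. g x * \<phi> x)"
proof -
  obtain B where B: "\<And>x. x \<in> S \<Longrightarrow> norm (\<phi> x) \<le> B" using bounded_continuous[OF \<phi>] by blast
  have m: "set_borel_measurable M S (\<lambda>x. g x * \<phi> x)"
  proof -
    have "(\<lambda>x. indicator S x *\<^sub>R (g x * \<phi> x)) = (\<lambda>x. (indicator S x *\<^sub>R g x) * (indicator S x *\<^sub>R \<phi> x))"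
      by (auto simp: indicator_def)
    then show ?thesis using g(1) measurable_continuous[OF \<phi>] unfolding set_borel_measurable_def by simp
  qed
  have bd: "set_integrable M S (\<lambda>x. (1 + \<bar>g x\<bar> powr q) * B)"
    by (intro set_integrable_mult_left set_integral_add set_integrable_const S_sets emeasure_finite g)
  show ?thesis
  proof (rule set_integrable_bound[OF bd m], intro AE_I2 impI)
    fix x assume x: "x \<in> S"
    have le: "\<bar>g x\<bar> \<le> 1 + \<bar>g x\<bar> powr q"
    proof (cases "\<bar>g x\<bar> \<le> 1")
      case False
      then have "\<bar>g x\<bar> powr 1 \<le> \<bar>g x\<bar> powr q" using q by (intro powr_mono) auto
      then show ?thesis using False by simp
    qed (use powr_ge_zero[of "\<bar>g x\<bar>" q] in linarith)
    have "\<bar>g x\<bar> * \<bar>\<phi> x\<bar> \<le> (1 + \<bar>g x\<bar> powr q) * B"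
      using B[OF x] le by (intro mult_mono) (auto intro: add_nonneg_nonneg)
    then show "norm (g x * \<phi> x) \<le> norm ((1 + \<bar>g x\<bar> powr q) * B)"
      using abs_ge_self[of "(1 + \<bar>g x\<bar> powr q) * B"] by (simp only: real_norm_def abs_mult[of "g x"])
  qed
qed

end

text \<open>The points of the interior where \<open>\<phi>\<close> does not vanish form an open null
  set, which must be empty.\<close>

lemma AE_zero_continuous_interior:
  fixes \<phi> :: "real^'n \<Rightarrow> 'b::real_normed_vector"
  assumes \<phi>: "continuous_on UNIV \<phi>" and AE: "AE x in lebesgue. x \<in> S \<longrightarrow> \<phi> x = 0"
    and x: "x \<in> interior S"
  shows "\<phi> x = 0"
proof (rule ccontr)
  assume "\<phi> x \<noteq> 0"
  define U where "U = interior S \<inter> {x. \<phi> x \<noteq> 0}"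
  have "open {x. \<phi> x \<noteq> 0}" using \<phi> by (intro open_Collect_neq) auto
  then have U: "open U" "U \<noteq> {}" using x \<open>\<phi> x \<noteq> 0\<close> by (auto simp: U_def)
  have "AE x in lebesgue. x \<notin> U"
    using AE by eventually_elim (use interior_subset in \<open>auto simp: U_def\<close>)
  then have "U \<in> null_sets lebesgue"
    using U by (subst completion.null_sets_iff_AE) auto
  then have "negligible U" by (simp add: negligible_iff_null_sets)
  then show False using U open_not_negligible by blast
qed

lemma (in trace_measure) integral_inner_self_zero:
  fixes \<phi> :: "real^'n \<Rightarrow> 'b::euclidean_space"
  assumes \<phi>: "continuous_on UNIV \<phi>" and z: "(LINT x:S|M. \<phi> x \<bullet> \<phi> x) = 0"
  shows "AE x in M. x \<in> S \<longrightarrow> \<phi> x = 0"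
proof -
  have "set_integrable M S (\<lambda>x. \<phi> x \<bullet> \<phi> x)"
    using \<phi> by (intro integrable_continuous continuous_intros)
  then have "AE x in M. indicator S x *\<^sub>R (\<phi> x \<bullet> \<phi> x) = 0"
    using z unfolding set_lebesgue_integral_def set_integrable_def
    by (subst (asm) integral_nonneg_eq_0_iff_AE) auto
  then show ?thesis by eventually_elim (auto simp: indicator_def split: if_splits)
qed

lemma set_integral_eq_zero_AE:
  fixes u :: "'a \<Rightarrow> real"
  assumes "AE x in M. x \<in> S \<longrightarrow> u x = 0"
  shows "(LINT x:S|M. u x) = 0"
  unfolding set_lebesgue_integral_def
  by (rule integral_eq_zero_AE) (use assms in \<open>eventually_elim, auto simp: indicator_def\<close>)

section \<open>Linear functionals on broken spaces\<close>

lemma linear_functional_on_add: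
  "linear_functional_on V F \<Longrightarrow> linear_functional_on V G \<Longrightarrow> linear_functional_on V (\<lambda>v. F v + G v)"
  by (auto simp: linear_functional_on_def algebra_simps)

lemma linear_functional_on_diff:
  "linear_functional_on V F \<Longrightarrow> linear_functional_on V G \<Longrightarrow> linear_functional_on V (\<lambda>v. F v - G v)"
  by (auto simp: linear_functional_on_def algebra_simps)

lemma linear_functional_on_sum_functionals:
  "(\<And>j. j \<in> I \<Longrightarrow> linear_functional_on V (F j)) \<Longrightarrow> linear_functional_on V (\<lambda>v. \<Sum>j\<in>I. F j v)"
  by (auto simp: linear_functional_on_def sum.distrib sum_distrib_left)

lemma linear_functional_on_integral:
  assumes "\<And>v. v \<in> V \<Longrightarrow> set_integrable M S (A v)"
    and "\<And>u v x. u \<in> V \<Longrightarrow> v \<in> V \<Longrightarrow> A (u + v) x = A u x + A v x"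
    and "\<And>r u x. u \<in> V \<Longrightarrow> A (r *\<^sub>R u) x = r * A u x"
  shows "linear_functional_on V (\<lambda>v. LINT x:S|M. A v x)"
  unfolding linear_functional_on_def
proof (intro conjI ballI allI)
  fix u v assume "u \<in> V" "v \<in> V"
  then show "(LINT x:S|M. A (u + v) x) = (LINT x:S|M. A u x) + (LINT x:S|M. A v x)"
    by (simp only: assms(2) set_integral_add(2)[OF assms(1) assms(1)])
next
  fix r u assume "u \<in> V"
  then show "(LINT x:S|M. A (r *\<^sub>R u) x) = r * (LINT x:S|M. A u x)"
    by (simp only: assms(3) set_integral_mult_right)
qed

lemma jump_add: "jump T (u + v) e x = jump T u e x + jump T v e x"
  by (simp add: jump_def scaleR_left_distrib sum.distrib)

lemma jump_scaleR: "jump T (r *\<^sub>R u) e x = r *\<^sub>R jump T u e x"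
  by (simp add: jump_def scaleR_sum_right)

lemma jump_sum: "jump T (\<Sum>i\<in>I. c i *\<^sub>R b i) e x = (\<Sum>i\<in>I. c i *\<^sub>R jump T (b i) e x)"
proof (induction I rule: infinite_finite_induct)
  case (insert i I)
  then show ?case by (simp only: sum.insert[OF insert(1,2)] jump_add jump_scaleR)
qed (simp_all add: jump_def)

lemma continuous_jump:
  "(\<And>K. continuous_on UNIV (v K)) \<Longrightarrow> continuous_on UNIV (jump T v e)"
  unfolding jump_def by (intro continuous_intros) auto

text \<open>The test quantity paired with the jump in \<open>D_DG\<close>, bundled so that linearity
  and continuity are shown once.\<close>

definition face_test ::
    "(real^'n) set set \<Rightarrow> ((real^'n) set \<Rightarrow> real^'n) \<Rightarrow> ((real^'n) set \<Rightarrow> real^'n \<Rightarrow> real^'n) \<Rightarrow>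
     (real^'n) set \<Rightarrow> real^'n \<Rightarrow> real^'n" where
  "face_test T C12 \<zeta> e x = vec_average T \<zeta> e x - vec_jump T \<zeta> e x *\<^sub>R C12 e"

lemma face_test_add: "face_test T C (u + v) e x = face_test T C u e x + face_test T C v e x"
  by (simp add: face_test_def vec_average_def vec_jump_def sum.distrib inner_add_left algebra_simps)

lemma face_test_scaleR: "face_test T C (r *\<^sub>R u) e x = r *\<^sub>R face_test T C u e x"
  by (simp add: face_test_def vec_average_def vec_jump_def algebra_simps
      flip: scaleR_sum_right sum_distrib_left)

lemma continuous_face_test:
  "(\<And>K. continuous_on UNIV (\<zeta> K)) \<Longrightarrow> continuous_on UNIV (face_test T C \<zeta> e)"
  unfolding face_test_def vec_average_def vec_jump_def by (intro continuous_intros) auto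

lemma continuous_broken_poly:
  "v \<in> broken T (poly_space k) \<Longrightarrow> continuous_on UNIV (v K)"
  by (cases "K \<in> T") (auto simp: broken_def zero_fun_def intro: continuous_on_poly_space)

lemma continuous_broken_vec_poly:
  "v \<in> broken T (vec_poly_space k) \<Longrightarrow> continuous_on UNIV (v K)"
  by (cases "K \<in> T") (auto simp: broken_def zero_fun_def intro: continuous_on_vec_poly_space)

section \<open>The discrete gradient\<close>

context dg_domain
begin

lemma trace_element:
  assumes "K \<in> T" shows "trace_measure lebesgue K"
proof -
  have "emeasure lebesgue K < \<infinity>"
    using element(4,5)[OF assms] emeasure_bounded_finite[OF compact_imp_bounded]
    by (simp add: borel_closed)
  then show ?thesis
    using element(4)[OF assms] completion.complete_measure_axioms
    by (auto simp: trace_measure_def trace_measure_axioms_def)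
qed

lemma trace_face:
  fixes e :: "(real^'n) set"
  assumes "compact e" "aff_dim e = int CARD('n) - 1"
  shows "trace_measure surface_measure e"
  using assms complete_surface_measure sets_surface_measure emeasure_surface_measure_finite[OF assms]
  by (auto simp: trace_measure_def trace_measure_axioms_def)

lemma trace_interior_face: "e \<in> interior_faces T \<Longrightarrow> trace_measure surface_measure e"
  using interior_face by (intro trace_face)

lemma \<Gamma>_subset: "\<Gamma>D \<subseteq> frontier \<Omega>" "\<Gamma>N \<subseteq> frontier \<Omega>"
  using frontier_\<Omega> by auto

lemma trace_boundary_face:
  "e \<in> boundary_faces T \<Gamma> \<Longrightarrow> \<Gamma> \<subseteq> frontier \<Omega> \<Longrightarrow> trace_measure surface_measure e"
  using boundary_face by (intro trace_face)

text \<open>Only points on the boundary of the convex set \<open>K\<close> can be outside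
  \<open>\<Omega>\<close>.\<close>

lemma element_diff_null:
  assumes "K \<in> T" shows "K - \<Omega> \<in> null_sets lebesgue"
proof -
  have "K - \<Omega> \<subseteq> frontier K"
    using interior_element[OF assms] element(5)[OF assms] by (auto simp: frontier_def)
  moreover have "negligible (frontier K)"
    using element(3)[OF assms] by (rule negligible_convex_frontier)
  ultimately show ?thesis using negligible_subset negligible_iff_null_sets by blast
qed

end

locale dg_spaces = dg_domain \<Omega> \<Gamma>D \<Gamma>N T for \<Omega> \<Gamma>D \<Gamma>N :: "(real^'n) set" and T +
  fixes k :: nat and C12 :: "(real^'n) set \<Rightarrow> real^'n"
begin

abbreviation "W \<equiv> broken T (poly_space k :: (real^'n \<Rightarrow> real) set)"
abbreviation "Q \<equiv> broken T (vec_poly_space k :: (real^'n \<Rightarrow> real^'n) set)"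

definition "L2 q \<zeta> = broken_integral T (\<lambda>K x. q K x \<bullet> \<zeta> K x)"
  for q \<zeta> :: "(real^'n) set \<Rightarrow> real^'n \<Rightarrow> real^'n"

definition "volume_form v \<zeta> = broken_integral T (\<lambda>K x. gradient (v K) x \<bullet> \<zeta> K x)"
definition "interior_form v \<zeta> =
  face_integral (interior_faces T) (\<lambda>e x. jump T v e x \<bullet> face_test T C12 \<zeta> e x)"
text \<open>The first argument is a family over faces, so that it can be the trace of a discrete
  function as well as the Dirichlet datum.\<close>

definition "boundary_form u \<zeta> = face_integral (boundary_faces T \<Gamma>D)
  (\<lambda>e x. u e x * (\<zeta> (boundary_element T e) x \<bullet> outward_normal (boundary_element T e) e))"

definition "gradient_form v \<zeta> =
  volume_form v \<zeta> - interior_form v \<zeta> - boundary_form (\<lambda>e. v (boundary_element T e)) \<zeta>"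

lemma W_continuous: "v \<in> W \<Longrightarrow> continuous_on UNIV (v K)"
  and Q_continuous: "q \<in> Q \<Longrightarrow> continuous_on UNIV (q K)"
  by (rule continuous_broken_poly continuous_broken_vec_poly; assumption)+

lemma W_differentiable:
  assumes "v \<in> W" shows "v K differentiable (at x)"
proof -
  have "v K \<in> poly_space k"
    using assms subspace_0[OF subspace_poly_space[of k, where 'a='n]] by (cases "K \<in> T") (auto simp: broken_def)
  then show ?thesis by (rule poly_space_differentiable)
qed

lemma gradient_W: "v \<in> W \<Longrightarrow> (\<lambda>K. gradient (v K)) \<in> Q"
proof -
  assume v: "v \<in> W"
  have "gradient (v K) \<in> vec_poly_space k" if "K \<in> T" for K
    using v that by (auto simp: broken_def intro: gradient_poly_space)
  moreover have "gradient (v K) = 0" if "K \<notin> T" for K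
  proof -
    have "v K = 0" using v that unfolding broken_def by blast
    then show ?thesis by (intro ext) (simp only: gradient_zero zero_fun_apply)
  qed
  ultimately show ?thesis unfolding broken_def by blast
qed

lemma subspace_W: "subspace W" and subspace_Q: "subspace Q"
  by (intro subspace_broken subspace_poly_space subspace_vec_poly_space)+

lemma L2_linear: "q \<in> Q \<Longrightarrow> linear_functional_on Q (\<lambda>u. L2 u q)"
  unfolding L2_def broken_integral_def
  by (intro linear_functional_on_sum_functionals linear_functional_on_integral
      trace_measure.integrable_continuous[OF trace_element] continuous_intros Q_continuous)
    (auto simp: inner_add_left)

lemma L2_self_zero:
  assumes q: "q \<in> Q" and z: "L2 q q = 0" and K: "K \<in> T" and x: "x \<in> interior K"
  shows "q K x = 0"
proof -
  have nn: "0 \<le> (LINT x:K|lebesgue. q K x \<bullet> q K x)" for K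
    unfolding set_lebesgue_integral_def by (auto intro!: integral_nonneg_AE)
  have "(LINT x:K|lebesgue. q K x \<bullet> q K x) = 0"
    using z K finite_T nn unfolding L2_def broken_integral_def
    by (simp add: sum_nonneg_eq_0_iff)
  then show ?thesis
    using trace_measure.integral_inner_self_zero[OF trace_element[OF K] Q_continuous[OF q]]
      AE_zero_continuous_interior[OF Q_continuous[OF q] _ x] by blast
qed

sublocale L2: inner_product_on Q L2
proof
  show "L2 q q \<ge> 0" for q
    unfolding L2_def broken_integral_def set_lebesgue_integral_def
    by (auto intro!: sum_nonneg integral_nonneg_AE)
  show "L2 q \<zeta> = L2 \<zeta> q" for q \<zeta> by (simp add: L2_def inner_commute)
  \<comment> \<open>A vanishing integral only says that the field is zero on the elements; members
    of \<open>Q\<close> are polynomials on the whole space, so the identity theorem is applied on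
    \<open>interior K\<close>.\<close>
  show "q = 0" if q: "q \<in> Q" "L2 q q = 0" for q
  proof
    fix K
    show "q K = 0 K"
    proof (cases "K \<in> T")
      case True
      show ?thesis
      proof
        fix y
        have "q K y $ i = 0" for i
        proof (rule real_polynomial_function_constant_on_open[of "\<lambda>x. q K x $ i" "interior K"])
          have "(\<lambda>x. q K x $ i) \<in> poly_space k"
            using q(1) True unfolding broken_def vec_poly_space_def by blast
          then show "real_polynomial_function (\<lambda>x. q K x $ i)"
            by (rule real_polynomial_function_poly_space)
          show "q K x $ i = 0" if "x \<in> interior K" for x using L2_self_zero[OF q True that] by simp
        qed (simp_all add: element(6)[OF True])
        then show "q K y = 0 K y" by (simp add: vec_eq_iff)
      qed
    next
      case False
      then show ?thesis using q(1) unfolding broken_def by simp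
    qed
  qed
qed (use subspace_Q L2_linear in auto)

lemma finite_dimensional_Q: "finite_dimensional Q" and finite_dimensional_W: "finite_dimensional W"
  by (intro finite_dimensional_broken finite_T subspace_poly_space subspace_vec_poly_space
      finite_dimensional_poly_space finite_dimensional_vec_poly_space)+

lemma Q_normal_component:
  "q \<in> Q \<Longrightarrow> continuous_on UNIV (\<lambda>x. q K x \<bullet> n)"
  by (intro continuous_intros Q_continuous)

lemma gradient_form_linear_left:
  assumes \<zeta>: "\<zeta> \<in> Q"
  shows "linear_functional_on W (\<lambda>v. gradient_form v \<zeta>)"
proof -
  have "linear_functional_on W (\<lambda>v. volume_form v \<zeta>)"
    unfolding volume_form_def broken_integral_def
  proof (intro linear_functional_on_sum_functionals linear_functional_on_integral
      trace_measure.integrable_continuous[OF trace_element])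
    show "continuous_on UNIV (\<lambda>x. gradient (v K) x \<bullet> \<zeta> K x)" if "v \<in> W" for v K
      by (intro continuous_on_inner Q_continuous[OF gradient_W[OF that]] Q_continuous[OF \<zeta>])
    show "gradient ((u + v) K) x \<bullet> \<zeta> K x = gradient (u K) x \<bullet> \<zeta> K x + gradient (v K) x \<bullet> \<zeta> K x"
      if "u \<in> W" "v \<in> W" for u v K x
      using gradient_add[OF W_differentiable[OF that(1)] W_differentiable[OF that(2)]]
      by (simp add: inner_add_left)
    show "gradient ((r *\<^sub>R u) K) x \<bullet> \<zeta> K x = r * (gradient (u K) x \<bullet> \<zeta> K x)"
      if "u \<in> W" for r u K x
      using gradient_scaleR[OF W_differentiable[OF that]] by (simp only: scaleR_fun_apply inner_scaleR_left)
  qed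
  moreover have "linear_functional_on W (\<lambda>v. interior_form v \<zeta>)"
    unfolding interior_form_def face_integral_def
    by (intro linear_functional_on_sum_functionals linear_functional_on_integral
        trace_measure.integrable_continuous[OF trace_interior_face] continuous_intros
        continuous_jump continuous_face_test W_continuous Q_continuous \<zeta>)
      (auto simp only: jump_add jump_scaleR inner_add_left inner_scaleR_left)
  moreover have "linear_functional_on W (\<lambda>v. boundary_form (\<lambda>e. v (boundary_element T e)) \<zeta>)"
    unfolding boundary_form_def face_integral_def
    by (intro linear_functional_on_sum_functionals linear_functional_on_integral
        trace_measure.integrable_continuous[OF trace_boundary_face[OF _ \<Gamma>_subset(1)]] continuous_intros
        W_continuous Q_continuous \<zeta>)
      (auto simp: distrib_right)
  ultimately show ?thesis unfolding gradient_form_def by (intro linear_functional_on_diff)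
qed

text \<open>Linearity in the test field is what the Riesz representation requires; linearity in
  \<open>v\<close> then carries over to the representer.\<close>

lemma gradient_form_linear_right:
  assumes v: "v \<in> W"
  shows "linear_functional_on Q (gradient_form v)"
proof -
  have "linear_functional_on Q (volume_form v)"
    unfolding volume_form_def broken_integral_def
    by (intro linear_functional_on_sum_functionals linear_functional_on_integral
        trace_measure.integrable_continuous[OF trace_element] continuous_intros Q_continuous
        Q_continuous[OF gradient_W[OF v]])
      (auto simp: inner_add_right)
  moreover have "linear_functional_on Q (interior_form v)"
    unfolding interior_form_def face_integral_def
    by (intro linear_functional_on_sum_functionals linear_functional_on_integral
        trace_measure.integrable_continuous[OF trace_interior_face] continuous_intros
        continuous_jump continuous_face_test W_continuous Q_continuous v)
      (auto simp only: face_test_add face_test_scaleR inner_add_right inner_scaleR_right)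
  moreover have "linear_functional_on Q (boundary_form (\<lambda>e. v (boundary_element T e)))"
    unfolding boundary_form_def face_integral_def
    by (intro linear_functional_on_sum_functionals linear_functional_on_integral
        trace_measure.integrable_continuous[OF trace_boundary_face[OF _ \<Gamma>_subset(1)]] continuous_intros
        W_continuous Q_continuous v)
      (auto simp: inner_add_left algebra_simps)
  ultimately show ?thesis unfolding gradient_form_def[abs_def] by (intro linear_functional_on_diff)
qed

lemma boundary_form_linear:
  assumes g: "\<And>e \<phi>. e \<in> boundary_faces T \<Gamma>D \<Longrightarrow> continuous_on UNIV \<phi> \<Longrightarrow>
      set_integrable surface_measure e (\<lambda>x. g x * \<phi> x)"
  shows "linear_functional_on Q (boundary_form (\<lambda>_. g))"
  unfolding boundary_form_def face_integral_def
  by (intro linear_functional_on_sum_functionals linear_functional_on_integral g Q_normal_component)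
    (auto simp: inner_add_left algebra_simps)

lemma boundary_element_in:
  assumes "e \<in> boundary_faces T \<Gamma>D \<or> e \<in> boundary_faces T \<Gamma>N"
  shows "boundary_element T e \<in> T"
  using assms boundary_face(5) \<Gamma>_subset by blast

section \<open>Passage between families that vanish outside the mesh and extensional
  families\<close>

lemma jump_restrict: "jump T (restrict v T) e x = jump T v e x"
  unfolding jump_def by (intro sum.cong) (auto simp: neighbours_def)

lemma face_test_restrict: "face_test T C12 (restrict \<zeta> T) e x = face_test T C12 \<zeta> e x"
  unfolding face_test_def vec_average_def vec_jump_def
  by (intro arg_cong2[where f="(-)"] arg_cong2[where f=scaleR] sum.cong refl) (auto simp: neighbours_def)

lemma restrict_Q: "q \<in> Q \<Longrightarrow> restrict q T \<in> Q_h T k"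
  by (auto simp: broken_def Q_h_def)

lemma restrict_W: "v \<in> W \<Longrightarrow> restrict v T \<in> V_h T k"
  by (auto simp: broken_def V_h_def)

lemma Q_h_restrictE:
  assumes "q \<in> Q_h T k" obtains q' where "q' \<in> Q" "q = restrict q' T"
proof (rule that[of "\<lambda>K. if K \<in> T then q K else 0"])
  show "(\<lambda>K. if K \<in> T then q K else 0) \<in> Q" using assms by (auto simp: Q_h_def broken_def)
  show "q = restrict (\<lambda>K. if K \<in> T then q K else 0) T"
    using assms by (auto simp: Q_h_def fun_eq_iff PiE_def extensional_def)
qed

lemma V_h_restrictE:
  assumes "v \<in> V_h T k" obtains v' where "v' \<in> W" "v = restrict v' T"
proof (rule that[of "\<lambda>K. if K \<in> T then v K else 0"])
  show "(\<lambda>K. if K \<in> T then v K else 0) \<in> W" using assms by (auto simp: V_h_def broken_def)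
  show "v = restrict (\<lambda>K. if K \<in> T then v K else 0) T"
    using assms by (auto simp: V_h_def fun_eq_iff PiE_def extensional_def)
qed

lemma L2_restrict: "L2 (restrict q T) (restrict \<zeta> T) = L2 q \<zeta>"
  unfolding L2_def broken_integral_def by (intro sum.cong) auto

text \<open>Splitting \<open>v - g\<close> in the Dirichlet term needs both parts integrable; for
  \<open>g\<close> times a continuous function this is the hypothesis on \<open>g\<close>.\<close>

lemma D_DG_rhs:
  assumes v: "v \<in> W" and \<zeta>: "\<zeta> \<in> Q"
    and g: "\<And>e \<phi>. e \<in> boundary_faces T \<Gamma>D \<Longrightarrow> continuous_on UNIV \<phi> \<Longrightarrow>
      set_integrable surface_measure e (\<lambda>x. g x * \<phi> x)"
  shows "broken_integral T (\<lambda>K x. gradient (restrict v T K) x \<bullet> restrict \<zeta> T K x)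
       - face_integral (interior_faces T) (\<lambda>e x. jump T (restrict v T) e x \<bullet>
           (vec_average T (restrict \<zeta> T) e x - vec_jump T (restrict \<zeta> T) e x *\<^sub>R C12 e))
       - face_integral (boundary_faces T \<Gamma>D)
           (\<lambda>e x. let K = boundary_element T e in
              (restrict v T K x - g x) * (restrict \<zeta> T K x \<bullet> outward_normal K e))
     = gradient_form v \<zeta> + boundary_form (\<lambda>_. g) \<zeta>"
proof -
  have 1: "broken_integral T (\<lambda>K x. gradient (restrict v T K) x \<bullet> restrict \<zeta> T K x) = volume_form v \<zeta>"
    unfolding volume_form_def broken_integral_def by (intro sum.cong) auto
  have 2: "face_integral (interior_faces T) (\<lambda>e x. jump T (restrict v T) e x \<bullet>
      (vec_average T (restrict \<zeta> T) e x - vec_jump T (restrict \<zeta> T) e x *\<^sub>R C12 e)) = interior_form v \<zeta>"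
    unfolding interior_form_def face_test_def[symmetric] jump_restrict face_test_restrict ..
  have "(LINT x:e|surface_measure. (let K = boundary_element T e in
        (restrict v T K x - g x) * (restrict \<zeta> T K x \<bullet> outward_normal K e))) =
      (LINT x:e|surface_measure. v (boundary_element T e) x *
        (\<zeta> (boundary_element T e) x \<bullet> outward_normal (boundary_element T e) e)) -
      (LINT x:e|surface_measure. g x *
        (\<zeta> (boundary_element T e) x \<bullet> outward_normal (boundary_element T e) e))"
    if e: "e \<in> boundary_faces T \<Gamma>D" for e
  proof -
    let ?K = "boundary_element T e"
    let ?z = "\<lambda>x. \<zeta> ?K x \<bullet> outward_normal ?K e"
    have K: "?K \<in> T" using e boundary_element_in by blast
    have "set_integrable surface_measure e (\<lambda>x. v ?K x * ?z x)"
      by (intro trace_measure.integrable_continuous[OF trace_boundary_face[OF e \<Gamma>_subset(1)]]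
          continuous_intros W_continuous Q_continuous v \<zeta>)
    moreover have "set_integrable surface_measure e (\<lambda>x. g x * ?z x)"
      by (intro g e Q_normal_component \<zeta>)
    ultimately have "(LINT x:e|surface_measure. v ?K x * ?z x - g x * ?z x) =
        (LINT x:e|surface_measure. v ?K x * ?z x) - (LINT x:e|surface_measure. g x * ?z x)"
      by (rule set_integral_diff(2))
    then show ?thesis using K by (simp add: Let_def left_diff_distrib)
  qed
  then have 3: "face_integral (boundary_faces T \<Gamma>D)
           (\<lambda>e x. let K = boundary_element T e in
              (restrict v T K x - g x) * (restrict \<zeta> T K x \<bullet> outward_normal K e)) =
      boundary_form (\<lambda>e. v (boundary_element T e)) \<zeta> - boundary_form (\<lambda>_. g) \<zeta>"
    unfolding boundary_form_def face_integral_def sum_subtractf[symmetric] by (intro sum.cong) auto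
  show ?thesis unfolding 1 2 3 gradient_form_def by simp
qed

text \<open>Riesz representation gives existence and definiteness of \<open>L2\<close> gives
  uniqueness, so the definite description in \<open>D_DG\<close> denotes; the formula shows that it
  is affine in \<open>v\<close>.\<close>

lemma D_DG_eq:
  assumes v: "v \<in> W" and E: "L2.orthonormal E" "span E = Q"
    and g: "\<And>e \<phi>. e \<in> boundary_faces T \<Gamma>D \<Longrightarrow> continuous_on UNIV \<phi> \<Longrightarrow>
      set_integrable surface_measure e (\<lambda>x. g x * \<phi> x)"
  shows "D_DG T \<Gamma>D k C12 (restrict v T) g =
    restrict (\<Sum>a\<in>E. (gradient_form v a + boundary_form (\<lambda>_. g) a) *\<^sub>R a) T"
proof -
  define q where "q = (\<Sum>a\<in>E. (gradient_form v a + boundary_form (\<lambda>_. g) a) *\<^sub>R a)"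
  have lin: "linear_functional_on Q (\<lambda>\<zeta>. gradient_form v \<zeta> + boundary_form (\<lambda>_. g) \<zeta>)"
    by (intro linear_functional_on_add gradient_form_linear_right boundary_form_linear v g)
  have qQ: "q \<in> Q" unfolding q_def E(2)[symmetric] by (intro span_sum span_scale span_base)
  have q: "L2 q \<zeta> = gradient_form v \<zeta> + boundary_form (\<lambda>_. g) \<zeta>" if "\<zeta> \<in> Q" for \<zeta>
    unfolding q_def by (rule L2.riesz_orthonormal[OF E lin that])
  have rhs: "broken_integral T (\<lambda>K x. r K x \<bullet> \<xi> K x) =
       broken_integral T (\<lambda>K x. gradient (restrict v T K) x \<bullet> \<xi> K x)
       - face_integral (interior_faces T)
           (\<lambda>e x. jump T (restrict v T) e x \<bullet> (vec_average T \<xi> e x - vec_jump T \<xi> e x *\<^sub>R C12 e))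
       - face_integral (boundary_faces T \<Gamma>D)
           (\<lambda>e x. let K = boundary_element T e in
              (restrict v T K x - g x) * (\<xi> K x \<bullet> outward_normal K e))
    \<longleftrightarrow> L2 r \<xi> = gradient_form v \<zeta> + boundary_form (\<lambda>_. g) \<zeta>"
    if "\<zeta> \<in> Q" "\<xi> = restrict \<zeta> T" for r \<zeta> \<xi>
    unfolding that(2) L2_def by (simp only: D_DG_rhs[OF v that(1) g])
  show ?thesis
    unfolding q_def[symmetric] D_DG_def
  proof (rule the_equality, intro conjI ballI)
    show "restrict q T \<in> Q_h T k" using qQ by (rule restrict_Q)
  next
    fix \<xi> assume "\<xi> \<in> Q_h T k"
    then obtain \<zeta> where \<zeta>: "\<zeta> \<in> Q" "\<xi> = restrict \<zeta> T" by (rule Q_h_restrictE)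
    show "broken_integral T (\<lambda>K x. restrict q T K x \<bullet> \<xi> K x) =
       broken_integral T (\<lambda>K x. gradient (restrict v T K) x \<bullet> \<xi> K x)
       - face_integral (interior_faces T)
           (\<lambda>e x. jump T (restrict v T) e x \<bullet> (vec_average T \<xi> e x - vec_jump T \<xi> e x *\<^sub>R C12 e))
       - face_integral (boundary_faces T \<Gamma>D)
           (\<lambda>e x. let K = boundary_element T e in
              (restrict v T K x - g x) * (\<xi> K x \<bullet> outward_normal K e))"
      unfolding rhs[OF \<zeta>] unfolding \<zeta>(2) L2_restrict by (rule q[OF \<zeta>(1)])
  next
    fix r assume r: "r \<in> Q_h T k \<and> (\<forall>\<xi>\<in>Q_h T k. broken_integral T (\<lambda>K x. r K x \<bullet> \<xi> K x) =
       broken_integral T (\<lambda>K x. gradient (restrict v T K) x \<bullet> \<xi> K x)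
       - face_integral (interior_faces T)
           (\<lambda>e x. jump T (restrict v T) e x \<bullet> (vec_average T \<xi> e x - vec_jump T \<xi> e x *\<^sub>R C12 e))
       - face_integral (boundary_faces T \<Gamma>D)
           (\<lambda>e x. let K = boundary_element T e in
              (restrict v T K x - g x) * (\<xi> K x \<bullet> outward_normal K e)))"
    obtain r' where r': "r' \<in> Q" "r = restrict r' T" using r by (blast elim: Q_h_restrictE)
    have "L2 r' \<zeta> = L2 q \<zeta>" if \<zeta>: "\<zeta> \<in> Q" for \<zeta>
    proof -
      have "L2 r (restrict \<zeta> T) = gradient_form v \<zeta> + boundary_form (\<lambda>_. g) \<zeta>"
        using r restrict_Q[OF \<zeta>] rhs[OF \<zeta> refl] by blast
      then show ?thesis unfolding r'(2) L2_restrict q[OF \<zeta>] .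
    qed
    then have "r' = q" using r'(1) qQ by (intro L2.ip_unique)
    then show "r = restrict q T" using r' by simp
  qed
qed

text \<open>Vanishing of the three homogeneous energies makes \<open>\<nabla>\<^sub>h v\<close> orthogonal to all of \<open>Q\<close>, in
  particular to itself; so \<open>v\<close> is piecewise constant, and the zero jumps spread the zero Dirichlet
  value over the whole mesh.\<close>

lemma W_zero:
  assumes v: "v \<in> W" and E: "L2.orthonormal E" "span E = Q"
    and D: "\<And>K. K \<in> T \<Longrightarrow> AE x in lebesgue. x \<in> K \<longrightarrow> (\<Sum>a\<in>E. gradient_form v a *\<^sub>R a) K x = 0"
    and J: "\<And>e. e \<in> interior_faces T \<Longrightarrow> AE x in surface_measure. x \<in> e \<longrightarrow> jump T v e x = 0"
    and B: "\<And>e. e \<in> boundary_faces T \<Gamma>D \<Longrightarrow>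
        AE x in surface_measure. x \<in> e \<longrightarrow> v (boundary_element T e) x = 0"
  shows "v = 0"
proof -
  define q where "q = (\<Sum>a\<in>E. gradient_form v a *\<^sub>R a)"
  have form0: "gradient_form v \<zeta> = 0" if \<zeta>: "\<zeta> \<in> Q" for \<zeta>
  proof -
    have "gradient_form v \<zeta> = L2 q \<zeta>"
      unfolding q_def by (rule L2.riesz_orthonormal[OF E gradient_form_linear_right[OF v] \<zeta>, symmetric])
    also have "\<dots> = 0"
      unfolding L2_def broken_integral_def
    proof (intro sum.neutral ballI set_integral_eq_zero_AE)
      fix K assume "K \<in> T"
      from D[OF this] show "AE x in lebesgue. x \<in> K \<longrightarrow> q K x \<bullet> \<zeta> K x = 0"
        unfolding q_def by eventually_elim auto
    qed
    finally show ?thesis .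
  qed
  let ?\<zeta> = "\<lambda>K. gradient (v K)"
  have "interior_form v ?\<zeta> = 0"
    unfolding interior_form_def face_integral_def
  proof (intro sum.neutral ballI set_integral_eq_zero_AE)
    fix e assume "e \<in> interior_faces T"
    from J[OF this] show "AE x in surface_measure. x \<in> e \<longrightarrow> jump T v e x \<bullet> face_test T C12 ?\<zeta> e x = 0"
      by eventually_elim auto
  qed
  moreover have "boundary_form (\<lambda>e. v (boundary_element T e)) ?\<zeta> = 0"
    unfolding boundary_form_def face_integral_def
  proof (intro sum.neutral ballI set_integral_eq_zero_AE)
    fix e assume "e \<in> boundary_faces T \<Gamma>D"
    from B[OF this] show "AE x in surface_measure. x \<in> e \<longrightarrow> v (boundary_element T e) x *
        (?\<zeta> (boundary_element T e) x \<bullet> outward_normal (boundary_element T e) e) = 0"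
      by eventually_elim auto
  qed
  ultimately have "L2 ?\<zeta> ?\<zeta> = 0"
    using form0[OF gradient_W[OF v]] by (simp add: gradient_form_def volume_form_def L2_def)
  then have grad0: "gradient (v K) x = 0" if "K \<in> T" "x \<in> interior K" for K x
    using L2_self_zero[OF gradient_W[OF v] _ that] by simp
  have "\<exists>c. \<forall>x. v K x = c" if K: "K \<in> T" for K
    using v K grad0[OF K] element[OF K]
    by (intro gradient_zero_constant[of _ k "interior K"]) (auto simp: broken_def)
  then obtain c where c: "\<And>K x. K \<in> T \<Longrightarrow> v K x = c K" by metis
  \<comment> \<open>An almost-everywhere statement yields an actual point because a face has
    positive measure; as \<open>v\<close> is piecewise constant, one point is enough.\<close>
  have pos: "\<exists>x\<in>e. P x"
    if "AE x in surface_measure. x \<in> e \<longrightarrow> P x" "compact e" "convex e" "aff_dim e = int CARD('n) - 1"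
    for e :: "(real^'n) set" and P
  proof (rule ccontr)
    assume "\<not> ?thesis"
    then have "AE x in surface_measure. x \<notin> e" using that(1) by (auto elim: eventually_mono)
    moreover have "e \<in> sets surface_measure"
      using that(2) sets_surface_measure compact_imp_closed borel_closed by blast
    ultimately have "emeasure surface_measure e = 0" by (simp add: AE_iff_measurable[OF _ refl] Collect_conv_if)
    then show False
      using emeasure_surface_measure_pos[OF compact_imp_closed that(3,4)] that(2) by auto
  qed
  have cc: "c K0 = c K1" if "K0 \<in> T" "K1 \<in> T" for K0 K1
  proof (rule constant_on_mesh[OF _ that])
    fix K K' assume K: "K \<in> T" "K' \<in> T" and e: "K \<inter> K' \<in> interior_faces T"
    let ?e = "K \<inter> K'"
    obtain L L' where L: "L \<in> T" "L' \<in> T" "L \<noteq> L'" "neighbours T ?e = {L, L'}"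
      "outward_normal L' ?e = - outward_normal L ?e" "norm (outward_normal L ?e) = 1"
      using interior_faceE[OF e] by metis
    obtain x where "jump T v ?e x = 0"
      using pos[OF J[OF e]] interior_face[OF e] by blast
    \<comment> \<open>The normals are opposite, so the jump of a piecewise constant function is the
      difference of its values times one normal.\<close>
    then have "(c L - c L') *\<^sub>R outward_normal L ?e = 0"
      using L c by (simp add: jump_def algebra_simps)
    moreover have "outward_normal L ?e \<noteq> 0" using L(6) by auto
    ultimately have "c L = c L'" by simp
    moreover have "K \<in> {L, L'}" "K' \<in> {L, L'}"
      using K L(4)[symmetric] by (auto simp: neighbours_def)
    ultimately show "c K = c K'" by auto
  qed
  obtain e where e: "e \<in> boundary_faces T \<Gamma>D" using ex_boundary_face_\<Gamma>D by blast
  have K0: "boundary_element T e \<in> T" using e boundary_element_in by blast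
  obtain x where "v (boundary_element T e) x = 0"
    using pos[OF B[OF e]] boundary_face[OF e \<Gamma>_subset(1)] by blast
  then have "c (boundary_element T e) = 0" using c K0 by simp
  then have "v K x = 0" if "K \<in> T" for K x using c[OF that] cc[OF that K0] by simp
  then have "v K = 0" if "K \<in> T" for K using that by (auto simp: fun_eq_iff)
  moreover have "v K = 0" if "K \<notin> T" for K using v that unfolding broken_def by blast
  ultimately show ?thesis by (intro ext[of v]) (metis zero_fun_apply)
qed

end

section \<open>Existence of a discrete minimiser\<close>

locale dg_data = dg_spaces \<Omega> \<Gamma>D \<Gamma>N T k C12
  for \<Omega> \<Gamma>D \<Gamma>N :: "(real^'n) set" and T k C12 +
  fixes p p' :: real and \<eta> h :: "(real^'n) set \<Rightarrow> real" and f gD :: "real^'n \<Rightarrow> real"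
    and gN :: "real^'n \<Rightarrow> real^'n"
  assumes p: "1 < p" and conjugate: "1/p + 1/p' = 1"
    and f: "in_Lp lebesgue p' \<Omega> f" and gD: "in_Lp surface_measure p \<Gamma>D gD"
    and gN: "in_Lp surface_measure p' \<Gamma>N (\<lambda>x. gN x \<bullet> domain_normal \<Omega> x)"
    and weights_pos: "\<And>e. e \<in> interior_faces T \<union> boundary_faces T (frontier \<Omega>) \<Longrightarrow> \<eta> e > 0"
      "\<And>e. e \<in> interior_faces T \<union> boundary_faces T (frontier \<Omega>) \<Longrightarrow> h e > 0"
begin

definition "load v =
  broken_integral T (\<lambda>K x. f x * v K x) +
  face_integral (boundary_faces T \<Gamma>N) (\<lambda>e x. (gN x \<bullet> domain_normal \<Omega> x) * v (boundary_element T e) x)"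

text \<open>Constant on each face, so every face term of the energy is this number times an
  unweighted \<open>affine_energy\<close>.\<close>

definition "weight e = 1/p * (\<eta> e * h e powr (1 - p))"

lemma weight_pos:
  assumes "e \<in> interior_faces T \<or> e \<in> boundary_faces T \<Gamma>D"
  shows "weight e > 0"
proof -
  have "e \<in> interior_faces T \<union> boundary_faces T (frontier \<Omega>)"
    using assms \<Gamma>_subset(1) by (auto simp: boundary_faces_def)
  then have "\<eta> e > 0" "h e > 0" by (rule weights_pos)+
  then show ?thesis unfolding weight_def using p by simp
qed

lemma p'_ge: "1 \<le> p'"
proof -
  have "1/p' = 1 - 1/p" using conjugate by simp
  moreover have "0 < 1/p" "1/p < 1" using p by auto
  ultimately have "0 < 1/p'" "1/p' \<le> 1" by linarith+
  then show ?thesis by (simp add: divide_le_eq_1 zero_less_divide_iff)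
qed

lemma gD_face:
  assumes e: "e \<in> boundary_faces T \<Gamma>D"
  shows "set_borel_measurable surface_measure e gD"
    "set_integrable surface_measure e (\<lambda>x. \<bar>gD x\<bar> powr p)"
  by (rule trace_measure.in_Lp_trace[OF trace_boundary_face[OF e \<Gamma>_subset(1)] gD
      boundary_face(7)[OF e \<Gamma>_subset(1)]])+

lemma gD_integrable:
  assumes "e \<in> boundary_faces T \<Gamma>D" "continuous_on UNIV \<phi>"
  shows "set_integrable surface_measure e (\<lambda>x. gD x * \<phi> x)"
  using p gD_face[OF assms(1)] assms(2)
  by (intro trace_measure.integrable_Lp_mult_continuous[OF trace_boundary_face[OF assms(1) \<Gamma>_subset(1)], of p]) auto

lemma load_linear: "linear_functional_on W load"
proof -
  have "set_integrable lebesgue K (\<lambda>x. f x * v K x)" if "v \<in> W" "K \<in> T" for v K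
    using trace_measure.in_Lp_trace[OF trace_element[OF that(2)] f element_diff_null[OF that(2)]]
    by (intro trace_measure.integrable_Lp_mult_continuous[OF trace_element[OF that(2)] p'_ge]
        W_continuous that)
  then have "linear_functional_on W (\<lambda>v. broken_integral T (\<lambda>K x. f x * v K x))"
    unfolding broken_integral_def
    by (intro linear_functional_on_sum_functionals linear_functional_on_integral)
      (auto simp: algebra_simps)
  moreover have "set_integrable surface_measure e (\<lambda>x. (gN x \<bullet> domain_normal \<Omega> x) * v (boundary_element T e) x)"
    if "v \<in> W" and e: "e \<in> boundary_faces T \<Gamma>N" for v e
    using trace_measure.in_Lp_trace[OF trace_boundary_face[OF e \<Gamma>_subset(2)] gN
        boundary_face(7)[OF e \<Gamma>_subset(2)]]
    by (intro trace_measure.integrable_Lp_mult_continuous[OF trace_boundary_face[OF e \<Gamma>_subset(2)] p'_ge]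
        W_continuous that)
  then have "linear_functional_on W (\<lambda>v. face_integral (boundary_faces T \<Gamma>N)
      (\<lambda>e x. (gN x \<bullet> domain_normal \<Omega> x) * v (boundary_element T e) x))"
    unfolding face_integral_def
    by (intro linear_functional_on_sum_functionals linear_functional_on_integral)
      (auto simp: algebra_simps)
  ultimately show ?thesis unfolding load_def[abs_def] by (rule linear_functional_on_add)
qed

lemma exists_minimiser:
  "\<exists>u\<in>V_h T k. \<forall>v\<in>V_h T k.
    J_h \<Omega> \<Gamma>D \<Gamma>N T k p \<eta> h C12 f gD gN u \<le> J_h \<Omega> \<Gamma>D \<Gamma>N T k p \<eta> h C12 f gD gN v"
proof -
  let ?be = "boundary_element T"
  obtain E where E: "L2.orthonormal E" "span E = Q"
    using finite_dimensional_Q L2.orthonormal_basis_exists span_superset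
    unfolding finite_dimensional_def by metis
  obtain N :: nat and b where bW: "\<forall>i<N. b i \<in> W"
    and bspan: "\<forall>v\<in>W. \<exists>c. v = (\<Sum>i<N. c i *\<^sub>R b i)"
    and bind: "\<forall>c. (\<Sum>i<N. c i *\<^sub>R b i) = 0 \<longrightarrow> (\<forall>i<N. c i = 0)"
    by (rule finite_dimensional_basis[OF finite_dimensional_W])
  define V where "V c = (\<Sum>i<N. c i *\<^sub>R b i)" for c :: "nat \<Rightarrow> real"
  have VW: "V c \<in> W" for c
    unfolding V_def using bW by (intro subspace_sum subspace_scale subspace_W) auto
  have Vapp: "V c K x = (\<Sum>i<N. c i *\<^sub>R b i K x)" for c K x
    by (simp only: V_def sum_fun_apply scaleR_fun_apply)
  have Vjump: "jump T (V c) e x = (\<Sum>i<N. c i *\<^sub>R jump T (b i) e x)" for c e x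
    unfolding V_def by (rule jump_sum)
  \<comment> \<open>The discrete gradient with datum \<open>gD\<close> splits as
    \<open>D v + R\<close>: \<open>D\<close> is linear in \<open>v\<close>, and \<open>R\<close> is
    the fixed representer of the Dirichlet datum.\<close>
  define D where "D v = (\<Sum>a\<in>E. gradient_form v a *\<^sub>R a)" for v
  define R where "R = (\<Sum>a\<in>E. boundary_form (\<lambda>_. gD) a *\<^sub>R a)"
  have EQ: "a \<in> Q" if "a \<in> E" for a using that E(2) span_base by blast
  have DQ: "D v \<in> Q" and RQ: "R \<in> Q" for v
    unfolding D_def R_def using EQ by (intro subspace_sum subspace_scale subspace_Q; blast)+
  have DV: "D (V c) K x = (\<Sum>i<N. c i *\<^sub>R D (b i) K x)" for c K x
  proof -
    have "gradient_form (V c) a = (\<Sum>i<N. c i * gradient_form (b i) a)" if "a \<in> E" for a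
      unfolding V_def using bW
      by (intro linear_functional_on_sum[OF gradient_form_linear_left[OF EQ[OF that]] subspace_W]) auto
    then have "D (V c) = (\<Sum>a\<in>E. (\<Sum>i<N. c i * gradient_form (b i) a) *\<^sub>R a)"
      unfolding D_def by (simp only: cong: sum.cong)
    also have "\<dots> = (\<Sum>i<N. c i *\<^sub>R D (b i))"
      unfolding D_def scaleR_sum_right scaleR_sum_left scaleR_scaleR by (rule sum.swap)
    finally show ?thesis by (simp only: sum_fun_apply scaleR_fun_apply)
  qed
  have DDG: "D_DG T \<Gamma>D k C12 (restrict (V c) T) gD K x = (\<Sum>i<N. c i *\<^sub>R D (b i) K x) + R K x"
    if "K \<in> T" for c K x
  proof -
    have "D_DG T \<Gamma>D k C12 (restrict (V c) T) gD =
        restrict (\<Sum>a\<in>E. (gradient_form (V c) a + boundary_form (\<lambda>_. gD) a) *\<^sub>R a) T"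
      by (rule D_DG_eq[OF VW E]) (rule gD_integrable)
    also have "\<dots> = restrict (D (V c) + R) T"
      unfolding D_def R_def by (simp only: scaleR_add_left sum.distrib)
    finally show ?thesis using that DV by (simp only: restrict_apply plus_fun_apply if_True)
  qed
  have term_K: "affine_energy lebesgue K N p (\<lambda>i. D (b i) K) (R K)" if K: "K \<in> T" for K
  proof -
    interpret trace_measure lebesgue K by (rule trace_element[OF K])
    \<comment> \<open>Although \<open>gD\<close> merely has an integrable \<open>p\<close>-th power
      on \<open>\<Gamma>D\<close>, its representer \<open>R\<close> is polynomial on each
      element.\<close>
    have "set_integrable lebesgue K (\<lambda>x. norm (R K x) powr p)"
      using p by (intro integrable_continuous continuous_on_powr' continuous_on_norm Q_continuous RQ
          continuous_on_const) auto
    then show ?thesis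
      using p S_sets emeasure_finite measurable_continuous[OF Q_continuous[OF DQ]]
        measurable_continuous[OF Q_continuous[OF RQ]] bounded_continuous[OF Q_continuous[OF DQ]]
      by unfold_locales
  qed
  have term_I: "affine_energy surface_measure e N p (\<lambda>i. jump T (b i) e) (\<lambda>_. 0)"
    if e: "e \<in> interior_faces T" for e
  proof -
    interpret trace_measure surface_measure e by (rule trace_interior_face[OF e])
    have "continuous_on UNIV (jump T (b i) e)" if "i < N" for i
      using bW that by (intro continuous_jump W_continuous) auto
    then show ?thesis
      using p S_sets emeasure_finite measurable_continuous bounded_continuous
      by unfold_locales (auto simp: set_borel_measurable_def set_integrable_def)
  qed
  have term_B: "affine_energy surface_measure e N p (\<lambda>i. b i (?be e)) (\<lambda>x. - gD x)"
    if e: "e \<in> boundary_faces T \<Gamma>D" for e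
  proof -
    interpret trace_measure surface_measure e by (rule trace_boundary_face[OF e \<Gamma>_subset(1)])
    have "set_borel_measurable surface_measure e (\<lambda>x. - gD x)"
      using gD_face(1)[OF e] by (simp add: set_borel_measurable_def)
    moreover have "continuous_on UNIV (b i (?be e))" if "i < N" for i
      using bW that by (intro W_continuous) auto
    then have "set_borel_measurable surface_measure e (b i (?be e))"
      "\<exists>B. \<forall>x\<in>e. norm (b i (?be e) x) \<le> B" if "i < N" for i
      using that by (blast intro: measurable_continuous bounded_continuous)+
    ultimately show ?thesis
      using p S_sets emeasure_finite gD_face(2)[OF e] by unfold_locales auto
  qed
  define GK where "GK K = affine_energy.energy lebesgue K N p (\<lambda>i. D (b i) K) (R K)" for K
  define GK0 where "GK0 K = affine_energy.energy0 lebesgue K N p (\<lambda>i. D (b i) K)" for K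
  define GI where "GI e = affine_energy.energy surface_measure e N p (\<lambda>i. jump T (b i) e) (\<lambda>_. 0)" for e
  define GI0 where "GI0 e = affine_energy.energy0 surface_measure e N p (\<lambda>i. jump T (b i) e)" for e
  define GB where "GB e = affine_energy.energy surface_measure e N p (\<lambda>i. b i (?be e)) (\<lambda>x. - gD x)" for e
  define GB0 where "GB0 e = affine_energy.energy0 surface_measure e N p (\<lambda>i. b i (?be e))" for e
  define G where "G c = (\<Sum>K\<in>T. 1/p * GK K c) + (\<Sum>e\<in>interior_faces T. weight e * GI e c) +
    (\<Sum>e\<in>boundary_faces T \<Gamma>D. weight e * GB e c)" for c
  define G0 where "G0 c = (\<Sum>K\<in>T. 1/p * GK0 K c) + (\<Sum>e\<in>interior_faces T. weight e * GI0 e c) +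
    (\<Sum>e\<in>boundary_faces T \<Gamma>D. weight e * GB0 e c)" for c
  have coercive: "coercive_term p N G G0"
    unfolding G_def[abs_def] G0_def[abs_def] GK_def GK0_def GI_def GI0_def GB_def GB0_def
    using p
    by (intro coercive_term_add coercive_term_sum finite_T finite_interior_faces finite_boundary_faces
        coercive_term_mult affine_energy.coercive_term_energy term_K term_I term_B)
      (auto intro: less_imp_le[OF weight_pos])
  have definite: "c i = 0" if z: "G0 c = 0" and i: "i < N" for c i
  proof -
    have nn: "\<And>K. K \<in> T \<Longrightarrow> 0 \<le> 1/p * GK0 K c" "\<And>e. e \<in> interior_faces T \<Longrightarrow> 0 \<le> weight e * GI0 e c"
      "\<And>e. e \<in> boundary_faces T \<Gamma>D \<Longrightarrow> 0 \<le> weight e * GB0 e c"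
      unfolding GK0_def GI0_def GB0_def
      using p affine_energy.energy_nonneg(2)[OF term_K] affine_energy.energy_nonneg(2)[OF term_I]
        affine_energy.energy_nonneg(2)[OF term_B] weight_pos
      by (auto intro!: mult_nonneg_nonneg divide_nonneg_nonneg simp: less_imp_le)
    have s: "(\<Sum>K\<in>T. 1/p * GK0 K c) \<ge> 0" "(\<Sum>e\<in>interior_faces T. weight e * GI0 e c) \<ge> 0"
      "(\<Sum>e\<in>boundary_faces T \<Gamma>D. weight e * GB0 e c) \<ge> 0"
      using nn by (intro sum_nonneg; blast)+
    then have zero: "(\<Sum>K\<in>T. 1/p * GK0 K c) = 0" "(\<Sum>e\<in>interior_faces T. weight e * GI0 e c) = 0"
      "(\<Sum>e\<in>boundary_faces T \<Gamma>D. weight e * GB0 e c) = 0"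
      using z unfolding G0_def by linarith+
    have zK: "GK0 K c = 0" if K: "K \<in> T" for K
      using sum_nonneg_0[OF finite_T nn(1) zero(1) K] p by simp
    have zI: "GI0 e c = 0" if e: "e \<in> interior_faces T" for e
      using sum_nonneg_0[OF finite_interior_faces nn(2) zero(2) e] weight_pos e by force
    have zB: "GB0 e c = 0" if e: "e \<in> boundary_faces T \<Gamma>D" for e
      using sum_nonneg_0[OF finite_boundary_faces nn(3) zero(3) e] weight_pos e by force
    \<comment> \<open>Positive weights make each vanishing sum of nonnegative terms vanish termwise.
      Once \<open>V c = 0\<close>, linear independence of the \<open>b i\<close> forces
      \<open>c i = 0\<close>.\<close>
    have "V c = 0"
    proof (rule W_zero[OF VW E])
      show "AE x in lebesgue. x \<in> K \<longrightarrow> (\<Sum>a\<in>E. gradient_form (V c) a *\<^sub>R a) K x = 0" if "K \<in> T" for K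
        using affine_energy.energy0_zero_AE[OF term_K[OF that] zK[OF that, unfolded GK0_def]]
        unfolding DV[symmetric] unfolding D_def .
      show "AE x in surface_measure. x \<in> e \<longrightarrow> jump T (V c) e x = 0" if "e \<in> interior_faces T" for e
        using affine_energy.energy0_zero_AE[OF term_I[OF that] zI[OF that, unfolded GI0_def]]
        unfolding Vjump[symmetric] .
      show "AE x in surface_measure. x \<in> e \<longrightarrow> V c (?be e) x = 0" if "e \<in> boundary_faces T \<Gamma>D" for e
        using affine_energy.energy0_zero_AE[OF term_B[OF that] zB[OF that, unfolded GB0_def]]
        unfolding Vapp[symmetric] .
    qed
    then show ?thesis using bind i unfolding V_def by blast
  qed
  have J: "J_h \<Omega> \<Gamma>D \<Gamma>N T k p \<eta> h C12 f gD gN (restrict (V c) T) = G c - (\<Sum>i<N. c i * load (b i))" for c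
  proof -
    let ?v = "restrict (V c) T"
    \<comment> \<open>The norms in \<open>J_h\<close> are \<open>p\<close>-th roots raised to the
      power \<open>p\<close>. Undoing this requires \<open>0 \<le> s\<close>, which is read off from
      the known sign of \<open>t\<close>.\<close>
    have root: "1/p * (s powr (1/p)) powr p = t" if "1/p * s = t" "0 \<le> t" for s t :: real
    proof -
      have "0 \<le> s" using that p by (auto simp: zero_le_divide_iff)
      then show ?thesis using p that(1) by (simp add: powr_powr)
    qed
    have "1/p * broken_integral T (\<lambda>K x. norm (D_DG T \<Gamma>D k C12 ?v gD K x) powr p) = (\<Sum>K\<in>T. 1/p * GK K c)"
      unfolding broken_integral_def GK_def sum_distrib_left
      by (intro sum.cong refl) (simp only: DDG affine_energy.energy_def[OF term_K])
    moreover have "0 \<le> (\<Sum>K\<in>T. 1/p * GK K c)"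
      unfolding GK_def using p
      by (intro sum_nonneg mult_nonneg_nonneg affine_energy.energy_nonneg(1) term_K) auto
    ultimately have 1: "1/p * (broken_integral T (\<lambda>K x. norm (D_DG T \<Gamma>D k C12 ?v gD K x) powr p)
        powr (1/p)) powr p = (\<Sum>K\<in>T. 1/p * GK K c)"
      by (rule root)
    have "1/p * face_integral (interior_faces T) (\<lambda>e x. norm (jump T ?v e x) powr p * (\<eta> e * h e powr (1 - p)))
        = (\<Sum>e\<in>interior_faces T. weight e * GI e c)"
      unfolding face_integral_def sum_distrib_left GI_def
      by (intro sum.cong refl) (simp add: affine_energy.energy_def[OF term_I] jump_restrict Vjump weight_def)
    moreover have "0 \<le> (\<Sum>e\<in>interior_faces T. weight e * GI e c)"
      unfolding GI_def
      by (intro sum_nonneg mult_nonneg_nonneg affine_energy.energy_nonneg(1) term_I less_imp_le[OF weight_pos]) auto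
    ultimately have 2: "1/p * (face_integral (interior_faces T)
          (\<lambda>e x. norm (jump T ?v e x) powr p * (\<eta> e * h e powr (1 - p))) powr (1/p)) powr p
        = (\<Sum>e\<in>interior_faces T. weight e * GI e c)"
      by (rule root)
    have "1/p * face_integral (boundary_faces T \<Gamma>D)
          (\<lambda>e x. \<bar>?v (?be e) x - gD x\<bar> powr p * (\<eta> e * h e powr (1 - p)))
        = (\<Sum>e\<in>boundary_faces T \<Gamma>D. weight e * GB e c)"
      unfolding face_integral_def sum_distrib_left GB_def
      by (intro sum.cong refl)
        (simp add: affine_energy.energy_def[OF term_B] boundary_element_in Vapp weight_def)
    moreover have "0 \<le> (\<Sum>e\<in>boundary_faces T \<Gamma>D. weight e * GB e c)"
      unfolding GB_def
      by (intro sum_nonneg mult_nonneg_nonneg affine_energy.energy_nonneg(1) term_B less_imp_le[OF weight_pos]) auto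
    ultimately have 3: "1/p * (face_integral (boundary_faces T \<Gamma>D)
          (\<lambda>e x. \<bar>?v (?be e) x - gD x\<bar> powr p * (\<eta> e * h e powr (1 - p))) powr (1/p)) powr p
        = (\<Sum>e\<in>boundary_faces T \<Gamma>D. weight e * GB e c)"
      by (rule root)
    have 4: "broken_integral T (\<lambda>K x. f x * ?v K x) = broken_integral T (\<lambda>K x. f x * V c K x)"
      unfolding broken_integral_def by (intro sum.cong refl) simp
    have 5: "face_integral (boundary_faces T \<Gamma>N) (\<lambda>e x. (gN x \<bullet> domain_normal \<Omega> x) * ?v (?be e) x) =
        face_integral (boundary_faces T \<Gamma>N) (\<lambda>e x. (gN x \<bullet> domain_normal \<Omega> x) * V c (?be e) x)"
      unfolding face_integral_def by (intro sum.cong refl) (simp add: boundary_element_in)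
    have "load (V c) = (\<Sum>i<N. c i * load (b i))"
      unfolding V_def using bW by (intro linear_functional_on_sum[OF load_linear subspace_W]) auto
    then show ?thesis
      unfolding J_h_def 1 2 3 4 5 G_def load_def by linarith
  qed
  have "\<exists>c. \<forall>c'. G c - (\<Sum>i<N. c i * load (b i)) \<le> G c' - (\<Sum>i<N. c' i * load (b i))"
    by (rule coercive_term_attains_min[OF p coercive]) (rule definite)
  then obtain c where c: "\<And>c'. G c - (\<Sum>i<N. c i * load (b i)) \<le> G c' - (\<Sum>i<N. c' i * load (b i))"
    by blast
  show ?thesis
  proof (intro bexI ballI)
    show "restrict (V c) T \<in> V_h T k" by (rule restrict_W[OF VW])
    fix v assume "v \<in> V_h T k"
    then obtain v' where v': "v' \<in> W" "v = restrict v' T" by (rule V_h_restrictE)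
    then obtain c' where "v' = V c'" using bspan unfolding V_def by blast
    then show "J_h \<Omega> \<Gamma>D \<Gamma>N T k p \<eta> h C12 f gD gN (restrict (V c) T)
        \<le> J_h \<Omega> \<Gamma>D \<Gamma>N T k p \<eta> h C12 f gD gN v"
      using c v'(2) by (simp only: J)
  qed
qed

end

theorem theorem4p1:
  fixes \<Omega> \<Gamma>D \<Gamma>N :: "(real^'n) set"
    and T :: "(real^'n) set set"
    and k :: nat
    and p p' :: real
    and \<eta> h :: "(real^'n) set \<Rightarrow> real"
    and C12 :: "(real^'n) set \<Rightarrow> real^'n"
    and f gD :: "real^'n \<Rightarrow> real"
    and gN :: "real^'n \<Rightarrow> real^'n"
  assumes "1 < p" and "1/p + 1/p' = 1"
    and "polyhedral \<Omega>" and "open \<Omega>" and "bounded \<Omega>" and "connected \<Omega>"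
    and "\<Gamma>D \<union> \<Gamma>N = frontier \<Omega>" and "\<Gamma>D \<inter> \<Gamma>N = {}"
    and "emeasure surface_measure \<Gamma>D > 0"
    and "in_Lp lebesgue p' \<Omega> f" and "in_dual_W1_0 p \<Omega> f"
    and "in_Ws (1/p') p \<Gamma>D gD"
    and "in_Lp surface_measure p' \<Gamma>N (\<lambda>x. gN x \<bullet> domain_normal \<Omega> x)"
    and "in_dual_Ws (1/p') p \<Gamma>N (\<lambda>x. gN x \<bullet> domain_normal \<Omega> x)"
    and "dg_mesh \<Omega> \<Gamma>D \<Gamma>N T"
    and "\<And>e. e \<in> interior_faces T \<union> boundary_faces T (frontier \<Omega>) \<Longrightarrow> \<eta> e > 0"
    and "\<And>e. e \<in> interior_faces T \<union> boundary_faces T (frontier \<Omega>) \<Longrightarrow> h e > 0"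
  shows "\<exists>u\<in>V_h T k. \<forall>v\<in>V_h T k.
    J_h \<Omega> \<Gamma>D \<Gamma>N T k p \<eta> h C12 f gD gN u \<le> J_h \<Omega> \<Gamma>D \<Gamma>N T k p \<eta> h C12 f gD gN v"
proof -
  interpret dg_data \<Omega> \<Gamma>D \<Gamma>N T k C12 p p' \<eta> h f gD gN
    using assms by unfold_locales (simp_all add: in_Ws_def)
  show ?thesis by (rule exists_minimiser)
qed

end
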